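(* Let $E$ be an elliptic curve over a finite field $\mathbb{F}_q$ with identity $\mathbf{O}$, and let $m$ be a positive integer. Suppose $P$ and $Q$ are $m$-torsion points on $E$ (over an extension field of $\mathbb{F}_q$), with neither $P$ nor $Q$ equal to $\mathbf{O}$ and $P \neq \pm Q$. Let $f_{m,P}$ and $f_{m,Q}$ be rational functions on $E$ with divisors $(f_{m,P}) = m(P) - m(\mathbf{O})$ and $(f_{m,Q}) = m(Q) - m(\mathbf{O})$. Then \[\frac{f_{m,P}(Q)\cdot f_{m,Q}(-P)}{f_{m,P}(-Q)\cdot f_{m,Q}(P)} = (-1)^m\, e_m(P,Q)^2.\]
   Context: Note the left-hand side does not depend on the choice of the functions $f_{m,P}$, $f_{m,Q}$, which are unique up to nonzero scalar multiples. The Weil pairing $e_m(P,Q)$ is defined as follows: choose divisors $\mathcal{A}_P$ and $\mathcal{A}_Q$ on $E$, linearly equivalent to $(P)-(\mathbf{O})$ and $(Q)-(\mathbf{O})$ respectively, with disjoint supports; let $f_{\mathcal{A}_P}$ and $f_{\mathcal{A}_Q}$ be rational functions on $E$ with divisors $m\mathcal{A}_P$ and $m\mathcal{A}_Q$. Then $e_m(P,Q) = f_{\mathcal{A}_P}(\mathcal{A}_Q)/f_{\mathcal{A}_Q}(\mathcal{A}_P)$, where for a function $f$ and a divisor $\sum n_i (R_i)$ disjoint from the zeros and poles of $f$, $f(\sum n_i(R_i)) = \prod f(R_i)^{n_i}$. *)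

theory Defs
  imports
    "HOL-Computational_Algebra.Computational_Algebra"
    "HOL-Library.Poly_Mapping"
begin

section \<open>Weierstrass curves\<close>

text \<open>
  The curve \<open>y\<^sup>2 + a1 x y + a3 y = x\<^sup>3 + a2 x\<^sup>2 + a4 x + a6\<close>, in long form so that
  characteristics 2 and 3 are included.
\<close>

datatype 'k weierstrass =
  Weierstrass (ec_a1: 'k) (ec_a2: 'k) (ec_a3: 'k) (ec_a4: 'k) (ec_a6: 'k)

text \<open>
  A bivariate polynomial is an element of \<open>K[x][y]\<close>: the coefficient of \<open>x\<^sup>i y\<^sup>j\<close> in \<open>F\<close> is
  \<^term>\<open>coeff (coeff F j) i\<close>.
\<close>

definition eval2 :: "'k::comm_ring_1 poly poly \<Rightarrow> 'k \<Rightarrow> 'k \<Rightarrow> 'k" where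
  "eval2 F x y = poly (poly F [:y:]) x"

definition weierstrass_poly :: "'k::comm_ring_1 weierstrass \<Rightarrow> 'k poly poly" where
  "weierstrass_poly E =
     [: - [:ec_a6 E, ec_a4 E, ec_a2 E, 1:], [:ec_a3 E, ec_a1 E:], 1 :]"

lemma eval2_weierstrass_poly:
  "eval2 (weierstrass_poly E) x y =
     y^2 + ec_a1 E * x * y + ec_a3 E * y - (x^3 + ec_a2 E * x^2 + ec_a4 E * x + ec_a6 E)"
  by (simp add: eval2_def weierstrass_poly_def power2_eq_square power3_eq_cube algebra_simps)

text \<open>
  \<open>Infinity\<close> is the unique point \<open>[0:1:0]\<close> of the projective curve on the line at infinity;
  it is the identity of the group law and is always a smooth point.
\<close>

datatype 'k point = Infinity | Affine 'k 'k

definition curve_points :: "'k::comm_ring_1 weierstrass \<Rightarrow> 'k point set" where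
  "curve_points E = insert Infinity {Affine x y | x y. eval2 (weierstrass_poly E) x y = 0}"

text \<open>
  Smoothness is tested at all points with coordinates in the algebraically closed field \<open>'k\<close>.
\<close>

definition elliptic_curve :: "'k::alg_closed_field weierstrass \<Rightarrow> bool" where
  "elliptic_curve E \<longleftrightarrow>
     (\<forall>x y. eval2 (weierstrass_poly E) x y = 0 \<longrightarrow>
        eval2 (map_poly pderiv (weierstrass_poly E)) x y \<noteq> 0 \<or>
        eval2 (pderiv (weierstrass_poly E)) x y \<noteq> 0)"

lemma eval2_partial_derivs:
  fixes E :: "'k::field weierstrass"
  shows "eval2 (map_poly pderiv (weierstrass_poly E)) x y =
           ec_a1 E * y - (3 * x^2 + 2 * ec_a2 E * x + ec_a4 E)"
    and "eval2 (pderiv (weierstrass_poly E)) x y = 2 * y + ec_a1 E * x + ec_a3 E"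
  by (simp_all add: eval2_def weierstrass_poly_def map_poly_pCons pderiv_pCons
        power2_eq_square algebra_simps)

definition field_embedding :: "('a::field \<Rightarrow> 'b::field) \<Rightarrow> bool" where
  "field_embedding \<iota> \<longleftrightarrow>
     \<iota> 1 = 1 \<and> (\<forall>x y. \<iota> (x + y) = \<iota> x + \<iota> y) \<and> (\<forall>x y. \<iota> (x * y) = \<iota> x * \<iota> y)"


section \<open>Group law\<close>

fun ec_neg :: "'k::field weierstrass \<Rightarrow> 'k point \<Rightarrow> 'k point" where
  "ec_neg E Infinity = Infinity"
| "ec_neg E (Affine x y) = Affine x (- y - ec_a1 E * x - ec_a3 E)"

text \<open>Here \<open>l\<close> is the slope of the chord or tangent through the two points.\<close>

fun ec_add :: "'k::field weierstrass \<Rightarrow> 'k point \<Rightarrow> 'k point \<Rightarrow> 'k point" where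
  "ec_add E Infinity Q = Q"
| "ec_add E P Infinity = P"
| "ec_add E (Affine x1 y1) (Affine x2 y2) =
     (if Affine x2 y2 = ec_neg E (Affine x1 y1) then Infinity
      else
        let l = (if x1 \<noteq> x2 then (y2 - y1) / (x2 - x1)
                 else (3 * x1^2 + 2 * ec_a2 E * x1 + ec_a4 E - ec_a1 E * y1)
                        / (2 * y1 + ec_a1 E * x1 + ec_a3 E));
            x3 = l^2 + ec_a1 E * l - ec_a2 E - x1 - x2
        in ec_neg E (Affine x3 (y1 + l * (x3 - x1))))"

definition ec_mult :: "'k::field weierstrass \<Rightarrow> nat \<Rightarrow> 'k point \<Rightarrow> 'k point" where
  "ec_mult E m P = (ec_add E P ^^ m) Infinity"

definition torsion_points :: "'k::field weierstrass \<Rightarrow> nat \<Rightarrow> 'k point set" where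
  "torsion_points E m = {P \<in> curve_points E. ec_mult E m P = Infinity}"


section \<open>Rational functions\<close>

text \<open>
  A rational function on \<open>E\<close> is represented by a fraction \<open>F/G\<close> in \<open>K(x,y)\<close> whose denominator
  does not vanish identically on \<open>E\<close>. Two such fractions represent the same element of the
  function field \<open>K(E)\<close>, the fraction field of \<open>K[x,y]/(W)\<close>, iff they are related by
  \<open>rf_eq\<close> below; all later notions depend only on the \<open>rf_eq\<close>-class.
\<close>

type_synonym 'k ratfun = "'k poly poly fract"

definition ratfuns :: "'k::field weierstrass \<Rightarrow> 'k ratfun set" where
  "ratfuns E = {Fract F G | F G. \<not> weierstrass_poly E dvd G}"

definition rf_eq :: "'k::field weierstrass \<Rightarrow> 'k ratfun \<Rightarrow> 'k ratfun \<Rightarrow> bool" where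
  "rf_eq E f g \<longleftrightarrow>
     (\<exists>F G. f - g = Fract F G \<and> weierstrass_poly E dvd F \<and> \<not> weierstrass_poly E dvd G)"

text \<open>
  Homogeneous forms of degree \<open>d\<close> in \<open>X, Y, Z\<close> correspond, by setting \<open>Z = 1\<close>, to
  bivariate polynomials of total degree at most \<open>d\<close>. \<open>form_value d F P\<close> is the value of the form
  at the representative \<open>(x,y,1)\<close> of an affine point, respectively \<open>(0,1,0)\<close> of \<open>Infinity\<close>; at
  the latter only the monomial \<open>Y\<^sup>d\<close> contributes.
\<close>

definition form_of_degree :: "nat \<Rightarrow> 'k::zero poly poly \<Rightarrow> bool" where
  "form_of_degree d F \<longleftrightarrow> (\<forall>i j. coeff (coeff F j) i \<noteq> 0 \<longrightarrow> i + j \<le> d)"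

fun form_value :: "nat \<Rightarrow> 'k::comm_ring_1 poly poly \<Rightarrow> 'k point \<Rightarrow> 'k" where
  "form_value d F (Affine x y) = eval2 F x y"
| "form_value d F Infinity = coeff (coeff F d) 0"

text \<open>
  \<open>f\<close> is regular at \<open>P\<close> with value \<open>c\<close>: on \<open>E\<close> it is a quotient of two forms of equal degree,
  the denominator not vanishing at \<open>P\<close>.
\<close>

definition has_value :: "'k::field weierstrass \<Rightarrow> 'k ratfun \<Rightarrow> 'k point \<Rightarrow> 'k \<Rightarrow> bool" where
  "has_value E f P c \<longleftrightarrow>
     (\<exists>d F G. form_of_degree d F \<and> form_of_degree d G \<and> form_value d G P \<noteq> 0 \<and>
        rf_eq E f (Fract F G) \<and> c = form_value d F P / form_value d G P)"

definition rf_value :: "'k::field weierstrass \<Rightarrow> 'k ratfun \<Rightarrow> 'k point \<Rightarrow> 'k" where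
  "rf_value E f P = (THE c. has_value E f P c)"

text \<open>A generator of the maximal ideal of the local ring of \<open>E\<close> at \<open>P\<close>.\<close>

definition uniformizer :: "'k::field weierstrass \<Rightarrow> 'k point \<Rightarrow> 'k ratfun \<Rightarrow> bool" where
  "uniformizer E P t \<longleftrightarrow>
     has_value E t P 0 \<and>
     (\<forall>g. has_value E g P 0 \<longrightarrow> (\<exists>h c. has_value E h P c \<and> rf_eq E g (t * h)))"

definition has_order :: "'k::field weierstrass \<Rightarrow> 'k ratfun \<Rightarrow> 'k point \<Rightarrow> int \<Rightarrow> bool" where
  "has_order E f P n \<longleftrightarrow>
     (\<exists>t u c. uniformizer E P t \<and> has_value E u P c \<and> c \<noteq> 0 \<and> rf_eq E f (t powi n * u))"


section \<open>Divisors and the Weil pairing\<close>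

type_synonym 'k divisor = "'k point \<Rightarrow>\<^sub>0 int"

definition divisors :: "'k::field weierstrass \<Rightarrow> 'k divisor set" where
  "divisors E = {D. Poly_Mapping.keys D \<subseteq> curve_points E}"

definition has_divisor :: "'k::field weierstrass \<Rightarrow> 'k ratfun \<Rightarrow> 'k divisor \<Rightarrow> bool" where
  "has_divisor E f D \<longleftrightarrow>
     f \<in> ratfuns E \<and> \<not> rf_eq E f 0 \<and> D \<in> divisors E \<and>
     (\<forall>P\<in>curve_points E. has_order E f P (Poly_Mapping.lookup D P))"

definition lin_equiv :: "'k::field weierstrass \<Rightarrow> 'k divisor \<Rightarrow> 'k divisor \<Rightarrow> bool" where
  "lin_equiv E D D' \<longleftrightarrow> D \<in> divisors E \<and> D' \<in> divisors E \<and> (\<exists>h. has_divisor E h (D - D'))"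

definition rf_value_div :: "'k::field weierstrass \<Rightarrow> 'k ratfun \<Rightarrow> 'k divisor \<Rightarrow> 'k" where
  "rf_value_div E f D =
     (\<Prod>R\<in>Poly_Mapping.keys D. rf_value E f R powi Poly_Mapping.lookup D R)"

definition weil_pairing ::
    "'k::field weierstrass \<Rightarrow> nat \<Rightarrow> 'k point \<Rightarrow> 'k point \<Rightarrow> 'k" where
  "weil_pairing E m P Q =
     (THE e. \<exists>A B f g.
        lin_equiv E A (frag_of P - frag_of Infinity) \<and>
        lin_equiv E B (frag_of Q - frag_of Infinity) \<and>
        Poly_Mapping.keys A \<inter> Poly_Mapping.keys B = {} \<and>
        has_divisor E f (frag_cmul (int m) A) \<and>
        has_divisor E g (frag_cmul (int m) B) \<and>
        e = rf_value_div E f B / rf_value_div E g A)"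

end

(*
  Everything is reduced to Weil reciprocity on the curve in the form with a tame symbol at infinity:
  if the divisors of f and g meet at most at the point O, then f(div g) = (-1)^(ord f ord g) g(div f),
  where the orders are those at O and leading coefficients at O replace the values there.

  For polynomials G = a + b y and F = c + d y without common zeros, y = - a/b at the zeros of G, so the
  product of the values of F there is a quotient of resultants of polynomials in x; exchanging F and G
  gives the same resultants up to leading coefficients, because b^2 N(F) and d^2 N(G) agree modulo
  c b - d a, where N is the norm to K[x]. Rational functions are written as quotients of
  polynomials that avoid a given finite set of points.

  By reciprocity the value f(B) / g(A) does not change if one of A, B is moved in its class. Taking
  B = (Q) - (O) and A = (P) - (O) + div h with ord h = 1 at O gives
  e(P,Q) = (-1)^m fP(Q) lc(fQ) / (fQ(P) lc(fP)), lc being the leading coefficient at O. Reciprocity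
  between fQ and x - x(P) gives fQ(P) fQ(-P) = lc(fQ)^2 (x(Q) - x(P))^m, and the same with P and
  Q exchanged; eliminating fQ(-P) and fP(-Q) yields the formula.
*)

theory Submission
  imports Defs
begin

section \<open>Polynomials over an algebraically closed field\<close>

text \<open>Nonconstant polynomial functions all have a pole at O, so reciprocity for disjoint
  divisors says nothing about two of them, and the symbol at O has to be carried along from the
  start. Its leading coefficients are read off under x -> t^2, y -> t^3, that is with respect to the
  parameter x/y at O; this makes them multiplicative. At the affine points disjointness remains an
  assumption, and numerators and denominators have to be chosen so that it holds. The divisors (P) -
  (O) and (Q) - (O) share O and are not an admissible choice for the pairing. Moving the first one
  off O brings in the orders of h and of f_Q there, which are 1 and -m; hence the sign (-1)^m in the
  formula for e. This sign disappears in e^2. The one in the theorem arises at the end: the two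
  instances of reciprocity with a vertical line contain (x(Q) - x(P))^m and (x(P) - x(Q))^m. Both
  are nonzero because P is neither Q nor -Q.\<close>

definition root_prod :: "'a::field poly \<Rightarrow> 'a poly \<Rightarrow> 'a" where
  "root_prod A B = (\<Prod>r\<in>#proots A. poly B r)"

lemma proots_factorization:
  fixes A :: "'a::alg_closed_field poly"
  assumes "A \<noteq> 0"
  shows "size (proots A) = degree A" "A = smult (lead_coeff A) (\<Prod>r\<in>#proots A. [:- r, 1:])"
proof -
  obtain S where S: "size S = degree A" "A = smult (lead_coeff A) (\<Prod>r\<in>#S. [:- r, 1:])"
    using alg_closed_imp_factorization[OF assms] by blast
  have *: "proots (\<Prod>r\<in>#S. [:- r, 1:]) = S" for S :: "'a multiset"
  proof (induction S)
    case (add x S)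
    have "(\<Prod>r\<in>#S. [:- r, 1:]) \<noteq> 0" by auto
    thus ?case using add.IH by (simp add: proots_mult del: mult_pCons_left)
  qed simp
  have "proots A = proots (smult (lead_coeff A) (\<Prod>r\<in>#S. [:- r, 1:]))"
    using S(2) by (rule arg_cong)
  also have "\<dots> = S" using assms * by simp
  finally have "proots A = S" .
  thus "size (proots A) = degree A" "A = smult (lead_coeff A) (\<Prod>r\<in>#proots A. [:- r, 1:])"
    using S by metis+
qed

lemma poly_via_roots:
  fixes A :: "'a::alg_closed_field poly"
  assumes "A \<noteq> 0"
  shows "poly A x = lead_coeff A * (\<Prod>r\<in>#proots A. x - r)"
proof -
  have "poly A x = poly (smult (lead_coeff A) (\<Prod>r\<in>#proots A. [:- r, 1:])) x"
    using proots_factorization(2)[OF assms] by (rule arg_cong)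
  thus ?thesis by (simp add: poly_prod_mset image_mset.compositionality o_def)
qed

lemma root_prod_mult_right: "root_prod A (B * C) = root_prod A B * root_prod A C"
  by (simp add: root_prod_def prod_mset.distrib)

lemma root_prod_power_right: "root_prod A (B ^ n) = root_prod A B ^ n"
  by (induction n) (simp_all add: root_prod_mult_right, simp add: root_prod_def)

lemma root_prod_cong: "A \<noteq> 0 \<Longrightarrow> A dvd B - C \<Longrightarrow> root_prod A B = root_prod A C"
  unfolding root_prod_def
proof (intro arg_cong[of _ _ prod_mset] image_mset_cong)
  fix r assume *: "A \<noteq> 0" "A dvd B - C" "r \<in># proots A"
  hence "poly A r = 0" by simp
  hence "poly (B - C) r = 0" using *(2) by (metis dvdE mult_zero_left poly_mult)
  thus "poly B r = poly C r" by simp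
qed

lemma root_prod_uminus: "root_prod (A :: 'a::alg_closed_field poly) (- B) = (- 1) ^ degree A * root_prod A B"
proof (cases "A = 0")
  case False
  have "root_prod A (- B) = root_prod A ([:- 1:] * B)" by simp
  also have "\<dots> = root_prod A [:- 1:] * root_prod A B" by (rule root_prod_mult_right)
  also have "root_prod A [:- 1:] = (- 1) ^ degree A"
    using proots_factorization(1)[OF False] by (simp add: root_prod_def)
  finally show ?thesis .
qed (simp add: root_prod_def)

lemma root_prod_nz: "A \<noteq> 0 \<Longrightarrow> (\<And>r. poly A r = 0 \<Longrightarrow> poly B r \<noteq> 0) \<Longrightarrow> root_prod A B \<noteq> 0"
  by (auto simp: root_prod_def)

text \<open>Symmetry of the resultant: \<open>root_prod A B\<close> is the resultant without its
  factor \<open>lead_coeff A ^ degree B\<close>, and both sides reduce to the product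
  \<open>D\<close> of all differences of a root of \<open>A\<close> and a root of
  \<open>B\<close>.\<close>

lemma root_prod_flip:
  fixes A B :: "'a::alg_closed_field poly"
  assumes "A \<noteq> 0" "B \<noteq> 0"
  shows "root_prod A B * lead_coeff A ^ degree B =
    (- 1) ^ (degree A * degree B) * root_prod B A * lead_coeff B ^ degree A"
proof -
  define D where "D = (\<Prod>r\<in>#proots A. \<Prod>q\<in>#proots B. r - q)"
  have 1: "root_prod A B = lead_coeff B ^ degree A * D"
    unfolding root_prod_def D_def poly_via_roots[OF assms(2)]
    using proots_factorization(1)[OF assms(1)] by (simp add: prod_mset.distrib)
  have "root_prod B A = lead_coeff A ^ degree B * (\<Prod>q\<in>#proots B. \<Prod>r\<in>#proots A. q - r)"
    unfolding root_prod_def poly_via_roots[OF assms(1)]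
    using proots_factorization(1)[OF assms(2)] by (simp add: prod_mset.distrib)
  also have "(\<Prod>q\<in>#proots B. \<Prod>r\<in>#proots A. q - r) = (\<Prod>r\<in>#proots A. \<Prod>q\<in>#proots B. (- 1) * (r - q))"
    by (subst prod_mset.swap) simp
  also have "\<dots> = (\<Prod>r\<in>#proots A. (- 1) ^ degree B * (\<Prod>q\<in>#proots B. r - q))"
    by (subst prod_mset.distrib) (simp add: proots_factorization(1)[OF assms(2)])
  also have "\<dots> = (- 1) ^ (degree A * degree B) * D"
    unfolding D_def prod_mset.distrib
    by (simp add: proots_factorization(1)[OF assms(1)] power_mult[symmetric] mult.commute)
  finally have "root_prod B A = lead_coeff A ^ degree B * ((- 1) ^ (degree A * degree B) * D)" .
  thus ?thesis unfolding 1 by (simp add: power_mult_distrib[symmetric] mult.assoc[symmetric])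
qed

text \<open>Linear factors at common roots are split off one by one. The factor \<open>e\<close> is
  kept monic so that passing from \<open>b\<close>, \<open>d\<close> to \<open>b'\<close>,
  \<open>d'\<close> does not change leading coefficients.\<close>

lemma extract_common_roots:
  fixes b d :: "'a::field poly"
  assumes "b \<noteq> 0" "d \<noteq> 0"
  shows "\<exists>e b' d'. b = e * b' \<and> d = e * d' \<and> lead_coeff e = 1 \<and> (\<forall>r. poly b' r \<noteq> 0 \<or> poly d' r \<noteq> 0)"
  using assms
proof (induction "degree b" arbitrary: b d rule: less_induct)
  case less
  show ?case
  proof (cases "\<exists>r. poly b r = 0 \<and> poly d r = 0")
    case False
    thus ?thesis by (intro exI[of _ 1] exI[of _ b] exI[of _ d]) auto
  next
    case True
    then obtain r b1 d1 where *: "b = [:- r, 1:] * b1" "d = [:- r, 1:] * d1"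
      by (metis dvdE poly_eq_0_iff_dvd)
    have nz: "b1 \<noteq> 0" "d1 \<noteq> 0" using less.prems * by auto
    hence "degree b1 < degree b" unfolding * by (subst degree_mult_eq) auto
    from less.hyps[OF this nz] obtain e b' d' where "b1 = e * b'" "d1 = e * d'" "lead_coeff e = 1"
      "\<forall>r. poly b' r \<noteq> 0 \<or> poly d' r \<noteq> 0" by blast
    moreover have "lead_coeff ([:- r, 1:] * e) = 1"
      using \<open>lead_coeff e = 1\<close> by (simp only: lead_coeff_mult) simp
    ultimately show ?thesis
      unfolding * by (intro exI[of _ "[:- r, 1:] * e"] exI[of _ b'] exI[of _ d']) (auto simp: mult.assoc simp del: mult_pCons_left)
  qed
qed

text \<open>The value at \<open>Infinity\<close> is a default; only affine points are
  projected.\<close>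

fun xco :: "'k::zero point \<Rightarrow> 'k" where "xco (Affine x y) = x" | "xco Infinity = 0"

text \<open>Otherwise the product of all \<open>x - a\<close>, increased by 1, would be a
  nonconstant polynomial without roots. Infinity of the field is what permits generic choices of
  slopes and constants later.\<close>

lemma infinite_alg_closed: "infinite (UNIV :: 'a::alg_closed_field set)"
proof
  assume fin: "finite (UNIV :: 'a set)"
  define p where "p = (\<Prod>a\<in>(UNIV :: 'a set). [:- a, 1:])"
  have "degree p = card (UNIV :: 'a set)" by (simp add: p_def degree_prod_eq_sum_degree)
  hence "degree p > 0" using fin by (simp add: card_gt_0_iff)
  hence "degree (p + 1) > 0" by (simp add: degree_add_eq_left)
  then obtain x where "poly (p + 1) x = 0" using alg_closed_imp_poly_has_root by blast
  moreover have "poly p x = 0" using fin by (auto simp: p_def poly_prod)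
  ultimately show False by simp
qed

section \<open>The coordinate ring\<close>

locale weierstrass_curve =
  fixes E :: "'k::field weierstrass"
begin

abbreviation W :: "'k poly poly" where "W \<equiv> weierstrass_poly E"

definition hpol :: "'k poly" where "hpol = [:ec_a3 E, ec_a1 E:]"

definition fpol :: "'k poly" where "fpol = [:ec_a6 E, ec_a4 E, ec_a2 E, 1:]"

lemma W_eq: "W = [:- fpol, hpol, 1:]"
  by (simp add: weierstrass_poly_def hpol_def fpol_def)

lemma degree_W: "degree W = 2"
  by (simp add: W_eq)


text \<open>Equality in the coordinate ring. The quotient ring is not formed; notions are defined on
  representatives and shown to respect this relation.\<close>

definition congW :: "'k poly poly \<Rightarrow> 'k poly poly \<Rightarrow> bool" (infix "\<doteq>" 50) where
  "F \<doteq> G \<longleftrightarrow> W dvd F - G"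

lemma congW_refl [simp, intro]: "F \<doteq> F"
  by (simp add: congW_def)

lemma congW_sym: "F \<doteq> G \<Longrightarrow> G \<doteq> F"
  by (simp add: congW_def) (metis dvd_minus_iff minus_diff_eq)

lemma congW_trans [trans]: "F \<doteq> G \<Longrightarrow> G \<doteq> H \<Longrightarrow> F \<doteq> H"
  unfolding congW_def using dvd_add[of W "F - G" "G - H"] by simp

lemma congW_0_iff: "F \<doteq> 0 \<longleftrightarrow> W dvd F"
  by (simp add: congW_def)

lemma congW_mult: "F \<doteq> G \<Longrightarrow> F' \<doteq> G' \<Longrightarrow> F * F' \<doteq> G * G'"
proof -
  assume "F \<doteq> G" "F' \<doteq> G'"
  hence "W dvd (F - G) * F' + G * (F' - G')"
    by (simp add: congW_def)
  thus ?thesis by (simp add: congW_def algebra_simps)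
qed

lemma congW_add: "F \<doteq> G \<Longrightarrow> F' \<doteq> G' \<Longrightarrow> F + F' \<doteq> G + G'"
  unfolding congW_def using dvd_add[of W "F - G" "F' - G'"] by (simp add: algebra_simps)


lemma congW_dvd: "F \<doteq> G \<Longrightarrow> W dvd F \<longleftrightarrow> W dvd G"
  unfolding congW_def using dvd_add[of W "F - G" G] dvd_diff[of W F "F - G"] by auto

lemma eval2_add: "eval2 (F + G) x y = eval2 F x y + eval2 G x (y::'k)"
  and eval2_diff: "eval2 (F - G) x y = eval2 F x y - eval2 G x (y::'k)"
  and eval2_mult: "eval2 (F * G) x y = eval2 F x y * eval2 G x (y::'k)"
  and eval2_power: "eval2 (F ^ n) x y = eval2 F x y ^ n"
  and eval2_1: "eval2 1 x (y::'k) = 1"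
  and eval2_pCons: "eval2 (pCons p F) x y = poly p x + y * eval2 F x y"
  and eval2_0: "eval2 0 x (y::'k) = 0"
  and eval2_smult: "eval2 (smult p F) x y = poly p x * eval2 F x y"
  by (simp_all add: eval2_def poly_power)

lemmas eval2_simps = eval2_add eval2_diff eval2_mult eval2_power eval2_1 eval2_pCons eval2_0 eval2_smult

definition on_curve :: "'k \<Rightarrow> 'k \<Rightarrow> bool" where
  "on_curve x y \<longleftrightarrow> eval2 W x y = 0"

lemma on_curve_iff: "on_curve x y \<longleftrightarrow> y\<^sup>2 + poly hpol x * y = poly fpol x"
  by (simp add: on_curve_def W_eq eval2_simps power2_eq_square algebra_simps)

lemma congW_eval2: "F \<doteq> G \<Longrightarrow> on_curve x y \<Longrightarrow> eval2 F x y = eval2 G x y"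
  unfolding congW_def on_curve_def dvd_def by (metis eval2_diff eval2_mult eq_iff_diff_eq_0 mult_zero_left)

lemma reduced_unique:
  assumes "[:a, b:] \<doteq> [:a', b':]"
  shows "a = a' \<and> b = b'"
proof -
  have "W dvd [:a - a', b - b':]" using assms by (simp add: congW_def)
  moreover have "degree [:a - a', b - b':] < degree W"
    by (simp add: degree_W)
  ultimately have "[:a - a', b - b':] = 0"
    using dvd_imp_degree_le leD by blast
  thus ?thesis by simp
qed

text \<open>
  As \<open>W\<close> is monic in \<open>y\<close>, pseudo-division by it is division with remainder \<open>rA F + rB F y\<close>.
\<close>

definition rA :: "'k poly poly \<Rightarrow> 'k poly" where "rA F = coeff (pseudo_mod F W) 0"
definition rB :: "'k poly poly \<Rightarrow> 'k poly" where "rB F = coeff (pseudo_mod F W) 1"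

abbreviation red :: "'k poly poly \<Rightarrow> 'k poly poly" where "red F \<equiv> [:rA F, rB F:]"

lemma red_cong: "F \<doteq> red F"
proof -
  have W0: "W \<noteq> 0" using degree_W by auto
  obtain q r where qr: "pseudo_divmod F W = (q, r)" by fastforce
  have lc: "coeff W (degree W) = 1"
    by (simp add: degree_W) (simp add: W_eq numeral_2_eq_2)
  from pseudo_divmod[OF W0 qr] lc have *: "F = W * q + r" "r = 0 \<or> degree r < 2"
    by (simp_all add: degree_W)
  have r: "r = pseudo_mod F W" using qr by (simp add: pseudo_mod_def)
  have "r = [:coeff r 0, coeff r 1:]"
    using *(2) by (intro poly_eqI) (auto simp: coeff_pCons coeff_eq_0 split: nat.splits)
  hence "r = red F" by (simp add: rA_def rB_def r)
  thus ?thesis using *(1) by (simp add: congW_def)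
qed

lemma red_eqI: "F \<doteq> [:a, b:] \<Longrightarrow> rA F = a \<and> rB F = b"
  using reduced_unique congW_trans congW_sym red_cong by blast

lemma red_reduced [simp]: "rA [:a, b:] = a" "rB [:a, b:] = b"
  using red_eqI[of "[:a, b:]" a b] by auto

lemma red_const [simp]: "rA [:a:] = a" "rB [:a:] = 0"
  using red_reduced[of a 0] by auto

lemma red_congW: "F \<doteq> G \<Longrightarrow> rA F = rA G \<and> rB F = rB G"
  using red_eqI red_cong congW_trans by blast

lemma dvd_red_iff: "W dvd F \<longleftrightarrow> rA F = 0 \<and> rB F = 0"
proof
  assume "W dvd F"
  hence "F \<doteq> [:0, 0:]" by (simp add: congW_0_iff)
  thus "rA F = 0 \<and> rB F = 0" by (rule red_eqI)
next
  assume "rA F = 0 \<and> rB F = 0"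
  thus "W dvd F" using red_cong[of F] by (simp add: congW_0_iff)
qed


lemma mult_reduced: "[:a, b:] * [:c, d:] \<doteq> [:a * c + b * d * fpol, a * d + b * c - b * d * hpol:]"
proof -
  have "[:a, b:] * [:c, d:] - [:a * c + b * d * fpol, a * d + b * c - b * d * hpol:] = [:b * d:] * W"
    by (simp add: W_eq algebra_simps)
  thus ?thesis unfolding congW_def by (metis dvd_triv_right)
qed

lemma red_mult:
  "rA (F * G) = rA F * rA G + rB F * rB G * fpol"
  "rB (F * G) = rA F * rB G + rB F * rA G - rB F * rB G * hpol"
  using red_eqI[OF congW_trans[OF congW_mult[OF red_cong[of F] red_cong[of G]] mult_reduced]] by auto

lemma red_add: "rA (F + G) = rA F + rA G" "rB (F + G) = rB F + rB G"
proof -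
  have "F + G \<doteq> [:rA F + rA G, rB F + rB G:]"
    using congW_add[OF red_cong[of F] red_cong[of G]] by simp
  from red_eqI[OF this] show "rA (F + G) = rA F + rA G" "rB (F + G) = rB F + rB G" by auto
qed

lemma red_pCons: 
  "rA (pCons c F) = c + rB F * fpol" "rB (pCons c F) = rA F - rB F * hpol"
proof -
  have *: "pCons c F = [:c, 0:] + [:0, 1:] * F" by simp
  show "rA (pCons c F) = c + rB F * fpol" "rB (pCons c F) = rA F - rB F * hpol"
    unfolding * red_add red_mult by (simp_all only: red_reduced) simp_all
qed

subsection \<open>Weights: the leading behaviour at infinity\<close>

text \<open>
  \<open>wt\<close> is the ring homomorphism \<open>K[x,y] \<rightarrow> K[t]\<close> with \<open>x \<mapsto> t\<^sup>2\<close>, \<open>y \<mapsto> t\<^sup>3\<close>. The degree of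
  the image of the reduced form of \<open>F\<close> is the pole order of \<open>F\<close> at infinity.
\<close>

definition sq :: "'k poly \<Rightarrow> 'k poly" where "sq p = pcompose p [:0, 0, 1:]"

definition wt :: "'k poly poly \<Rightarrow> 'k poly" where "wt F = poly (map_poly sq F) (monom 1 3)"

lemma sq_simps [simp]: "sq 0 = 0" "sq 1 = 1" "sq [:c:] = [:c:]" "sq (p + q) = sq p + sq q"
  "sq (p - q) = sq p - sq q" "sq (- p) = - sq p" "sq (p * q) = sq p * sq q"
  by (simp_all add: sq_def pcompose_1 pcompose_add pcompose_diff pcompose_uminus pcompose_mult)

lemma degree_sq [simp]: "degree (sq p) = 2 * degree p"
  by (simp add: sq_def degree_pcompose)

lemma sq_eq_0_iff [simp]: "sq p = 0 \<longleftrightarrow> p = 0"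
  by (simp add: sq_def pcompose_eq_0_iff)

lemma lead_coeff_sq [simp]: "lead_coeff (sq p) = lead_coeff p"
  by (simp add: sq_def lead_coeff_comp)

lemma coeff_sq: "coeff (sq p) n = (if even n then coeff p (n div 2) else 0)"
proof (induction p arbitrary: n)
  case (pCons a p)
  have "sq (pCons a p) = pCons a (pCons 0 (sq p))"
    by (simp add: sq_def pcompose_pCons)
  thus ?case
    by (auto simp: pCons.IH coeff_pCons split: nat.splits elim!: evenE oddE) 
qed auto

lemma wt_pCons [simp]: "wt (pCons c F) = sq c + monom 1 3 * wt F"
  by (simp add: wt_def map_poly_pCons)

lemma wt_0 [simp]: "wt 0 = 0" 
  by (simp add: wt_def)

lemma wt_add [simp]: "wt (F + G) = wt F + wt G"
proof (induction F arbitrary: G)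
  case (pCons a F)
  show ?case by (cases G) (simp add: pCons.IH distrib_left)
qed auto

lemma wt_smult [simp]: "wt (smult c F) = sq c * wt F"
  by (induction F) (simp_all add: algebra_simps)

lemma wt_mult: "wt (F * G) = wt F * wt G"
  by (induction F) (simp_all add: algebra_simps)

lemma wt_uminus [simp]: "wt (- F) = - wt F"
  by (induction F) (simp_all add: algebra_simps)

lemma wt_diff [simp]: "wt (F - G) = wt F - wt G"
  using wt_add[of F "- G"] by simp

text \<open>\<open>y^2\<close> and \<open>x^3\<close> both have weight 6 and cancel; the remaining
  terms have weight at most 5, the weight of \<open>x y\<close>. This gain of one is what makes
  leading coefficients at infinity multiplicative.\<close>

lemma degree_wt_W: "degree (wt W) \<le> 5"
proof -
  have "coeff (wt W) n = 0" if "n > 5" for n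
  proof -
    have "sq fpol = [:ec_a6 E, 0, ec_a4 E, 0, ec_a2 E, 0, 1:]"
      by (simp add: fpol_def sq_def pcompose_pCons)
    moreover have "sq hpol = [:ec_a3 E, 0, ec_a1 E:]"
      by (simp add: hpol_def sq_def pcompose_pCons)
    moreover have "monom (1::'k) 3 = [:0,0,0,1:]" by (simp add: monom_altdef numeral_3_eq_3)
    ultimately have "wt W = - [:ec_a6 E, 0, ec_a4 E, 0, ec_a2 E:] + [:0,0,0,ec_a3 E,0,ec_a1 E:]"
      by (simp add: W_eq)
    thus ?thesis using that by (auto simp: coeff_pCons split: nat.splits)
  qed
  thus ?thesis by (intro degree_le) auto
qed

text \<open>\<open>sq a\<close> has only even exponents and \<open>monom 1 3 * sq b\<close> only odd
  ones, so nothing cancels between them.\<close>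

lemma degree_wt_reduced_ge: "b \<noteq> 0 \<Longrightarrow> degree (wt [:a, b:]) \<ge> 2 * degree b + 3"
proof -
  assume b: "b \<noteq> 0"
  have "coeff (wt [:a, b:]) (2 * degree b + 3) = lead_coeff b"
    by (simp add: coeff_sq coeff_monom_mult)
  thus ?thesis using b by (intro le_degree) auto
qed

lemma wt_reduced_eq_0: "wt [:a, b:] = 0 \<Longrightarrow> a = 0 \<and> b = 0"
proof -
  assume *: "wt [:a, b:] = 0"
  hence "b = 0" using degree_wt_reduced_ge[of b a] by (cases "b = 0") auto
  thus ?thesis using * by simp
qed

text \<open>The product of two reduced forms has \<open>y^2\<close>-coefficient
  \<open>rB F * rB G\<close>, and reducing it subtracts that multiple of \<open>W\<close>.\<close>

lemma wt_red_mult: "wt (red (F * G)) = wt (red F) * wt (red G) - sq (rB F * rB G) * wt W"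
proof -
  have "red (F * G) = red F * red G - [:rB F * rB G:] * W"
    by (simp add: W_eq red_mult algebra_simps)
  hence "wt (red (F * G)) = wt (red F * red G - [:rB F * rB G:] * W)" by (rule arg_cong)
  also have "\<dots> = wt (red F) * wt (red G) - wt [:rB F * rB G:] * wt W"
    by (simp only: wt_diff wt_mult)
  finally show ?thesis by (simp del: wt_pCons add: wt_pCons[of _ 0])
qed

lemma wt_even:
  assumes "a \<noteq> 0" "b = 0 \<or> 2 * degree b + 3 < 2 * degree a"
  shows "degree (wt [:a, b:]) = 2 * degree a" "lead_coeff (wt [:a, b:]) = lead_coeff a"
proof -
  have eq: "wt [:a, b:] = monom 1 3 * sq b + sq a" by simp
  have less: "b = 0 \<or> degree (monom 1 3 * sq b) < degree (sq a)"
    using assms degree_mult_le[of "monom (1::'k) 3" "sq b"] by (auto simp: degree_monom_eq)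
  show "degree (wt [:a, b:]) = 2 * degree a"
    unfolding eq using less by (auto simp: degree_add_eq_right)
  show "lead_coeff (wt [:a, b:]) = lead_coeff a"
    unfolding eq using less lead_coeff_add_le[of "monom 1 3 * sq b" "sq a"] lead_coeff_sq[of a] by auto
qed

lemma wt_odd:
  assumes "b \<noteq> 0" "a = 0 \<or> 2 * degree a < 2 * degree b + 3"
  shows "degree (wt [:a, b:]) = 2 * degree b + 3" "lead_coeff (wt [:a, b:]) = lead_coeff b"
proof -
  have eq: "wt [:a, b:] = sq a + monom 1 3 * sq b" by simp
  have d: "degree (monom 1 3 * sq b) = 2 * degree b + 3" 
    using assms by (subst degree_mult_eq) (auto simp: degree_monom_eq)
  have l: "lead_coeff (monom 1 3 * sq b) = lead_coeff b"
    unfolding lead_coeff_mult using lead_coeff_sq[of b] by (simp add: degree_monom_eq)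
  have less: "a = 0 \<or> degree (sq a) < degree (monom 1 3 * sq b)"
    using assms d by auto
  show "degree (wt [:a, b:]) = 2 * degree b + 3"
    unfolding eq using less d by (auto simp: degree_add_eq_right)
  show "lead_coeff (wt [:a, b:]) = lead_coeff b"
    unfolding eq using less lead_coeff_add_le[of "sq a" "monom 1 3 * sq b"] l by auto
qed

definition pdeg :: "'k poly poly \<Rightarrow> nat" where "pdeg F = degree (wt (red F))"
definition plc :: "'k poly poly \<Rightarrow> 'k" where "plc F = lead_coeff (wt (red F))"

lemma wt_red_eq_0_iff: "wt (red F) = 0 \<longleftrightarrow> W dvd F"
  using wt_reduced_eq_0[of "rA F" "rB F"] by (auto simp: dvd_red_iff[of F])

lemma plc_nz: "\<not> W dvd F \<Longrightarrow> plc F \<noteq> 0"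
  using wt_red_eq_0_iff by (simp add: plc_def del: wt_pCons)

lemma pdeg_cases [consumes 1, case_names even odd]:
  assumes "\<not> W dvd F"
  obtains "rA F \<noteq> 0" "rB F = 0 \<or> 2 * degree (rB F) + 3 < 2 * degree (rA F)"
      "pdeg F = 2 * degree (rA F)" "plc F = lead_coeff (rA F)"
  | "rB F \<noteq> 0" "rA F = 0 \<or> 2 * degree (rA F) < 2 * degree (rB F) + 3"
      "pdeg F = 2 * degree (rB F) + 3" "plc F = lead_coeff (rB F)"
proof (cases "rA F \<noteq> 0 \<and> (rB F = 0 \<or> 2 * degree (rB F) + 3 < 2 * degree (rA F))")
  case True
  thus ?thesis using that(1) wt_even[of "rA F" "rB F"] by (simp add: pdeg_def plc_def del: wt_pCons)
next
  case False
  have "2 * degree (rB F) + 3 \<noteq> 2 * degree (rA F)" by presburger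
  hence "rB F \<noteq> 0" "rA F = 0 \<or> 2 * degree (rA F) < 2 * degree (rB F) + 3"
    using False assms by (auto simp: dvd_red_iff)
  thus ?thesis using that(2) wt_odd[of "rB F" "rA F"] by (simp add: pdeg_def plc_def del: wt_pCons)
qed

text \<open>If both \<open>y\<close>-parts are nonzero, the correction in \<open>wt_red_mult\<close>
  has degree at most \<open>2 * degree (rB F) + 2 * degree (rB G) + 5\<close>, whereas the two
  factors contribute at least \<open>2 * degree (rB F) + 3\<close> and
  \<open>2 * degree (rB G) + 3\<close>. The product wins by one and its top term survives.\<close>

lemma pdeg_plc_mult_aux:
  assumes "\<not> W dvd F" "\<not> W dvd G"
  shows "degree (wt (red (F * G))) = pdeg F + pdeg G \<and> lead_coeff (wt (red (F * G))) = plc F * plc G"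
proof (cases "rB F * rB G = 0")
  case True
  have "wt (red (F * G)) = wt (red F) * wt (red G)"
    unfolding wt_red_mult True by simp
  thus ?thesis
    using assms wt_red_eq_0_iff[of F] wt_red_eq_0_iff[of G] lead_coeff_mult[of "wt (red F)" "wt (red G)"]
    by (simp add: pdeg_def plc_def degree_mult_eq del: wt_pCons)
next
  case False
  let ?p = "wt (red F) * wt (red G)" and ?q = "- (sq (rB F * rB G) * wt W)"
  have dp: "degree ?p = pdeg F + pdeg G"
    using assms wt_red_eq_0_iff[of F] wt_red_eq_0_iff[of G]
    by (simp add: pdeg_def degree_mult_eq del: wt_pCons)
  have "degree ?q \<le> 2 * degree (rB F) + 2 * degree (rB G) + 5"
    using degree_mult_le[of "sq (rB F * rB G)" "wt W"] degree_wt_W False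
      degree_mult_eq[of "rB F" "rB G"]
    by (simp only: degree_minus degree_sq) simp
  also have "\<dots> < pdeg F + pdeg G"
    using False degree_wt_reduced_ge[of "rB F" "rA F"] degree_wt_reduced_ge[of "rB G" "rA G"]
    by (simp add: pdeg_def del: wt_pCons)
  finally have less: "degree ?q < degree ?p" using dp by simp
  have eq: "wt (red (F * G)) = ?q + ?p" unfolding wt_red_mult by simp
  have "lead_coeff (wt (red (F * G))) = lead_coeff ?p"
    unfolding eq by (rule lead_coeff_add_le[OF less])
  moreover have "degree (wt (red (F * G))) = degree ?p"
    unfolding eq by (rule degree_add_eq_right[OF less])
  moreover have "lead_coeff ?p = plc F * plc G" by (simp only: plc_def lead_coeff_mult)
  ultimately show ?thesis using dp by simp
qed

text \<open>Primality of \<open>W\<close> without any factorization argument: leading coefficients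
  at infinity multiply, so a product of nonzero elements of the coordinate ring is nonzero.\<close>

lemma W_dvd_mult_iff: "W dvd F * G \<longleftrightarrow> W dvd F \<or> W dvd G"
proof
  assume *: "W dvd F * G"
  show "W dvd F \<or> W dvd G"
  proof (rule ccontr)
    assume "\<not> (W dvd F \<or> W dvd G)"
    hence "lead_coeff (wt (red (F * G))) \<noteq> 0"
      using pdeg_plc_mult_aux[of F G] plc_nz by auto
    thus False using * wt_red_eq_0_iff by (metis leading_coeff_0_iff)
  qed
qed auto

lemma pdeg_mult: "\<not> W dvd F \<Longrightarrow> \<not> W dvd G \<Longrightarrow> pdeg (F * G) = pdeg F + pdeg G"
  and plc_mult: "\<not> W dvd F \<Longrightarrow> \<not> W dvd G \<Longrightarrow> plc (F * G) = plc F * plc G"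
  using pdeg_plc_mult_aux[of F G] by (auto simp: pdeg_def plc_def)

lemma pdeg_congW: "F \<doteq> G \<Longrightarrow> pdeg F = pdeg G"
  and plc_congW: "F \<doteq> G \<Longrightarrow> plc F = plc G"
  using red_congW[of F G] by (auto simp: pdeg_def plc_def)

lemma W_dvd_power_iff: "W dvd F ^ n \<longleftrightarrow> W dvd F \<and> n > 0"
proof (induction n)
  case 0
  have "\<not> W dvd 1" using red_const[of 1] dvd_red_iff[of 1] by (simp add: one_pCons)
  thus ?case by simp
qed (auto simp: W_dvd_mult_iff)

lemma W_not_dvd_1 [simp]: "\<not> W dvd 1"
  using W_dvd_power_iff[of 1 0] by simp

lemma W_dvd_const_iff [simp]: "W dvd [:p:] \<longleftrightarrow> p = 0"
  by (simp add: dvd_red_iff)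

lemma W_dvd_reduced_iff [simp]: "W dvd [:a, b:] \<longleftrightarrow> a = 0 \<and> b = 0"
  by (simp add: dvd_red_iff)

lemma congW_mult_cancel: "A * F \<doteq> A * G \<Longrightarrow> \<not> W dvd A \<Longrightarrow> F \<doteq> G"
  unfolding congW_def by (metis W_dvd_mult_iff right_diff_distrib)

subsection \<open>Conjugation and norm\<close>

text \<open>\<open>[:- hpol, - 1:]\<close> is \<open>- hpol - y\<close>, the ordinate of the
  negative of \<open>(x, y)\<close>: conjugation is the action of point negation on
  functions.\<close>

definition conj :: "'k poly poly \<Rightarrow> 'k poly poly" where "conj F = pcompose F [:- hpol, - 1:]"

definition nrm :: "'k poly poly \<Rightarrow> 'k poly" where
  "nrm F = (rA F)\<^sup>2 - rA F * rB F * hpol - (rB F)\<^sup>2 * fpol"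

lemma conj_mult: "conj (F * G) = conj F * conj G"
  and conj_diff: "conj (F - G) = conj F - conj G"
  by (simp_all add: conj_def pcompose_mult pcompose_diff)

lemma conj_power: "conj (F ^ n) = conj F ^ n"
  by (induction n) (simp_all add: conj_mult, simp add: conj_def pcompose_1)

lemma conj_const: "conj [:p:] = [:p:]" by (simp add: conj_def)

lemma conj_reduced: "conj [:a, b:] = [:a - b * hpol, - b:]"
  by (simp add: conj_def pcompose_pCons algebra_simps)

lemma conj_W: "conj W = W"
  by (simp add: conj_def W_eq pcompose_pCons algebra_simps)

lemma conj_congW: "F \<doteq> G \<Longrightarrow> conj F \<doteq> conj G"
  unfolding congW_def dvd_def by (metis conj_W conj_diff conj_mult)

lemma red_conj: "rA (conj F) = rA F - rB F * hpol" "rB (conj F) = - rB F"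
  using red_eqI[of "conj F"] conj_congW[OF red_cong[of F]] by (auto simp: conj_reduced)

lemma conj_nrm: "F * conj F \<doteq> [:nrm F:]"
proof -
  have "rA (F * conj F) = nrm F" "rB (F * conj F) = 0"
    by (simp_all add: red_mult red_conj nrm_def algebra_simps power2_eq_square)
  thus ?thesis using red_cong[of "F * conj F"] by simp
qed


lemma W_dvd_conj_iff: "W dvd conj F \<longleftrightarrow> W dvd F"
  by (auto simp: dvd_red_iff red_conj)

lemma nrm_eq_0_iff: "nrm F = 0 \<longleftrightarrow> W dvd F"
  using congW_dvd[OF conj_nrm[of F]] by (simp add: W_dvd_mult_iff W_dvd_conj_iff)


text \<open>To leading order conjugation is \<open>y\<close> to \<open>- y\<close>, which changes
  the sign exactly when the \<open>y\<close>-part dominates, that is for odd pole order. The term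
  \<open>rB F * hpol\<close> is too small to interfere, since \<open>hpol\<close> has degree at most
  1.\<close>

lemma pdeg_plc_conj:
  assumes "\<not> W dvd F"
  shows "pdeg (conj F) = pdeg F \<and> plc (conj F) = (- 1) ^ pdeg F * plc F"
proof -
  let ?a = "rA F" and ?b = "rB F"
  have conj: "red (conj F) = [:?a - ?b * hpol, - ?b:]" by (simp add: red_conj)
  have dh: "degree (?b * hpol) \<le> degree ?b + 1"
    using degree_mult_le[of ?b hpol] by (simp add: hpol_def split: if_splits)
  from assms show ?thesis
  proof (cases rule: pdeg_cases)
    case even
    have "degree (?b * hpol) < degree ?a \<or> ?b = 0"
      using even dh by auto
    hence *: "degree (?a - ?b * hpol) = degree ?a \<and> lead_coeff (?a - ?b * hpol) = lead_coeff ?a"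
    proof
      assume less: "degree (?b * hpol) < degree ?a"
      hence "degree (- (?b * hpol) + ?a) = degree ?a" by (intro degree_add_eq_right) simp
      moreover have "lead_coeff (- (?b * hpol) + ?a) = lead_coeff ?a"
        using less by (intro lead_coeff_add_le) simp
      ultimately show ?thesis by simp
    qed auto
    hence "?a - ?b * hpol \<noteq> 0" using even by (metis leading_coeff_0_iff)
    moreover have "coeff (?a - ?b * hpol) (degree ?a) = lead_coeff ?a" using * by metis
    ultimately    show ?thesis
      using wt_even[of "?a - ?b * hpol" "- ?b"] * even unfolding pdeg_def plc_def conj
      by (simp del: wt_pCons coeff_diff)
  next
    case odd
    have "degree (?a - ?b * hpol) \<le> max (degree ?a) (degree ?b + 1)"
      using degree_diff_le_max[of ?a "?b * hpol"] dh by linarith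
    hence "?a - ?b * hpol = 0 \<or> 2 * degree (?a - ?b * hpol) < 2 * degree (- ?b) + 3"
      using odd by auto
    thus ?thesis
      using wt_odd[of "- ?b" "?a - ?b * hpol"] odd unfolding pdeg_def plc_def conj by (simp del: wt_pCons)
  qed
qed

text \<open>\<open>F * conj F\<close> has pole order \<open>2 * pdeg F\<close> at infinity, and a
  polynomial in \<open>x\<close> has twice its degree.\<close>

lemma degree_nrm:
  assumes "\<not> W dvd F"
  shows "degree (nrm F) = pdeg F \<and> lead_coeff (nrm F) = (- 1) ^ pdeg F * (plc F)\<^sup>2"
proof -
  have nz: "\<not> W dvd conj F" "nrm F \<noteq> 0" using assms by (auto simp: W_dvd_conj_iff nrm_eq_0_iff)
  have *: "wt (red [:nrm F:]) = sq (nrm F)" by simp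
  have "2 * degree (nrm F) = pdeg [:nrm F:]" by (simp add: pdeg_def)
  also have "\<dots> = pdeg (F * conj F)" by (rule pdeg_congW[OF congW_sym[OF conj_nrm]])
  also have "\<dots> = 2 * pdeg F" using assms nz pdeg_plc_conj[of F] by (simp add: pdeg_mult)
  finally have 1: "degree (nrm F) = pdeg F" by simp
  have "lead_coeff (nrm F) = plc [:nrm F:]" unfolding plc_def * by (simp add: coeff_sq)
  also have "\<dots> = plc (F * conj F)" by (rule plc_congW[OF congW_sym[OF conj_nrm]])
  also have "\<dots> = (- 1) ^ pdeg F * (plc F)\<^sup>2"
    using assms nz pdeg_plc_conj[of F] by (simp add: plc_mult power2_eq_square)
  finally show ?thesis using 1 by simp
qed

subsection \<open>Forms and the point at infinity\<close>


lemma sq_smult [simp]: "sq (smult c p) = smult c (sq p)"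
  by (simp add: sq_def pcompose_smult)

definition weight_le :: "nat \<Rightarrow> 'k poly poly \<Rightarrow> bool" where
  "weight_le n F \<longleftrightarrow> (\<forall>i j. coeff (coeff F j) i \<noteq> 0 \<longrightarrow> 2 * i + 3 * j \<le> n)"

lemma wt_red_pCons: "wt (red (pCons c F)) = sq c + monom 1 3 * wt (red F) - sq (rB F) * wt W"
  by (simp add: red_pCons W_eq algebra_simps)

text \<open>Reduction replaces \<open>y^2\<close> by \<open>fpol - hpol y\<close>, whose part of
  weight 6 is \<open>x^3\<close> with the same image \<open>t^6\<close>. It therefore raises no
  weight and keeps the coefficient at the bounding weight.\<close>

lemma weight_le_imp:
  "weight_le n F \<Longrightarrow> degree (wt (red F)) \<le> n \<and> coeff (wt (red F)) n = coeff (wt F) n"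
proof (induction F arbitrary: n)
  case 0
  have "rA 0 = 0" "rB 0 = 0" using red_const[of 0] by simp_all
  thus ?case by simp
next
  case (pCons c F)
  have c: "degree (sq c) \<le> n"
  proof (cases "c = 0")
    case False
    hence "2 * degree c + 3 * 0 \<le> n"
      using pCons.prems unfolding weight_le_def by (metis coeff_pCons_0 leading_coeff_0_iff)
    thus ?thesis by simp
  qed simp
  show ?case
  proof (cases "F = 0")
    case True
    have "red (pCons c F) = [:c:]" using red_const[of c] True by simp
    thus ?thesis using c True by simp
  next
    case False
    have F: "2 * i + 3 * j + 3 \<le> n" if "coeff (coeff F j) i \<noteq> 0" for i j
      using pCons.prems that unfolding weight_le_def 
      by (metis coeff_pCons_Suc mult_Suc_right add.assoc add.commute)
    obtain j where j: "coeff F j \<noteq> 0" using False by (meson leading_coeff_0_iff)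
    then obtain i where "coeff (coeff F j) i \<noteq> 0" by (meson leading_coeff_0_iff)
    hence n: "n \<ge> 3" using F by fastforce
    have "weight_le (n - 3) F" unfolding weight_le_def using F by fastforce
    from pCons.IH[OF this] have IH: "degree (wt (red F)) \<le> n - 3"
      "coeff (wt (red F)) (n - 3) = coeff (wt F) (n - 3)" by auto
    \<comment> \<open>The \<open>y\<close>-part of the reduced form uses up
      \<open>2 * degree (rB F) + 3\<close> of the weight \<open>n - 3\<close>; since
      \<open>wt W\<close> has degree at most 5 and not 6, the inequality is strict.\<close>
    have d: "degree (sq (rB F) * wt W) < n"
    proof (cases "rB F = 0")
      case False
      have "2 * degree (rB F) + 3 \<le> n - 3"
        using degree_wt_reduced_ge[OF False, of "rA F"] IH(1) by linarith
      thus ?thesis using degree_mult_le[of "sq (rB F)" "wt W"] degree_wt_W n by simp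
    qed (use n in simp)
    have m: "degree (monom 1 3 * wt (red F)) \<le> n"
      using degree_mult_le[of "monom (1::'k) 3" "wt (red F)"] IH(1) n by (simp add: degree_monom_eq del: wt_pCons)
    have "degree (wt (red (pCons c F))) \<le> n"
      unfolding wt_red_pCons using c d m by (intro degree_diff_le degree_add_le) auto
    moreover have "coeff (wt (red (pCons c F))) n = coeff (wt (pCons c F)) n"
      unfolding wt_red_pCons wt_pCons[of c F] using n IH(2) coeff_eq_0[OF d]
      by (simp add: coeff_monom_mult del: wt_pCons)
    ultimately show ?thesis ..
  qed
qed

lemma form_imp_weight_le: "form_of_degree d F \<Longrightarrow> weight_le (3 * d) F"
proof -
  assume *: "form_of_degree d F"
  have "2 * i + 3 * j \<le> 3 * d" if "coeff (coeff F j) i \<noteq> 0" for i j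
  proof -
    have "i + j \<le> d" using * that unfolding form_of_degree_def by blast
    thus ?thesis by simp
  qed
  thus ?thesis unfolding weight_le_def by blast
qed

text \<open>In degree at most \<open>d\<close> the weight \<open>3 * d\<close> is reached by
  \<open>Y^d\<close> alone, the monomial that \<open>form_value\<close> reads off at
  \<open>Infinity\<close>.\<close>

lemma coeff_wt_form: "form_of_degree d F \<Longrightarrow> coeff (wt F) (3 * d) = coeff (coeff F d) 0"
proof (induction F arbitrary: d)
  case (pCons c F)
  show ?case
  proof (cases d)
    case 0
    thus ?thesis by (simp add: coeff_sq coeff_monom_mult)
  next
    case (Suc d')
    have "form_of_degree d' F"
      using pCons.prems unfolding form_of_degree_def Suc by (metis Suc_le_mono add_Suc_right coeff_pCons_Suc)
    moreover have "coeff (sq c) (3 * d) = 0"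
    proof -
      have "coeff c i = 0" if "i > d" for i
        using pCons.prems that unfolding form_of_degree_def by (metis add.right_neutral coeff_pCons_0 leD)
      moreover have "d < 3 * d div 2" if "even (3 * d)" using that Suc by presburger
      ultimately show ?thesis by (auto simp: coeff_sq)
    qed
    ultimately show ?thesis using pCons.IH Suc by (simp add: coeff_monom_mult)
  qed
qed simp

lemma form_at_infinity:
  assumes "form_of_degree d F"
  shows "degree (wt (red F)) \<le> 3 * d" "coeff (wt (red F)) (3 * d) = coeff (coeff F d) 0"
  using weight_le_imp[OF form_imp_weight_le[OF assms]] coeff_wt_form[OF assms] by auto

lemma pdeg_const: "pdeg [:p:] = 2 * degree p" and plc_const: "plc [:p:] = lead_coeff p"
  by (simp_all add: pdeg_def plc_def coeff_sq)

lemma pdeg_y: "pdeg [:0, 1:] = 3" and plc_y: "plc [:0, 1:] = 1"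
  by (simp_all add: pdeg_def plc_def degree_monom_eq)

lemma pdeg_plc_power:
  assumes "\<not> W dvd F"
  shows "pdeg (F ^ n) = n * pdeg F \<and> plc (F ^ n) = plc F ^ n"
proof (induction n)
  case 0
  show ?case using pdeg_const[of 1] plc_const[of 1] by (simp add: one_pCons)
next
  case (Suc n)
  thus ?case using assms by (simp add: pdeg_mult plc_mult W_dvd_power_iff)
qed

text \<open>Every natural number except 1 is of the form \<open>2 i + 3 j\<close>. The choice of
  \<open>i\<close> works because \<open>2 i\<close> is congruent to \<open>4 n\<close>, hence to
  \<open>n\<close>, modulo 3.\<close>

lemma monomial_with_weight:
  assumes "n \<noteq> 1"
  obtains i j where "2 * i + 3 * j = n" "i \<le> (2::nat)"
    "pdeg (monom (monom 1 i) j) = n" "plc (monom (monom 1 i) j) = 1"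
proof -
  define i where "i = (2 * n) mod 3"
  define j where "j = (n - 2 * i) div 3"
  have "i \<le> 2" by (simp add: i_def)
  have le: "2 * i \<le> n"
  proof -
    consider "n = 0" | "n = 2" | "n = 3" | "n \<ge> 4" using assms by linarith
    thus ?thesis by cases (use \<open>i \<le> 2\<close> in \<open>auto simp: i_def\<close>)
  qed
  have "2 * n = 3 * ((2 * n) div 3) + i" unfolding i_def by simp
  hence "n - 2 * i = 3 * (2 * ((2 * n) div 3) - n)" using le by linarith
  hence ij: "2 * i + 3 * j = n" using le unfolding j_def by simp
  have y: "[:0, 1:] ^ j = monom (1 :: 'k poly) j" by (simp add: monom_altdef)
  have M: "monom (monom 1 i) j = [:monom (1::'k) i:] * [:0, 1:] ^ j"
    unfolding y by (simp add: smult_monom)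
  have nz: "\<not> W dvd [:monom 1 i:]" "\<not> W dvd [:0, 1:] ^ j" by (simp_all add: W_dvd_power_iff)
  have "pdeg (monom (monom 1 i) j) = n" "plc (monom (monom 1 i) j) = 1"
    unfolding M pdeg_mult[OF nz] plc_mult[OF nz] using ij
    by (simp_all add: pdeg_const plc_const pdeg_plc_power pdeg_y plc_y degree_monom_eq)
  thus ?thesis using that ij \<open>i \<le> 2\<close> by blast
qed

text \<open>
  A function with a pole of order at most \<open>n\<close> at infinity and no other pole is a combination of the
  monomials \<open>x\<^sup>i y\<^sup>j\<close> with \<open>i \<le> 2\<close> and \<open>2 i + 3 j \<le> n\<close>; for \<open>n = 3 d\<close> these have degree at most \<open>d\<close>.
\<close>

lemma weighted_representative:
  "degree (wt (red F)) \<le> n \<Longrightarrow>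
     \<exists>F'. F' \<doteq> F \<and> (\<forall>i j. coeff (coeff F' j) i \<noteq> 0 \<longrightarrow> 2 * i + 3 * j \<le> n \<and> i \<le> 2)"
proof (induction n arbitrary: F rule: less_induct)
  case (less n)
  show ?case
  proof (cases "W dvd F")
    case True
    thus ?thesis by (intro exI[of _ 0]) (auto simp: congW_0_iff intro: congW_sym)
  next
    case nd: False
    show ?thesis
    proof (cases "n = 0")
      case True
      hence "pdeg F = 0" using less.prems by (simp add: pdeg_def del: wt_pCons)
      with nd have "rB F = 0" "degree (rA F) = 0" by (cases rule: pdeg_cases; simp)+
      then obtain c where "red F = [:[:c:]:]" by (metis degree_eq_zeroE pCons_0_0)
      hence "[:[:c:]:] \<doteq> F" using red_cong[of F] congW_sym by metis
      moreover have "coeff (coeff [:[:c:]:] j) i \<noteq> 0 \<longrightarrow> 2 * i + 3 * j \<le> n \<and> i \<le> 2" for i j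
        by (auto simp: coeff_pCons split: nat.splits)
      ultimately show ?thesis by blast
    next
      case False
      show ?thesis
      proof (cases "pdeg F < n")
        case True
        hence "degree (wt (red F)) \<le> n - 1" by (simp add: pdeg_def del: wt_pCons)
        from less.IH[OF _ this] False obtain F' where "F' \<doteq> F" 
          "\<forall>i j. coeff (coeff F' j) i \<noteq> 0 \<longrightarrow> 2 * i + 3 * j \<le> n - 1 \<and> i \<le> 2" by auto
        thus ?thesis by (intro exI[of _ F']) fastforce
      next
        case False
        hence n: "pdeg F = n" using less.prems by (simp add: pdeg_def del: wt_pCons)
        have "n \<noteq> 1" using nd n by (cases rule: pdeg_cases) auto
        then obtain i j where ij: "2 * i + 3 * j = n" "i \<le> 2"
          "pdeg (monom (monom 1 i) j) = n" "plc (monom (monom 1 i) j) = 1"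
          using monomial_with_weight by metis
        define M where "M = monom (monom (1::'k) i) j"
        define F1 where "F1 = F + [:[:- plc F:]:] * M"
        have w: "wt (red F1) = wt (red F) + [:- plc F:] * wt (red M)"
        proof -
          have "rA ([:[:- plc F:]:] * M) = [:- plc F:] * rA M" "rB ([:[:- plc F:]:] * M) = [:- plc F:] * rB M"
            by (simp_all only: red_mult red_const) simp_all
          thus ?thesis by (simp add: F1_def red_add sq_smult smult_add_right right_diff_distrib)
        qed
        have M1: "degree (wt (red M)) = n" "coeff (wt (red M)) n = 1"
          using ij unfolding M_def pdeg_def plc_def by auto
        have F1: "degree (wt (red F)) = n" "coeff (wt (red F)) n = plc F"
          using n unfolding pdeg_def plc_def by auto
        have "degree (wt (red F1)) \<le> n"
          unfolding w using F1(1) M1(1) degree_smult_le[of "- plc F" "wt (red M)"]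
          by (intro degree_add_le) (auto simp del: wt_pCons)
        moreover have "coeff (wt (red F1)) n = 0" unfolding w using F1 M1 by (simp del: wt_pCons)
        ultimately have "degree (wt (red F1)) \<le> n - 1"
          using \<open>n \<noteq> 0\<close> by (metis One_nat_def Suc_pred eq_zero_or_degree_less le_zero_eq less_Suc_eq_le neq0_conv degree_0 zero_le)
        from less.IH[OF _ this] \<open>n \<noteq> 0\<close> obtain F' where F': "F' \<doteq> F1" 
          "\<And>i j. coeff (coeff F' j) i \<noteq> 0 \<Longrightarrow> 2 * i + 3 * j \<le> n - 1 \<and> i \<le> 2" by auto
        have "F' + [:[:plc F:]:] * M \<doteq> F1 + [:[:plc F:]:] * M"
          by (intro congW_add F' congW_refl)
        also have "F1 + [:[:plc F:]:] * M = F" by (simp add: F1_def smult_add_left[symmetric])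
        finally have c: "F' + [:[:plc F:]:] * M \<doteq> F" .
        have "2 * i' + 3 * j' \<le> n \<and> i' \<le> 2" if "coeff (coeff (F' + [:[:plc F:]:] * M) j') i' \<noteq> 0" for i' j'
        proof (cases "coeff (coeff F' j') i' = 0")
          case True
          hence "i' = i" "j' = j" using that by (auto simp: M_def split: if_splits)
          thus ?thesis using ij by simp
        next
          case False
          thus ?thesis using F'(2)[OF False] by (meson diff_le_self le_trans)
        qed
        thus ?thesis using c by blast
      qed
    qed
  qed
qed

lemma form_representative:
  assumes "degree (wt (red F)) \<le> 3 * d"
  obtains F' where "F' \<doteq> F" "form_of_degree d F'"
proof -
  obtain F' where F': "F' \<doteq> F" "\<forall>i j. coeff (coeff F' j) i \<noteq> 0 \<longrightarrow> 2 * i + 3 * j \<le> 3 * d \<and> i \<le> 2"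
    using weighted_representative[OF assms] by blast
  \<comment> \<open>From \<open>2 i + 3 j \<le> 3 d\<close> alone one gets
    \<open>3 (i + j) \<le> 3 d + i\<close>; the bound \<open>i \<le> 2\<close> then gives the
    claim.\<close>
  have "i + j \<le> d" if "coeff (coeff F' j) i \<noteq> 0" for i j
    using F'(2)[rule_format, OF that] by linarith
  thus ?thesis using that F'(1) unfolding form_of_degree_def by blast
qed

lemma exists_form_degree: "\<exists>d. form_of_degree d (F :: 'k poly poly)"
proof -
  let ?S = "(\<lambda>j. degree (coeff F j)) ` {..degree F}"
  have "i + j \<le> Max ?S + degree F" if "coeff (coeff F j) i \<noteq> 0" for i j
  proof -
    have j: "j \<le> degree F" using that by (metis coeff_0 le_degree)
    have "i \<le> degree (coeff F j)" using that by (simp add: le_degree)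
    also have "\<dots> \<le> Max ?S" using j by (intro Max_ge) auto
    finally show ?thesis using j by simp
  qed
  thus ?thesis unfolding form_of_degree_def by blast
qed

lemma form_of_degree_mono: "form_of_degree d F \<Longrightarrow> d \<le> d' \<Longrightarrow> form_of_degree d' F"
  unfolding form_of_degree_def by (meson le_trans)

section \<open>The function field as fractions modulo \<open>W\<close>\<close>

lemma rf_eq_Fract:
  assumes "\<not> W dvd G" "\<not> W dvd B"
  shows "rf_eq E (Fract F G) (Fract A B) \<longleftrightarrow> F * B \<doteq> A * G"
proof -
  have nz: "G \<noteq> 0" "B \<noteq> 0" using assms by auto
  show ?thesis
  proof
    assume "rf_eq E (Fract F G) (Fract A B)"
    then obtain F' G' where *: "Fract (F * B - A * G) (G * B) = Fract F' G'" "W dvd F'" "\<not> W dvd G'"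
      using nz by (auto simp: rf_eq_def)
    have "G' \<noteq> 0" using * by auto
    hence "(F * B - A * G) * G' = F' * (G * B)" using * nz by (simp add: eq_fract)
    hence "W dvd (F * B - A * G) * G'" using *(2) by simp
    thus "F * B \<doteq> A * G" using *(3) by (simp add: W_dvd_mult_iff congW_def)
  next
    assume "F * B \<doteq> A * G"
    moreover have "Fract F G - Fract A B = Fract (F * B - A * G) (G * B)" using nz by simp
    ultimately show "rf_eq E (Fract F G) (Fract A B)"
      unfolding rf_eq_def congW_def using assms W_dvd_mult_iff by blast
  qed
qed

text \<open>The units of the localization of \<open>K[x,y]\<close> at the prime \<open>W\<close>,
  that is the fractions that restrict to nonzero elements of the function field. They form a group,
  on which orders and leading coefficients are homomorphisms.\<close>

definition nonzero_rf :: "'k ratfun \<Rightarrow> bool" where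
  "nonzero_rf f \<longleftrightarrow> (\<exists>F G. f = Fract F G \<and> \<not> W dvd F \<and> \<not> W dvd G)"

lemma nonzero_rfE:
  assumes "nonzero_rf f"
  obtains F G where "f = Fract F G" "\<not> W dvd F" "\<not> W dvd G" "F \<noteq> 0" "G \<noteq> 0"
  using assms unfolding nonzero_rf_def by (metis dvd_0_right)

lemma nonzero_rf_nz: "nonzero_rf f \<Longrightarrow> f \<noteq> 0"
  by (auto elim!: nonzero_rfE simp: Zero_fract_def eq_fract)

lemma nonzero_rf_Fract [intro]: "\<not> W dvd F \<Longrightarrow> \<not> W dvd G \<Longrightarrow> nonzero_rf (Fract F G)"
  unfolding nonzero_rf_def by blast

lemma nonzero_rf_mult: "nonzero_rf f \<Longrightarrow> nonzero_rf g \<Longrightarrow> nonzero_rf (f * g)"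
  by (auto elim!: nonzero_rfE intro!: nonzero_rf_Fract simp: W_dvd_mult_iff)

lemma nonzero_rf_1: "nonzero_rf 1"
  unfolding One_fract_def by (rule nonzero_rf_Fract) simp_all

lemma nonzero_rf_inverse: "nonzero_rf f \<Longrightarrow> nonzero_rf (inverse f)"
  by (auto elim!: nonzero_rfE simp: nonzero_rf_Fract)

lemma nonzero_rf_power: "nonzero_rf f \<Longrightarrow> nonzero_rf (f ^ n)"
  by (induction n) (auto intro: nonzero_rf_mult nonzero_rf_1)

lemma nonzero_rf_powi: "nonzero_rf f \<Longrightarrow> nonzero_rf (f powi n)"
  by (auto simp: power_int_def intro: nonzero_rf_power nonzero_rf_inverse)

lemma nonzero_rf_divide: "nonzero_rf f \<Longrightarrow> nonzero_rf g \<Longrightarrow> nonzero_rf (f / g)"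
  unfolding divide_inverse by (intro nonzero_rf_mult nonzero_rf_inverse)

lemma nonzero_rf_iff: "nonzero_rf f \<longleftrightarrow> f \<in> ratfuns E \<and> \<not> rf_eq E f 0"
proof
  assume "nonzero_rf f"
  then obtain F G where *: "f = Fract F G" "\<not> W dvd F" "\<not> W dvd G" by (auto elim: nonzero_rfE)
  moreover have "\<not> rf_eq E f 0"
    using rf_eq_Fract[of G 1 F 0] * by (simp add: congW_0_iff Zero_fract_def)
  ultimately show "f \<in> ratfuns E \<and> \<not> rf_eq E f 0" unfolding ratfuns_def by blast
next
  assume f: "f \<in> ratfuns E \<and> \<not> rf_eq E f 0"
  then obtain F G where *: "f = Fract F G" "\<not> W dvd G" unfolding ratfuns_def by blast
  hence "\<not> W dvd F" using f rf_eq_Fract[of G 1 F 0] by (auto simp: congW_0_iff Zero_fract_def)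
  thus "nonzero_rf f" using * by blast
qed

end

section \<open>Local parameters at the affine points\<close>

locale elliptic = weierstrass_curve E for E :: "'k::alg_closed_field weierstrass" +
  assumes smooth: "elliptic_curve E"
begin

definition negy :: "'k \<Rightarrow> 'k \<Rightarrow> 'k" where "negy r s = - s - poly hpol r"

lemma on_curve_negy: "on_curve r s \<Longrightarrow> on_curve r (negy r s)"
  by (simp add: on_curve_iff negy_def power2_eq_square algebra_simps)

lemma negy_negy [simp]: "negy r (negy r s) = s"
  by (simp add: negy_def)

lemma on_curve_fibre:
  assumes "on_curve r s" "on_curve r s'"
  shows "s' = s \<or> s' = negy r s"
proof -
  have "(s' - s) * (s' - negy r s) = 0"
    using assms by (simp add: on_curve_iff negy_def power2_eq_square algebra_simps)
  thus ?thesis by auto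
qed

lemma eval2_conj: "eval2 (conj F) r s = eval2 F r (negy r s)"
proof -
  have "eval2 (conj F) r s = poly (poly F [:negy r s:]) r"
  proof (induction F)
    case (pCons a F)
    have "conj (pCons a F) = [:a:] + [:- hpol, - 1:] * conj F"
      by (simp add: conj_def pcompose_pCons)
    hence "eval2 (conj (pCons a F)) r s = eval2 ([:a:] + [:- hpol, - 1:] * conj F) r s"
      by (rule arg_cong)
    also have "\<dots> = poly a r + negy r s * eval2 (conj F) r s"
      by (simp only: eval2_simps) (simp add: negy_def algebra_simps)
    finally show ?case by (simp add: pCons.IH)
  qed (simp add: conj_def eval2_def)
  thus ?thesis by (simp add: eval2_def)
qed

abbreviation vert :: "'k \<Rightarrow> 'k poly poly" where "vert r \<equiv> [:[:- r, 1:]:]"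

text \<open>At a point equal to its negative the vertical line is tangent, and \<open>y - s\<close>
  is the parameter; elsewhere \<open>x - r\<close> is.\<close>

definition lpar :: "'k \<Rightarrow> 'k \<Rightarrow> 'k poly poly" where
  "lpar r s = (if s = negy r s then [:[:- s:], 1:] else vert r)"

lemma eval2_lpar [simp]: "eval2 (lpar r s) r s = 0"
  by (simp add: lpar_def eval2_simps)

lemma W_dvd_lpar [simp]: "\<not> W dvd lpar r s"
  by (simp add: lpar_def)

text \<open>
  \<^term>\<open>vrel r s F n c\<close> says that \<open>F\<close> has order \<open>n\<close> at \<open>(r, s)\<close> and that the quotient of \<open>F\<close> by
  the \<open>n\<close>-th power of the local parameter takes the value \<open>c\<close> there.
\<close>

definition vrel :: "'k \<Rightarrow> 'k \<Rightarrow> 'k poly poly \<Rightarrow> nat \<Rightarrow> 'k \<Rightarrow> bool" where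
  "vrel r s F n c \<longleftrightarrow> (\<exists>G H. F * G \<doteq> lpar r s ^ n * H \<and> eval2 G r s \<noteq> 0 \<and> eval2 H r s \<noteq> 0 \<and>
     c = eval2 H r s / eval2 G r s)"

lemma vrelI: "F * G \<doteq> lpar r s ^ n * H \<Longrightarrow> eval2 G r s \<noteq> 0 \<Longrightarrow> eval2 H r s \<noteq> 0 \<Longrightarrow>
   vrel r s F n (eval2 H r s / eval2 G r s)"
  by (auto simp: vrel_def)

lemma vrel_nz: "vrel r s F n c \<Longrightarrow> c \<noteq> 0"
  by (auto simp: vrel_def)

text \<open>The two representations of \<open>F\<close> are cross-multiplied, the common power of
  the parameter is cancelled, and the rest is evaluated at the point; a surplus factor of the
  parameter would make one side vanish.\<close>

lemma vrel_unique_aux: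
  assumes "on_curve r s" "vrel r s F n c" "vrel r s F m d" "n \<le> m"
  shows "n = m \<and> c = d"
proof -
  let ?t = "lpar r s"
  from assms(2) obtain G H where 1: "F * G \<doteq> ?t ^ n * H" "eval2 G r s \<noteq> 0" "eval2 H r s \<noteq> 0"
    "c = eval2 H r s / eval2 G r s" by (auto simp: vrel_def)
  from assms(3) obtain G' H' where 2: "F * G' \<doteq> ?t ^ m * H'" "eval2 G' r s \<noteq> 0" "eval2 H' r s \<noteq> 0"
    "d = eval2 H' r s / eval2 G' r s" by (auto simp: vrel_def)
  have "(?t ^ n * H) * G' \<doteq> (F * G) * G'" by (intro congW_mult congW_sym[OF 1(1)] congW_refl)
  also have "(F * G) * G' = (F * G') * G" by (simp add: ac_simps)
  also have "\<dots> \<doteq> (?t ^ m * H') * G" by (intro congW_mult 2(1) congW_refl)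
  also have "\<dots> = ?t ^ n * (?t ^ (m - n) * H' * G)"
    using assms(4) by (simp add: power_add[symmetric] mult.assoc[symmetric])
  finally have "?t ^ n * (H * G') \<doteq> ?t ^ n * (?t ^ (m - n) * H' * G)" by (simp only: mult.assoc)
  hence "H * G' \<doteq> ?t ^ (m - n) * H' * G"
    by (rule congW_mult_cancel) (simp add: W_dvd_power_iff)
  from congW_eval2[OF this assms(1)] have 
    *: "eval2 H r s * eval2 G' r s = 0 ^ (m - n) * eval2 H' r s * eval2 G r s"
    by (simp add: eval2_simps)
  have "m - n = 0"
  proof (rule ccontr)
    assume "m - n \<noteq> 0"
    hence z: "(0::'k) ^ (m - n) = 0" by simp
    have "eval2 H r s * eval2 G' r s = 0" using * unfolding z by simp
    thus False using 1 2 by simp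
  qed
  hence "eval2 H r s * eval2 G' r s = eval2 H' r s * eval2 G r s" using * by simp
  thus ?thesis using \<open>m - n = 0\<close> 1 2 assms(4) by (simp add: frac_eq_eq)
qed

lemma vrel_unique:
  assumes "on_curve r s" "vrel r s F n c" "vrel r s F m d"
  shows "n = m" "c = d"
proof -
  have "n = m \<and> c = d"
  proof (cases "n \<le> m")
    case True
    show ?thesis by (rule vrel_unique_aux[OF assms True])
  next
    case False
    hence "m \<le> n" by simp
    from vrel_unique_aux[OF assms(1,3,2) this] show ?thesis by blast
  qed
  thus "n = m" "c = d" by blast+
qed

lemma vrel_mult:
  assumes "vrel r s F n c" "vrel r s F' m d"
  shows "vrel r s (F * F') (n + m) (c * d)"
proof -
  let ?t = "lpar r s"
  from assms(1) obtain G H where 1: "F * G \<doteq> ?t ^ n * H" "eval2 G r s \<noteq> 0" "eval2 H r s \<noteq> 0"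
    "c = eval2 H r s / eval2 G r s" by (auto simp: vrel_def)
  from assms(2) obtain G' H' where 2: "F' * G' \<doteq> ?t ^ m * H'" "eval2 G' r s \<noteq> 0" "eval2 H' r s \<noteq> 0"
    "d = eval2 H' r s / eval2 G' r s" by (auto simp: vrel_def)
  have "(F * F') * (G * G') \<doteq> ?t ^ (n + m) * (H * H')"
    using congW_mult[OF 1(1) 2(1)] by (simp add: power_add ac_simps)
  from vrelI[OF this] 1 2 show ?thesis by (simp add: eval2_simps)
qed

lemma vrel_congW: "F \<doteq> F' \<Longrightarrow> vrel r s F n c \<Longrightarrow> vrel r s F' n c"
proof -
  assume F: "F \<doteq> F'" and "vrel r s F n c"
  then obtain G H where *: "F * G \<doteq> lpar r s ^ n * H" "eval2 G r s \<noteq> 0" "eval2 H r s \<noteq> 0"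
    "c = eval2 H r s / eval2 G r s" by (auto simp: vrel_def)
  have "F' * G \<doteq> F * G" by (intro congW_mult congW_sym[OF F] congW_refl)
  also note *(1)
  finally show ?thesis using vrelI * by metis
qed

lemma vrel_0_iff: 
  assumes "eval2 F r s \<noteq> 0"
  shows "vrel r s F 0 (eval2 F r s)"
  using vrelI[of F 1 r s 0 F] assms by (simp add: eval2_simps)

lemma vrel_lpar: "vrel r s (lpar r s) 1 1"
  using vrelI[of "lpar r s" 1 r s 1 1] by (simp add: eval2_simps)

lemma vrel_power: "vrel r s F n c \<Longrightarrow> vrel r s (F ^ k) (k * n) (c ^ k)"
proof (induction k)
  case 0
  show ?case using vrel_0_iff[of 1] by (simp add: eval2_simps)
next
  case (Suc k)
  thus ?case using vrel_mult[of r s F n c "F ^ k" "k * n" "c ^ k"] by simp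
qed

lemma vert_unramified: "s \<noteq> negy r s \<Longrightarrow> vrel r s (vert r) 1 1"
  using vrel_lpar[of r s] by (simp add: lpar_def)

lemma W_partials:
  "eval2 (map_poly pderiv W) x y = y * poly (pderiv hpol) x - poly (pderiv fpol) x"
  "eval2 (pderiv W) x y = 2 * y + poly hpol x"
  unfolding eval2_partial_derivs
  by (simp_all add: hpol_def fpol_def pderiv_pCons power2_eq_square algebra_simps)

lemma smooth': "on_curve x y \<Longrightarrow>
    y * poly (pderiv hpol) x - poly (pderiv fpol) x \<noteq> 0 \<or> y \<noteq> negy x y"
proof -
  assume "on_curve x y"
  hence "y * poly (pderiv hpol) x - poly (pderiv fpol) x \<noteq> 0 \<or> 2 * y + poly hpol x \<noteq> 0"
    using smooth unfolding elliptic_curve_def on_curve_def W_partials by blast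
  thus ?thesis by (simp add: negy_def algebra_simps eq_neg_iff_add_eq_0)
qed

text \<open>Smoothness is used here: up to sign, \<open>U\<close> takes the value of \<open>\<partial>W/\<partial>x\<close> at the point.\<close>

lemma ramified_unit:
  assumes "on_curve r s" "s = negy r s"
  obtains U where "vert r * U \<doteq> [:[:- s:], 1:]\<^sup>2" "eval2 U r s \<noteq> 0"
proof -
  \<comment> \<open>In powers of \<open>y - s\<close> the curve polynomial is
    \<open>(y - s)^2 + (hpol + 2 s) (y - s) - p\<close>. At a point equal to its negative both lower
    coefficients vanish at \<open>r\<close>, so \<open>x - r\<close> splits off and \<open>U\<close>
    is the cofactor.\<close>
  define p where "p = fpol - [:s:] * hpol - [:s\<^sup>2:]"
  have "poly fpol r = s\<^sup>2 + poly hpol r * s" using assms(1) by (simp add: on_curve_iff)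
  hence "poly p r = 0" by (simp add: p_def)
  then obtain u where u: "p = [:- r, 1:] * u"
    by (metis dvdE poly_eq_0_iff_dvd)
  have "poly (pderiv p) r = poly u r"
    unfolding u by (simp add: pderiv_mult pderiv_pCons del: mult_pCons_left)
  moreover have "poly (pderiv p) r = poly (pderiv fpol) r - s * poly (pderiv hpol) r"
    by (simp add: p_def pderiv_diff pderiv_smult)
  ultimately have ur: "poly u r \<noteq> 0" using smooth'[OF assms(1)] assms(2) by auto
  have h2: "hpol + [:2 * s:] = [:- r, 1:] * [:ec_a1 E:]"
  proof -
    have "s + s = - (ec_a3 E + r * ec_a1 E)"
      using arg_cong[OF assms(2), of "\<lambda>z. s + z"] by (simp add: negy_def hpol_def)
    hence "ec_a3 E + 2 * s = - (r * ec_a1 E)" by (simp only: mult_2) simp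
    thus ?thesis by (simp add: hpol_def algebra_simps)
  qed
  define U where "U = [:u:] - [:[:ec_a1 E:]:] * [:[:- s:], 1:]"
  have "vert r * U = [:p:] - [:hpol + [:2 * s:]:] * [:[:- s:], 1:]"
    unfolding U_def u h2 by (simp add: algebra_simps)
  also have "\<dots> = [:[:- s:], 1:]\<^sup>2 - W"
    by (simp add: p_def W_eq power2_eq_square algebra_simps)
  finally have eq: "vert r * U = [:[:- s:], 1:]\<^sup>2 - W" .
  have eq': "[:[:- s:], 1:]\<^sup>2 - vert r * U = W"
    unfolding eq by (simp only: diff_diff_eq2 add_diff_cancel_left')
  have "vert r * U \<doteq> [:[:- s:], 1:]\<^sup>2"
    by (rule congW_sym) (simp only: congW_def eq' dvd_refl)
  moreover have "eval2 U r s \<noteq> 0" using ur by (simp add: U_def eval2_simps)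
  ultimately show ?thesis using that by blast
qed

lemma vert_ramified:
  assumes "on_curve r s" "s = negy r s"
  obtains c where "vrel r s (vert r) 2 c"
proof -
  obtain U where U: "vert r * U \<doteq> [:[:- s:], 1:]\<^sup>2" "eval2 U r s \<noteq> 0"
    using ramified_unit[OF assms] .
  hence "vert r * U \<doteq> lpar r s ^ 2 * 1" using assms(2) by (simp add: lpar_def)
  from vrelI[OF this U(2)] show ?thesis using that by (simp add: eval2_simps)
qed

text \<open>In \<open>a + b y = (a + s b) + b (y - s)\<close> the first summand is divisible by
  \<open>x - r\<close>, which has order 2 here, so the second summand determines the order.\<close>

lemma vrel_ramified_1:
  assumes "on_curve r s" "s = negy r s" "poly a r + s * poly b r = 0" "poly b r \<noteq> 0"
  obtains c where "vrel r s [:a, b:] 1 c"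
proof -
  obtain U where U: "vert r * U \<doteq> [:[:- s:], 1:]\<^sup>2" "eval2 U r s \<noteq> 0"
    using ramified_unit[OF assms(1,2)] .
  have "poly (a + [:s:] * b) r = 0" using assms(3) by simp
  then obtain a' where a': "a + [:s:] * b = [:- r, 1:] * a'"
    by (metis dvdE poly_eq_0_iff_dvd)
  let ?t = "[:[:- s:], 1:]"
  have "[:a, b:] = [:a + [:s:] * b:] + [:b:] * ?t" by simp
  also have "\<dots> = vert r * [:a':] + [:b:] * ?t" unfolding a' by (simp add: mult.commute)
  finally have "[:a, b:] * U = (vert r * [:a':] + [:b:] * ?t) * U" by (rule arg_cong)
  also have "\<dots> = (vert r * U) * [:a':] + ?t * ([:b:] * U)"
    by (simp only: distrib_right distrib_left ac_simps)
  also have "\<dots> \<doteq> ?t\<^sup>2 * [:a':] + ?t * ([:b:] * U)"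
    by (intro congW_add congW_mult U congW_refl)
  also have "\<dots> = lpar r s ^ 1 * (?t * [:a':] + [:b:] * U)"
  proof -
    have "lpar r s = ?t" using assms(2) by (simp add: lpar_def)
    thus ?thesis by (simp only: power2_eq_square distrib_left mult.assoc power_one_right)
  qed
  finally have "[:a, b:] * U \<doteq> lpar r s ^ 1 * (?t * [:a':] + [:b:] * U)" .
  from vrelI[OF this U(2)] show ?thesis using that assms(4) U(2) by (simp add: eval2_simps)
qed

lemma both_zero_unramified:
  assumes "s \<noteq> negy r s" "poly a r + s * poly b r = 0" "poly a r + negy r s * poly b r = 0"
  shows "poly a r = 0 \<and> poly b r = 0"
proof -
  have "(s - negy r s) * poly b r = (poly a r + s * poly b r) - (poly a r + negy r s * poly b r)"
    by (simp add: algebra_simps)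
  hence "(s - negy r s) * poly b r = 0" by (simp only: assms) simp
  thus ?thesis using assms by auto
qed

lemma nrm_decomp:
  assumes "nrm F \<noteq> 0"
  obtains c where "nrm F = [:- r, 1:] ^ order r (nrm F) * c" "poly c r \<noteq> 0"
  using order_decomp[OF assms, of r] poly_eq_0_iff_dvd by metis

text \<open>At an unramified point where \<open>a + b y\<close> vanishes its conjugate does not,
  since otherwise \<open>a\<close> and \<open>b\<close> would both vanish at \<open>r\<close>. The
  conjugate is then a unit, and the order is that of the norm at \<open>r\<close>.\<close>

lemma vrel_primitive:
  assumes "on_curve r s" "poly a r \<noteq> 0 \<or> poly b r \<noteq> 0"
  shows "\<exists>n c. vrel r s [:a, b:] n c"
proof (cases "eval2 [:a, b:] r s = 0")
  case False
  thus ?thesis using vrel_0_iff by blast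
next
  case True
  hence 0: "poly a r + s * poly b r = 0" by (simp add: eval2_simps)
  show ?thesis
  proof (cases "s = negy r s")
    case ram: True
    have "poly b r \<noteq> 0" using 0 assms(2) by auto
    thus ?thesis using vrel_ramified_1[OF assms(1) ram 0] by metis
  next
    case False
    let ?F = "[:a, b:]"
    have conj: "eval2 (conj ?F) r s \<noteq> 0"
      using both_zero_unramified[OF False 0] assms(2) unfolding eval2_conj by (auto simp: eval2_simps)
    have "nrm ?F \<noteq> 0" using assms(2) by (auto simp: nrm_eq_0_iff)
    from nrm_decomp[OF this, of r] obtain c where
      c: "nrm ?F = [:- r, 1:] ^ order r (nrm ?F) * c" "poly c r \<noteq> 0" .
    have "[:nrm ?F:] = lpar r s ^ order r (nrm ?F) * [:c:]"
      using False by (subst c(1)) (simp add: lpar_def poly_const_pow mult.commute)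
    hence "?F * conj ?F \<doteq> lpar r s ^ order r (nrm ?F) * [:c:]" using conj_nrm by metis
    moreover have "eval2 [:c:] r s \<noteq> 0" using c(2) by (simp add: eval2_simps)
    ultimately show ?thesis using vrelI[OF _ conj] by blast
  qed
qed

lemma vrel_vert_exists: "on_curve r s \<Longrightarrow> \<exists>n c. vrel r s (vert r) n c"
  using vert_unramified vert_ramified by metis

text \<open>Common factors \<open>x - r\<close> are split off as vertical lines until
  \<open>vrel_primitive\<close> applies.\<close>

lemma vrel_exists_reduced:
  assumes "on_curve r s"
  shows "a \<noteq> 0 \<or> b \<noteq> 0 \<Longrightarrow> \<exists>n c. vrel r s [:a, b:] n c"
proof (induction "degree a + degree b" arbitrary: a b rule: less_induct)
  case less
  show ?case
  proof (cases "poly a r = 0 \<and> poly b r = 0")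
    case True
    then obtain a' b' where *: "a = [:- r, 1:] * a'" "b = [:- r, 1:] * b'"
      by (metis dvdE poly_eq_0_iff_dvd)
    have "degree a' \<le> degree a" "degree b' \<le> degree b" "a' \<noteq> 0 \<longrightarrow> degree a' < degree a"
         "b' \<noteq> 0 \<longrightarrow> degree b' < degree b"
      by (cases "a' = 0"; cases "b' = 0"; simp add: * degree_mult_eq del: mult_pCons_left)+
    moreover have nz: "a' \<noteq> 0 \<or> b' \<noteq> 0" using less.prems * by auto
    ultimately have "degree a' + degree b' < degree a + degree b" by auto
    from less.hyps[OF this nz] obtain n c where "vrel r s [:a', b':] n c" by blast
    moreover obtain m d where "vrel r s (vert r) m d" using vrel_vert_exists[OF assms] by blast
    ultimately have "vrel r s (vert r * [:a', b':]) (m + n) (d * c)" by (rule vrel_mult[rotated])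
    moreover have "vert r * [:a', b':] = [:a, b:]" unfolding * by simp
    ultimately show ?thesis by metis
  next
    case False
    thus ?thesis using vrel_primitive[OF assms] by blast
  qed
qed

lemma vrel_exists:
  assumes "on_curve r s" "\<not> W dvd F"
  shows "\<exists>n c. vrel r s F n c"
  using vrel_exists_reduced[OF assms(1), of "rA F" "rB F"] assms(2) vrel_congW[OF congW_sym[OF red_cong[of F]]]
  unfolding dvd_red_iff[of F] by blast

lemma vrel_not_dvd: 
  assumes "on_curve r s" "vrel r s F n c"
  shows "\<not> W dvd F"
proof
  assume "W dvd F"
  from assms(2) obtain G H where "F * G \<doteq> lpar r s ^ n * H" "eval2 H r s \<noteq> 0" by (auto simp: vrel_def)
  hence "W dvd lpar r s ^ n * H" using congW_dvd dvd_mult2[OF \<open>W dvd F\<close>] by blast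
  hence "W dvd H" by (auto simp: W_dvd_mult_iff W_dvd_power_iff)
  hence "eval2 H r s = 0" using congW_eval2[of H 0] assms(1) by (simp add: congW_0_iff eval2_simps)
  thus False using \<open>eval2 H r s \<noteq> 0\<close> by simp
qed

section \<open>Order and leading coefficient at an affine point\<close>

definition aord :: "'k \<Rightarrow> 'k \<Rightarrow> 'k poly poly \<Rightarrow> nat" where
  "aord r s F = (THE n. \<exists>c. vrel r s F n c)"
definition alc :: "'k \<Rightarrow> 'k \<Rightarrow> 'k poly poly \<Rightarrow> 'k" where
  "alc r s F = (THE c. \<exists>n. vrel r s F n c)"

lemma aord_alc_eqI:
  assumes "on_curve r s" "vrel r s F n c"
  shows "aord r s F = n" "alc r s F = c"
  unfolding aord_def alc_def using vrel_unique[OF assms(1)] assms(2) by blast+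

lemma vrel_aord: "on_curve r s \<Longrightarrow> \<not> W dvd F \<Longrightarrow> vrel r s F (aord r s F) (alc r s F)"
  using vrel_exists aord_alc_eqI by metis

lemma aord_mult: "on_curve r s \<Longrightarrow> \<not> W dvd F \<Longrightarrow> \<not> W dvd G \<Longrightarrow> aord r s (F * G) = aord r s F + aord r s G"
  and alc_mult: "on_curve r s \<Longrightarrow> \<not> W dvd F \<Longrightarrow> \<not> W dvd G \<Longrightarrow> alc r s (F * G) = alc r s F * alc r s G"
  using aord_alc_eqI vrel_mult vrel_aord by metis+

lemma aord_congW: "on_curve r s \<Longrightarrow> \<not> W dvd F \<Longrightarrow> F \<doteq> G \<Longrightarrow> aord r s F = aord r s G"
  and alc_congW: "on_curve r s \<Longrightarrow> \<not> W dvd F \<Longrightarrow> F \<doteq> G \<Longrightarrow> alc r s F = alc r s G"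
  using aord_alc_eqI vrel_congW vrel_aord by metis+

lemma alc_nz: "on_curve r s \<Longrightarrow> \<not> W dvd F \<Longrightarrow> alc r s F \<noteq> 0"
  using vrel_aord vrel_nz by metis

lemma aord_eq_0_iff:
  assumes "on_curve r s" "\<not> W dvd F"
  shows "aord r s F = 0 \<longleftrightarrow> eval2 F r s \<noteq> 0"
proof
  assume "aord r s F = 0"
  hence "vrel r s F 0 (alc r s F)" using vrel_aord[OF assms] by simp
  then obtain G H where *: "F * G \<doteq> H" "eval2 H r s \<noteq> 0" by (auto simp: vrel_def)
  show "eval2 F r s \<noteq> 0" using congW_eval2[OF *(1) assms(1)] *(2) by (auto simp: eval2_simps)
next
  assume "eval2 F r s \<noteq> 0"
  thus "aord r s F = 0" using aord_alc_eqI[OF assms(1)] vrel_0_iff by blast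
qed

lemma alc_eval: "on_curve r s \<Longrightarrow> eval2 F r s \<noteq> 0 \<Longrightarrow> alc r s F = eval2 F r s"
  using aord_alc_eqI vrel_0_iff by blast

lemma aord_lpar: "on_curve r s \<Longrightarrow> aord r s (lpar r s) = 1"
  using aord_alc_eqI vrel_lpar by blast

subsection \<open>Order and norm\<close>

text \<open>The factor 1 or 2 is the ramification index of the projection to the x-line.\<close>

lemma aord_const:
  assumes "on_curve r s" "p \<noteq> 0"
  shows "aord r s [:p:] = (if s = negy r s then 2 else 1) * order r p"
proof -
  from order_decomp[OF assms(2), of r] obtain q where 
    q: "p = [:- r, 1:] ^ order r p * q" "poly q r \<noteq> 0" using poly_eq_0_iff_dvd by metis
  have "[:p:] = vert r ^ order r p * [:q:]" 
    by (subst q(1)) (simp add: poly_const_pow mult.commute)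
  moreover have "vrel r s [:q:] 0 (poly q r)" using vrel_0_iff[of "[:q:]" r s] q(2) by (simp add: eval2_simps)
  moreover obtain c where "vrel r s (vert r) (if s = negy r s then 2 else 1) c"
    by (cases "s = negy r s") (use vert_unramified vert_ramified[OF assms(1)] in \<open>auto\<close>)
  ultimately have "vrel r s [:p:] (order r p * (if s = negy r s then 2 else 1) + 0) (c ^ order r p * poly q r)"
    by (simp only: vrel_mult vrel_power)
  from aord_alc_eqI(1)[OF assms(1) this] show ?thesis by simp
qed

lemma aord_conj_unramified:
  assumes "on_curve r s" "\<not> W dvd F" "s \<noteq> negy r s"
  shows "aord r s (conj F) = aord r (negy r s) F"
proof -
  let ?s = "negy r s"
  have "vrel r ?s F (aord r ?s F) (alc r ?s F)" using assms on_curve_negy vrel_aord by blast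
  then obtain G H where *: "F * G \<doteq> lpar r ?s ^ aord r ?s F * H" "eval2 G r ?s \<noteq> 0" "eval2 H r ?s \<noteq> 0"
    by (auto simp: vrel_def)
  have l: "lpar r ?s = vert r" "lpar r s = vert r" using assms(3) by (auto simp: lpar_def)
  have "conj F * conj G \<doteq> lpar r s ^ aord r ?s F * conj H"
    using conj_congW[OF *(1)] unfolding l by (simp add: conj_mult conj_power conj_const)
  from vrelI[OF this] * show ?thesis using aord_alc_eqI(1)[OF assms(1)] by (simp add: eval2_conj)
qed

lemma aord_nrm:
  assumes "on_curve r s" "\<not> W dvd F"
  shows "aord r s F + aord r s (conj F) = (if s = negy r s then 2 else 1) * order r (nrm F)"
proof -
  have "aord r s F + aord r s (conj F) = aord r s (F * conj F)"
    using assms by (simp add: aord_mult W_dvd_conj_iff)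
  also have "\<dots> = aord r s [:nrm F:]"
    using assms by (intro aord_congW conj_nrm) (auto simp: W_dvd_mult_iff W_dvd_conj_iff)
  finally show ?thesis using assms by (simp add: aord_const nrm_eq_0_iff)
qed

text \<open>Conjugation fixes the point, hence maps units to units, and it maps the parameter
  \<open>y - s\<close> to another function of order 1.\<close>

lemma aord_conj_ramified:
  assumes "on_curve r s" "\<not> W dvd F" "s = negy r s"
  shows "aord r s (conj F) = aord r s F"
proof -
  let ?t = "[:[:- s:], 1:]"
  have t: "lpar r s = ?t" using assms(3) by (simp add: lpar_def)
  have ct: "conj ?t = [:[:- s:] - hpol, - 1:]" by (simp add: conj_reduced)
  have "vrel r s (conj ?t) 1 (alc r s (conj ?t))"
  proof -
    have "poly ([:- s:] - hpol) r + s * poly (- 1) r = 0"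
    proof -
      have "s = - s - poly hpol r" using assms(3) by (simp add: negy_def)
      thus ?thesis by simp
    qed
    from vrel_ramified_1[OF assms(1,3) this] obtain c where "vrel r s [:[:- s:] - hpol, - 1:] 1 c" by auto
    thus ?thesis unfolding ct using aord_alc_eqI[OF assms(1)] by metis
  qed
  moreover have "vrel r s F (aord r s F) (alc r s F)" using assms vrel_aord by blast
  then obtain G H where *: "F * G \<doteq> ?t ^ aord r s F * H" "eval2 G r s \<noteq> 0" "eval2 H r s \<noteq> 0"
    by (auto simp: vrel_def t)
  have G: "vrel r s (conj G) 0 (eval2 (conj G) r s)" and H: "vrel r s (conj H) 0 (eval2 (conj H) r s)"
    using * eval2_conj[of _ r s, folded assms(3)] vrel_0_iff[of "conj G" r s] vrel_0_iff[of "conj H" r s]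
    by simp_all
  have "conj F * conj G \<doteq> conj ?t ^ aord r s F * conj H"
    using conj_congW[OF *(1)] by (simp only: conj_mult conj_power)
  from aord_congW[OF assms(1) _ this] have "aord r s (conj F * conj G) = aord r s (conj ?t ^ aord r s F * conj H)"
    using assms vrel_not_dvd[OF assms(1) G] by (simp add: W_dvd_mult_iff W_dvd_conj_iff)
  moreover have "aord r s (conj F * conj G) = aord r s (conj F)"
    using aord_alc_eqI[OF assms(1) G] vrel_not_dvd[OF assms(1) G] assms by (simp add: aord_mult W_dvd_conj_iff)
  moreover have "aord r s (conj ?t ^ aord r s F * conj H) = aord r s F * 1 + 0"
    by (rule aord_alc_eqI(1)[OF assms(1)], rule vrel_mult[OF vrel_power H]) fact
  ultimately show ?thesis by simp
qed

text \<open>The norm counts the zeros of \<open>F\<close> above \<open>r\<close>. At a branch point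
  \<open>F\<close> and \<open>conj F\<close> have equal order, and this 2 cancels against the
  ramification index.\<close>

lemma order_nrm:
  assumes "on_curve r s" "\<not> W dvd F"
  shows "order r (nrm F) = (if s = negy r s then aord r s F else aord r s F + aord r (negy r s) F)"
  using aord_nrm[OF assms] aord_conj_ramified[OF assms] aord_conj_unramified[OF assms] by (auto split: if_splits)

section \<open>Orders and leading coefficients of rational functions\<close>

subsection \<open>Orders at all points\<close>

fun ordp :: "'k point \<Rightarrow> 'k poly poly \<Rightarrow> int" where
  "ordp (Affine r s) F = int (aord r s F)"
| "ordp Infinity F = - int (pdeg F)"

fun lcp :: "'k point \<Rightarrow> 'k poly poly \<Rightarrow> 'k" where
  "lcp (Affine r s) F = alc r s F"
| "lcp Infinity F = plc F"

lemma Affine_curve_iff: "Affine r s \<in> curve_points E \<longleftrightarrow> on_curve r s"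
  by (auto simp: curve_points_def on_curve_def)

lemma curve_pointsE:
  assumes "P \<in> curve_points E"
  obtains "P = Infinity" | r s where "P = Affine r s" "on_curve r s"
  using assms Affine_curve_iff by (cases P) auto

lemma Infinity_curve [simp]: "Infinity \<in> curve_points E"
  by (simp add: curve_points_def)

definition rord :: "'k point \<Rightarrow> 'k ratfun \<Rightarrow> int" where
  "rord P f = (THE n. \<exists>F G. f = Fract F G \<and> \<not> W dvd F \<and> \<not> W dvd G \<and> n = ordp P F - ordp P G)"

definition rlc :: "'k point \<Rightarrow> 'k ratfun \<Rightarrow> 'k" where
  "rlc P f = (THE c. \<exists>F G. f = Fract F G \<and> \<not> W dvd F \<and> \<not> W dvd G \<and> c = lcp P F / lcp P G)"

context
  fixes P :: "'k point"
  assumes P: "P \<in> curve_points E"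
begin

lemma ordp_mult: "\<not> W dvd F \<Longrightarrow> \<not> W dvd G \<Longrightarrow> ordp P (F * G) = ordp P F + ordp P G"
  and lcp_mult: "\<not> W dvd F \<Longrightarrow> \<not> W dvd G \<Longrightarrow> lcp P (F * G) = lcp P F * lcp P G"
  using P by (auto elim!: curve_pointsE simp: aord_mult alc_mult pdeg_mult plc_mult)

lemma ordp_congW: "\<not> W dvd F \<Longrightarrow> F \<doteq> G \<Longrightarrow> ordp P F = ordp P G"
  and lcp_congW: "\<not> W dvd F \<Longrightarrow> F \<doteq> G \<Longrightarrow> lcp P F = lcp P G"
  using P by (auto elim!: curve_pointsE intro: aord_congW alc_congW pdeg_congW plc_congW)

lemma lcp_nz: "\<not> W dvd F \<Longrightarrow> lcp P F \<noteq> 0"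
  using P by (auto elim!: curve_pointsE simp: alc_nz plc_nz)

text \<open>The line at infinity meets the curve three times in \<open>Infinity\<close>. Setting
  \<open>Z = 1\<close> in a form of degree \<open>d\<close> that is nonzero there therefore produces
  a pole of order \<open>3 d\<close>.\<close>

abbreviation (input) form_base :: "nat \<Rightarrow> int" where
  "form_base d \<equiv> (if P = Infinity then - 3 * int d else 0)"

lemma form_value_dvd: 
  assumes "form_of_degree d A" "W dvd A"
  shows "form_value d A P = 0"
proof (cases P)
  case Infinity
  have "wt (red A) = 0" using assms(2) wt_red_eq_0_iff by blast
  thus ?thesis using form_at_infinity(2)[OF assms(1)] Infinity by (simp del: wt_pCons)
next
  case (Affine r s)
  hence "on_curve r s" using P Affine_curve_iff by simp
  from congW_eval2[OF _ this, of A 0] assms(2) Affine show ?thesis 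
    by (simp add: congW_0_iff eval2_simps)
qed

lemma form_value_nonzero:
  assumes "form_of_degree d A" "form_value d A P \<noteq> 0"
  shows "\<not> W dvd A" "ordp P A = form_base d" "lcp P A = form_value d A P"
proof -
  show nd: "\<not> W dvd A" using form_value_dvd assms by blast
  have "ordp P A = form_base d \<and> lcp P A = form_value d A P"
  proof (cases P)
    case Infinity
    have "degree (wt (red A)) = 3 * d"
      using form_at_infinity[OF assms(1)] assms(2) Infinity by (intro antisym le_degree) auto
    thus ?thesis
      using Infinity form_at_infinity[OF assms(1)] by (simp add: pdeg_def plc_def del: wt_pCons)
  next
    case (Affine r s)
    hence "on_curve r s" using P Affine_curve_iff by simp
    thus ?thesis using assms(2) Affine nd by (simp add: aord_eq_0_iff alc_eval)
  qed
  thus "ordp P A = form_base d" "lcp P A = form_value d A P" by auto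
qed

lemma form_value_zero:
  assumes "form_of_degree d A" "form_value d A P = 0" "\<not> W dvd A"
  shows "ordp P A > form_base d"
proof (cases P)
  case Infinity
  have "degree (wt (red A)) \<noteq> 3 * d"
    using form_at_infinity(2)[OF assms(1)] assms Infinity wt_red_eq_0_iff[of A]
    by (metis form_value.simps(2) leading_coeff_0_iff)
  thus ?thesis
    using Infinity form_at_infinity(1)[OF assms(1)] by (simp add: pdeg_def del: wt_pCons)
next
  case (Affine r s)
  hence "on_curve r s" using P Affine_curve_iff by simp
  hence "aord r s A \<noteq> 0" using assms Affine by (simp add: aord_eq_0_iff)
  thus ?thesis using Affine by (simp add:)
qed

section \<open>Regular functions and their values in terms of orders\<close>

lemma has_value_imp:
  assumes "\<not> W dvd G" "has_value E (Fract F G) P c"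
  shows "(W dvd F \<and> c = 0) \<or> (\<not> W dvd F \<and> ordp P F > ordp P G \<and> c = 0) \<or>
    (\<not> W dvd F \<and> ordp P F = ordp P G \<and> c = lcp P F / lcp P G)"
proof -
  from assms(2) obtain d A B where *: "form_of_degree d A" "form_of_degree d B" "form_value d B P \<noteq> 0"
    "rf_eq E (Fract F G) (Fract A B)" "c = form_value d A P / form_value d B P"
    unfolding has_value_def by blast
  note B = form_value_nonzero[OF *(2,3)]
  have eq: "F * B \<doteq> A * G" using rf_eq_Fract[OF assms(1) B(1)] *(4) by blast
  hence dvd: "W dvd F \<longleftrightarrow> W dvd A" using congW_dvd[OF eq] B(1) assms(1) by (simp add: W_dvd_mult_iff)
  show ?thesis
  proof (cases "W dvd F")
    case True
    thus ?thesis using dvd form_value_dvd[OF *(1)] *(5) by simp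
  next
    case False
    hence A: "\<not> W dvd A" using dvd by simp
    have "\<not> W dvd F * B" using False B by (simp add: W_dvd_mult_iff)
    from ordp_congW[OF this eq] lcp_congW[OF this eq] have
      ol: "ordp P F + ordp P B = ordp P A + ordp P G" "lcp P F * lcp P B = lcp P A * lcp P G"
      using False A B assms(1) by (simp_all add: ordp_mult lcp_mult)
    show ?thesis
    proof (cases "form_value d A P = 0")
      case True
      thus ?thesis using form_value_zero[OF *(1) True A] ol(1) B(2) False *(5) by simp
    next
      case False
      note A' = form_value_nonzero[OF *(1) False]
      have "lcp P F / lcp P G = lcp P A / lcp P B"
        using ol(2) lcp_nz[OF assms(1)] lcp_nz[OF B(1)] by (simp add: frac_eq_eq)
      thus ?thesis using ol A' B *(5) \<open>\<not> W dvd F\<close> by simp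
    qed
  qed
qed

text \<open>At an affine point the unit factors supplied by \<open>vrel\<close> give the quotient.
  At infinity a form that does not vanish has pole order divisible by 3, so numerator and
  denominator are first multiplied by a power of \<open>x\<close>.\<close>

lemma regular_representation:
  assumes "\<not> W dvd F" "\<not> W dvd G" "ordp P F \<ge> ordp P G"
  shows "\<exists>d A B. form_of_degree d A \<and> form_of_degree d B \<and> form_value d B P \<noteq> 0 \<and> F * B \<doteq> A * G"
proof (cases P)
  case (Affine r s)
  hence on: "on_curve r s" using P Affine_curve_iff by simp
  obtain F1 F2 where F: "F * F1 \<doteq> lpar r s ^ aord r s F * F2" "eval2 F1 r s \<noteq> 0"
    using vrel_aord[OF on assms(1)] unfolding vrel_def by blast
  obtain G1 G2 where G: "G * G1 \<doteq> lpar r s ^ aord r s G * G2" "eval2 G2 r s \<noteq> 0"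
    using vrel_aord[OF on assms(2)] unfolding vrel_def by blast
  define A where "A = lpar r s ^ (aord r s F - aord r s G) * F2 * G1"
  define B where "B = F1 * G2"
  have le: "aord r s G \<le> aord r s F" using assms(3) Affine by simp
  have "F * B = (F * F1) * G2" by (simp add: B_def mult.assoc)
  also have "\<dots> \<doteq> (lpar r s ^ aord r s F * F2) * G2" by (intro congW_mult F congW_refl)
  also have "\<dots> = (lpar r s ^ (aord r s F - aord r s G) * F2) * (lpar r s ^ aord r s G * G2)"
    using power_add[of "lpar r s" "aord r s F - aord r s G" "aord r s G"] le by (simp add: ac_simps)
  also have "\<dots> \<doteq> (lpar r s ^ (aord r s F - aord r s G) * F2) * (G * G1)"
    by (intro congW_mult congW_sym[OF G(1)] congW_refl)
  also have "\<dots> = A * G" by (simp add: A_def ac_simps)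
  finally have eq: "F * B \<doteq> A * G" .
  obtain d1 d2 where "form_of_degree d1 A" "form_of_degree d2 B" using exists_form_degree by metis
  hence "form_of_degree (max d1 d2) A" "form_of_degree (max d1 d2) B"
    by (auto elim: form_of_degree_mono)
  moreover have "form_value (max d1 d2) B P \<noteq> 0" using F G Affine by (simp add: B_def eval2_simps)
  ultimately show ?thesis using eq by blast
next
  case Infinity
  define X where "X = [:[:0, 1::'k:]:]"
  \<comment> \<open>\<open>x^i\<close> adds \<open>2 i\<close> to the pole order, and
    \<open>n + 2 (n mod 3)\<close> is divisible by 3.\<close>
  define i where "i = pdeg G mod 3"
  define d where "d = (pdeg G + 2 * i) div 3"
  have d: "3 * d = pdeg G + 2 * i" 
  proof -
    have "pdeg G = 3 * (pdeg G div 3) + i" unfolding i_def by simp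
    hence "pdeg G + 2 * i = 3 * (pdeg G div 3 + i)" by simp
    hence "3 dvd pdeg G + 2 * i" by (rule dvdI)
    thus ?thesis unfolding d_def by (rule dvd_mult_div_cancel)
  qed
  have X: "\<not> W dvd X" "pdeg X = 2" "plc X = 1" by (simp_all add: X_def pdeg_const plc_const)
  hence Xi: "\<not> W dvd X ^ i" "pdeg (X ^ i) = 2 * i" by (simp_all add: W_dvd_power_iff pdeg_plc_power)
  have pF: "pdeg (F * X ^ i) \<le> 3 * d" and pG: "pdeg (G * X ^ i) = 3 * d"
    using assms Xi Infinity d by (simp_all add: pdeg_mult)
  obtain A where A: "A \<doteq> F * X ^ i" "form_of_degree d A"
    using form_representative pF unfolding pdeg_def by blast
  obtain B where B: "B \<doteq> G * X ^ i" "form_of_degree d B"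
    using form_representative pG unfolding pdeg_def by (metis order_refl)
  have "form_value d B P = coeff (wt (red B)) (3 * d)"
    using form_at_infinity(2)[OF B(2)] Infinity by simp
  also have "\<dots> = plc B" using pG pdeg_congW[OF B(1)] unfolding plc_def pdeg_def by metis
  also have "\<dots> \<noteq> 0" using plc_nz congW_dvd[OF B(1)] assms(2) Xi by (simp add: W_dvd_mult_iff)
  finally have "form_value d B P \<noteq> 0" .
  moreover have "F * B \<doteq> F * (G * X ^ i)" by (intro congW_mult B congW_refl)
  hence "F * B \<doteq> (F * X ^ i) * G" by (simp add: ac_simps)
  hence "F * B \<doteq> A * G" using congW_mult[OF congW_sym[OF A(1)] congW_refl] congW_trans by blast
  ultimately show ?thesis using A(2) B(2) by blast
qed

lemma has_value_Fract_iff: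
  assumes "\<not> W dvd G"
  shows "has_value E (Fract F G) P c \<longleftrightarrow> (W dvd F \<and> c = 0) \<or> 
    (\<not> W dvd F \<and> ordp P F > ordp P G \<and> c = 0) \<or>
    (\<not> W dvd F \<and> ordp P F = ordp P G \<and> c = lcp P F / lcp P G)" (is "_ \<longleftrightarrow> ?R")
proof
  assume "has_value E (Fract F G) P c"
  thus ?R by (rule has_value_imp[OF assms])
next
  assume R: ?R
  show "has_value E (Fract F G) P c"
  proof (cases "W dvd F")
    case True
    have "rf_eq E (Fract F G) (Fract 0 1)"
      using True rf_eq_Fract[OF assms, of 1 F 0] by (simp add: congW_0_iff)
    moreover have "form_value 0 1 P \<noteq> (0::'k)" "form_value 0 0 P = (0::'k)" 
      by (cases P; simp add: eval2_simps)+
    moreover have "form_of_degree 0 (0 :: 'k poly poly)" "form_of_degree 0 (1 :: 'k poly poly)"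
      by (auto simp: form_of_degree_def coeff_1)
    moreover have "c = 0" using R True by auto
    ultimately show ?thesis unfolding has_value_def by (metis div_0)
  next
    case False
    hence "ordp P F \<ge> ordp P G" using R by auto
    from regular_representation[OF False assms this] obtain d A B where
      *: "form_of_degree d A" "form_of_degree d B" "form_value d B P \<noteq> 0" "F * B \<doteq> A * G" by blast
    have "rf_eq E (Fract F G) (Fract A B)"
      using rf_eq_Fract[OF assms form_value_nonzero(1)[OF *(2,3)]] *(4) by simp
    hence v: "has_value E (Fract F G) P (form_value d A P / form_value d B P)"
      unfolding has_value_def using * by blast
    from has_value_imp[OF assms this] R False have "c = form_value d A P / form_value d B P" by auto
    thus ?thesis using v by simp
  qed
qed

lemma has_value_rep:
  assumes "has_value E f P c"
  obtains F G where "f = Fract F G" "\<not> W dvd G" "G \<noteq> 0"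
proof -
  from assms obtain d A B where *: "form_of_degree d B" "form_value d B P \<noteq> 0" "rf_eq E f (Fract A B)"
    unfolding has_value_def by blast
  have B: "\<not> W dvd B" using form_value_nonzero *(1,2) by blast
  from *(3) obtain F G where FG: "f - Fract A B = Fract F G" "\<not> W dvd G" unfolding rf_eq_def by blast
  have "G \<noteq> 0" "B \<noteq> 0" using FG B by auto
  moreover have "f = Fract F G + Fract A B" using FG(1) by (metis diff_add_cancel)
  ultimately have "f = Fract (F * B + A * G) (G * B)" by simp
  moreover have "\<not> W dvd G * B" using FG B by (simp add: W_dvd_mult_iff)
  ultimately show ?thesis using that by (metis dvd_0_right)
qed

section \<open>Orders and leading coefficients of fractions\<close>

lemma ord_lc_unique:
  assumes "Fract F G = Fract F' G'" "\<not> W dvd F" "\<not> W dvd G" "\<not> W dvd F'" "\<not> W dvd G'"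
  shows "ordp P F - ordp P G = ordp P F' - ordp P G' \<and> lcp P F / lcp P G = lcp P F' / lcp P G'"
proof -
  have "G \<noteq> 0" "G' \<noteq> 0" using assms by auto
  hence "F * G' = F' * G" using assms(1) by (simp add: eq_fract)
  hence "ordp P (F * G') = ordp P (F' * G)" "lcp P (F * G') = lcp P (F' * G)" by simp_all
  thus ?thesis using assms lcp_nz by (simp add: ordp_mult lcp_mult frac_eq_eq)
qed

lemma rord_Fract: "\<not> W dvd F \<Longrightarrow> \<not> W dvd G \<Longrightarrow> rord P (Fract F G) = ordp P F - ordp P G"
  unfolding rord_def by (rule the_equality) (blast, metis ord_lc_unique)

lemma rlc_Fract: "\<not> W dvd F \<Longrightarrow> \<not> W dvd G \<Longrightarrow> rlc P (Fract F G) = lcp P F / lcp P G"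
  unfolding rlc_def by (rule the_equality) (blast, metis ord_lc_unique)

lemma rord_mult: "nonzero_rf f \<Longrightarrow> nonzero_rf g \<Longrightarrow> rord P (f * g) = rord P f + rord P g"
  and rlc_mult: "nonzero_rf f \<Longrightarrow> nonzero_rf g \<Longrightarrow> rlc P (f * g) = rlc P f * rlc P g"
  by (auto elim!: nonzero_rfE simp: rord_Fract rlc_Fract W_dvd_mult_iff ordp_mult lcp_mult)

lemma rlc_nz: "nonzero_rf f \<Longrightarrow> rlc P f \<noteq> 0"
  by (auto elim!: nonzero_rfE simp: rlc_Fract lcp_nz)

lemma rord_inverse: "nonzero_rf f \<Longrightarrow> rord P (inverse f) = - rord P f"
  and rlc_inverse: "nonzero_rf f \<Longrightarrow> rlc P (inverse f) = inverse (rlc P f)"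
  by (auto elim!: nonzero_rfE simp: rord_Fract rlc_Fract)

lemma rord_divide: "nonzero_rf f \<Longrightarrow> nonzero_rf g \<Longrightarrow> rord P (f / g) = rord P f - rord P g"
  and rlc_divide: "nonzero_rf f \<Longrightarrow> nonzero_rf g \<Longrightarrow> rlc P (f / g) = rlc P f / rlc P g"
  by (simp_all add: divide_inverse rord_mult rlc_mult rord_inverse rlc_inverse nonzero_rf_inverse)

lemma rord_1: "rord P 1 = 0" and rlc_1: "rlc P 1 = 1"
  using lcp_nz[of 1] by (simp_all add: One_fract_def rord_Fract rlc_Fract)

lemma rord_power: "nonzero_rf f \<Longrightarrow> rord P (f ^ n) = int n * rord P f"
  and rlc_power: "nonzero_rf f \<Longrightarrow> rlc P (f ^ n) = rlc P f ^ n"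
proof -
  assume "nonzero_rf f"
  hence "rord P (f ^ n) = int n * rord P f \<and> rlc P (f ^ n) = rlc P f ^ n"
    by (induction n) (simp_all add: rord_1 rlc_1 rord_mult rlc_mult nonzero_rf_power algebra_simps)
  thus "rord P (f ^ n) = int n * rord P f" "rlc P (f ^ n) = rlc P f ^ n" by auto
qed

lemma rord_powi: "nonzero_rf f \<Longrightarrow> rord P (f powi n) = n * rord P f"
  by (simp add: power_int_def rord_power rord_inverse nonzero_rf_power nonzero_rf_inverse)

lemma rf_eq_rord:
  assumes "rf_eq E f g" "nonzero_rf f"
  shows "nonzero_rf g \<and> rord P f = rord P g \<and> rlc P f = rlc P g"
proof -
  obtain F G where f: "f = Fract F G" "\<not> W dvd F" "\<not> W dvd G" "G \<noteq> 0" using assms(2) by (elim nonzero_rfE)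
  obtain F' G' where d: "f - g = Fract F' G'" "W dvd F'" "\<not> W dvd G'" using assms(1) unfolding rf_eq_def by blast
  have "G' \<noteq> 0" using d by auto
  have "g = f - (f - g)" by simp
  also have "\<dots> = f - Fract F' G'" by (simp only: d(1))
  also have "\<dots> = Fract (F * G' - F' * G) (G * G')" unfolding f(1) using f \<open>G' \<noteq> 0\<close> by simp
  finally have g: "g = Fract (F * G' - F' * G) (G * G')" .
  have c: "F * G' \<doteq> F * G' - F' * G" using d(2) by (simp add: congW_def)
  have nd: "\<not> W dvd F * G'" "\<not> W dvd G * G'" using f d by (auto simp: W_dvd_mult_iff)
  hence nd': "\<not> W dvd F * G' - F' * G" using congW_dvd[OF c] by simp
  have "rord P g = ordp P (F * G') - ordp P (G * G')" "rlc P g = lcp P (F * G') / lcp P (G * G')"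
    unfolding g using nd nd' ordp_congW[OF nd(1) c] lcp_congW[OF nd(1) c] by (simp_all add: rord_Fract rlc_Fract)
  thus ?thesis using f d g nd nd' lcp_nz by (simp add: ordp_mult lcp_mult rord_Fract rlc_Fract nonzero_rf_Fract)
qed

lemma has_value_iff:
  assumes "nonzero_rf f"
  shows "has_value E f P c \<longleftrightarrow> (rord P f > 0 \<and> c = 0) \<or> (rord P f = 0 \<and> c = rlc P f)"
  using assms by (auto elim!: nonzero_rfE simp: rord_Fract rlc_Fract has_value_Fract_iff)

lemma rf_value_eq:
  assumes "nonzero_rf f" "rord P f = 0"
  shows "rf_value E f P = rlc P f"
  using assms by (simp add: rf_value_def has_value_iff)

lemma exists_order_1: "\<exists>t. nonzero_rf t \<and> rord P t = 1"
  using P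
proof (cases rule: curve_pointsE)
  case 1
  have "rord P (Fract [:[:0, 1:]:] [:0, 1:]) = ordp P [:[:0, 1:]:] - ordp P [:0, 1:]"
    by (rule rord_Fract) simp_all
  also have "\<dots> = 1" using 1 by (simp add: pdeg_const pdeg_y)
  finally have "rord P (Fract [:[:0, 1:]:] [:0, 1:]) = 1" .
  thus ?thesis by (meson W_dvd_const_iff W_dvd_reduced_iff nonzero_rf_Fract one_neq_zero pCons_eq_0_iff)
next
  case (2 r s)
  have "aord r s 1 = 0" using 2 by (simp add: aord_eq_0_iff eval2_simps)
  have "rord P (Fract (lpar r s) 1) = ordp P (lpar r s) - ordp P 1"
    by (rule rord_Fract) simp_all
  also have "\<dots> = 1" using 2 \<open>aord r s 1 = 0\<close> by (simp add: aord_lpar)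
  finally have "rord P (Fract (lpar r s) 1) = 1" .
  thus ?thesis by (meson W_dvd_lpar W_not_dvd_1 nonzero_rf_Fract)
qed

text \<open>A generator \<open>t\<close> of the maximal ideal divides some \<open>t0\<close> of
  order 1, say \<open>t0 = t h\<close>; as \<open>t\<close> has positive and \<open>h\<close>
  nonnegative order, \<open>t\<close> has order 1. Conversely, dividing a function of positive order
  by one of order 1 leaves a regular function.\<close>

lemma uniformizer_iff: "uniformizer E P t \<longleftrightarrow> nonzero_rf t \<and> rord P t = 1"
proof
  assume t: "nonzero_rf t \<and> rord P t = 1"
  show "uniformizer E P t"
    unfolding uniformizer_def
  proof (intro conjI allI impI)
    show "has_value E t P 0" using t by (simp add: has_value_iff)
  next
    fix g assume g: "has_value E g P 0"
    obtain F G where FG: "g = Fract F G" "\<not> W dvd G" "G \<noteq> 0" using has_value_rep[OF g] by metis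
    obtain A B where AB: "t = Fract A B" "\<not> W dvd A" "\<not> W dvd B" "A \<noteq> 0" "B \<noteq> 0" using t by (auto elim: nonzero_rfE)
    have eq: "g = t * (g / t)" using t nonzero_rf_nz by simp
    have "\<exists>c. has_value E (g / t) P c"
    proof (cases "W dvd F")
      case True
      have "g / t = Fract (F * B) (G * A)" using FG AB by simp
      moreover have "\<not> W dvd G * A" "W dvd F * B" using FG AB True by (auto simp: W_dvd_mult_iff)
      ultimately show ?thesis using has_value_Fract_iff by metis
    next
      case False
      hence "nonzero_rf g" using FG by blast
      moreover from this have "rord P g > 0" using g by (auto simp: has_value_iff rlc_nz)
      ultimately have "nonzero_rf (g / t)" "rord P (g / t) \<ge> 0" using t by (simp_all add: nonzero_rf_divide rord_divide)
      thus ?thesis by (simp add: has_value_iff) (metis less_le)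
    qed
    thus "\<exists>h c. has_value E h P c \<and> rf_eq E g (t * h)"
      using eq unfolding rf_eq_def by (metis W_not_dvd_1 Zero_fract_def diff_self dvd_0_right)
  qed
next
  assume t: "uniformizer E P t"
  obtain t0 where t0: "nonzero_rf t0" "rord P t0 = 1" using exists_order_1 by blast
  hence "has_value E t0 P 0" by (simp add: has_value_iff)
  then obtain h c where h: "has_value E h P c" "rf_eq E t0 (t * h)" using t unfolding uniformizer_def by blast
  note th = rf_eq_rord[OF h(2) t0(1)]
  have t0v: "has_value E t P 0" using t unfolding uniformizer_def by blast
  obtain A B where AB: "t = Fract A B" "\<not> W dvd B" "B \<noteq> 0" using has_value_rep[OF t0v] by metis
  obtain F G where FG: "h = Fract F G" "\<not> W dvd G" "G \<noteq> 0" using has_value_rep[OF h(1)] by metis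
  have "\<not> W dvd A * F"
  proof
    assume *: "W dvd A * F"
    have "nonzero_rf (Fract (A * F) (B * G))" using th AB FG by simp
    thus False using rf_eq_Fract[of "B * G" 1 "A * F" 0] * AB FG 
      by (auto simp: nonzero_rf_iff W_dvd_mult_iff congW_0_iff Zero_fract_def)
  qed
  hence nz: "nonzero_rf t" "nonzero_rf h" using AB FG by (auto simp: W_dvd_mult_iff)
  have "rord P t + rord P h = 1" using th t0 nz by (simp add: rord_mult)
  moreover have "rord P h \<ge> 0" "rord P t > 0"
    using h(1) t0v nz by (auto simp: has_value_iff rlc_nz)
  ultimately show "nonzero_rf t \<and> rord P t = 1" using nz by simp
qed

lemma has_order_iff:
  assumes "nonzero_rf f"
  shows "has_order E f P n \<longleftrightarrow> rord P f = n"
proof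
  assume "has_order E f P n"
  then obtain t u c where *: "uniformizer E P t" "has_value E u P c" "c \<noteq> 0" "rf_eq E f (t powi n * u)"
    unfolding has_order_def by blast
  have t: "nonzero_rf t" "rord P t = 1" using * uniformizer_iff by auto
  obtain F G where FG: "u = Fract F G" "\<not> W dvd G" "G \<noteq> 0" using has_value_rep[OF *(2)] by metis
  have "\<not> W dvd F" using has_value_imp[OF FG(2), of F c] * FG by auto
  hence u: "nonzero_rf u" using FG by auto
  hence "rord P u = 0" using *(2,3) by (simp add: has_value_iff)
  thus "rord P f = n" using rf_eq_rord[OF *(4) assms] t u by (simp add: rord_mult rord_powi nonzero_rf_powi)
next
  assume n: "rord P f = n"
  obtain t where t: "nonzero_rf t" "rord P t = 1" using exists_order_1 by blast
  define u where "u = f / t powi n"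
  have u: "nonzero_rf u" "rord P u = 0" using t n assms by (simp_all add: u_def nonzero_rf_divide nonzero_rf_powi rord_divide rord_powi)
  have "f = t powi n * u" using t nonzero_rf_nz[OF t(1)] by (simp add: u_def)
  hence "rf_eq E f (t powi n * u)"
    unfolding rf_eq_def by (metis W_not_dvd_1 Zero_fract_def diff_self dvd_0_right)
  thus "has_order E f P n" unfolding has_order_def using t u uniformizer_iff has_value_iff rlc_nz by blast
qed

end

lemma has_divisor_iff:
  "has_divisor E f D \<longleftrightarrow> nonzero_rf f \<and> D \<in> divisors E \<and> (\<forall>P\<in>curve_points E. rord P f = Poly_Mapping.lookup D P)"
  unfolding has_divisor_def using nonzero_rf_iff has_order_iff by blast

section \<open>Reciprocity for polynomial functions\<close>

definition apts :: "'k point set" where "apts = curve_points E - {Infinity}"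

lemma Affine_apts: "Affine r s \<in> apts \<longleftrightarrow> on_curve r s"
  by (simp add: apts_def Affine_curve_iff)

lemma aptsE: 
  assumes "P \<in> apts" 
  obtains r s where "P = Affine r s" "on_curve r s"
  using assms by (cases P) (auto simp: apts_def Affine_curve_iff)

fun pval :: "'k poly poly \<Rightarrow> 'k point \<Rightarrow> 'k" where
  "pval F (Affine r s) = eval2 F r s"
| "pval F Infinity = 0"

lemma ordp_nonneg: "P \<in> apts \<Longrightarrow> ordp P F \<ge> 0"
  by (auto elim!: aptsE)

lemma ordp_eq_0_iff: "P \<in> apts \<Longrightarrow> \<not> W dvd F \<Longrightarrow> ordp P F = 0 \<longleftrightarrow> pval F P \<noteq> 0"
  by (auto elim!: aptsE simp: aord_eq_0_iff)

lemma ordp_pos_iff: "P \<in> apts \<Longrightarrow> \<not> W dvd F \<Longrightarrow> 0 < ordp P F \<longleftrightarrow> pval F P = 0"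
  using ordp_eq_0_iff[of P F] ordp_nonneg[of P F] by linarith

lemma lcp_pval: "P \<in> apts \<Longrightarrow> pval F P \<noteq> 0 \<Longrightarrow> lcp P F = pval F P"
  by (auto elim!: aptsE simp: alc_eval)

lemma pval_mult: "pval (F * G) P = pval F P * pval G P"
  by (cases P) (auto simp: eval2_simps)

lemma pval_congW: "P \<in> apts \<Longrightarrow> F \<doteq> G \<Longrightarrow> pval F P = pval G P"
  by (auto elim!: aptsE simp: congW_eval2)

lemma pval_reduced: "P \<in> apts \<Longrightarrow> \<exists>s. \<forall>a b. pval [:a, b:] P = poly a (xco P) + s * poly b (xco P)"
  by (auto elim!: aptsE simp: eval2_simps)

lemma nrm_eval: "on_curve r s \<Longrightarrow> poly (nrm F) r = eval2 F r s * eval2 F r (negy r s)"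
  using congW_eval2[OF conj_nrm[of F], of r s] by (simp add: eval2_simps eval2_conj)

section \<open>Zeros of polynomial functions and roots of the norm\<close>

lemma exists_point_over: "\<exists>s. on_curve r s"
proof -
  obtain s where "poly [:- poly fpol r, poly hpol r, 1:] s = 0"
    using alg_closed_imp_poly_has_root[of "[:- poly fpol r, poly hpol r, 1:]"] by auto
  hence "on_curve r s" by (simp add: on_curve_iff power2_eq_square algebra_simps)
  thus ?thesis by blast
qed

lemma fibre_eq:
  assumes "on_curve r s"
  shows "{P \<in> apts. xco P = r} = {Affine r s, Affine r (negy r s)}"
  using assms on_curve_negy by (auto elim!: aptsE dest: on_curve_fibre[OF assms] simp: Affine_apts)

text \<open>Zeros lie above the finitely many roots of the norm, at most two above each.\<close>

lemma finite_zeros: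
  assumes "\<not> W dvd F"
  shows "finite {P \<in> apts. pval F P = 0}"
proof (rule finite_subset)
  show "{P \<in> apts. pval F P = 0} \<subseteq> (\<Union>r\<in>{r. poly (nrm F) r = 0}. {P \<in> apts. xco P = r})"
    by (auto elim!: aptsE simp: nrm_eval Affine_apts)
  have "finite {P \<in> apts. xco P = r}" for r
    using exists_point_over[of r] fibre_eq by force
  thus "finite (\<Union>r\<in>{r. poly (nrm F) r = 0}. {P \<in> apts. xco P = r})"
    using assms by (intro finite_UN_I poly_roots_finite) (auto simp: nrm_eq_0_iff)
qed

definition zeros :: "'k poly poly \<Rightarrow> 'k point multiset" where
  "zeros F = Abs_multiset (\<lambda>P. if P \<in> apts then nat (ordp P F) else 0)"

lemma count_zeros:
  assumes "\<not> W dvd F"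
  shows "count (zeros F) P = (if P \<in> apts then nat (ordp P F) else 0)"
proof -
  have "{P. (if P \<in> apts then nat (ordp P F) else 0) > 0} = {P \<in> apts. pval F P = 0}"
    using assms by (auto simp: ordp_pos_iff split: if_splits)
  thus ?thesis unfolding zeros_def using finite_zeros[OF assms] by (simp add: count_Abs_multiset)
qed

lemma set_zeros:
  assumes "\<not> W dvd F"
  shows "set_mset (zeros F) = {P \<in> apts. pval F P = 0}"
  using assms by (auto simp: set_mset_def count_zeros[OF assms] ordp_pos_iff split: if_splits)

lemma zeros_mult:
  assumes "\<not> W dvd F" "\<not> W dvd G"
  shows "zeros (F * G) = zeros F + zeros G"
proof (rule multiset_eqI)
  fix P
  show "count (zeros (F * G)) P = count (zeros F + zeros G) P"
  proof (cases "P \<in> apts")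
    case True
    hence "P \<in> curve_points E" by (simp add: apts_def)
    thus ?thesis using True assms ordp_nonneg[OF True]
      by (simp add: count_zeros W_dvd_mult_iff ordp_mult nat_add_distrib)
  qed (use assms in \<open>simp add: count_zeros W_dvd_mult_iff\<close>)
qed

lemma zeros_congW:
  assumes "\<not> W dvd F" "F \<doteq> G"
  shows "zeros F = zeros G"
  using assms ordp_congW unfolding zeros_def apts_def by (intro arg_cong[of _ _ Abs_multiset]) auto

text \<open>By \<open>order_nrm\<close> the multiplicities of the points above \<open>r\<close> add
  up to the order of the norm; at a branch point the set \<open>?T\<close> has only one element.
  Products of functions of \<open>x\<close> over the zeros of \<open>F\<close> thereby become
  products over roots of a polynomial.\<close>

lemma image_xco_zeros:
  assumes "\<not> W dvd F"
  shows "image_mset xco (zeros F) = proots (nrm F)"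
proof (rule multiset_eqI)
  fix r
  obtain s where s: "on_curve r s" using exists_point_over by blast
  let ?T = "{Affine r s, Affine r (negy r s)}"
  have nz: "nrm F \<noteq> 0" using assms by (simp add: nrm_eq_0_iff)
  have "count (image_mset xco (zeros F)) r = (\<Sum>P\<in>xco -` {r} \<inter> set_mset (zeros F). count (zeros F) P)"
    by (rule count_image_mset)
  also have "\<dots> = (\<Sum>P\<in>?T. count (zeros F) P)"
    by (rule sum.mono_neutral_left)
       (use fibre_eq[OF s] set_zeros[OF assms] in \<open>auto simp: not_in_iff\<close>)
  also have "\<dots> = order r (nrm F)"
    using order_nrm[OF s assms] s on_curve_negy[OF s] by (auto simp: count_zeros[OF assms] Affine_apts)
  also have "\<dots> = count (proots (nrm F)) r" using nz by simp
  finally show "count (image_mset xco (zeros F)) r = count (proots (nrm F)) r" .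
qed

lemma root_prod_nrm:
  "\<not> W dvd F \<Longrightarrow> root_prod (nrm F) p = (\<Prod>P\<in>#zeros F. poly p (xco P))"
  unfolding root_prod_def image_xco_zeros[symmetric] by (simp add: image_mset.compositionality o_def)

text \<open>The affine zeros balance the pole at infinity: both numbers are the degree of the
  norm.\<close>

lemma size_zeros: "\<not> W dvd F \<Longrightarrow> size (zeros F) = pdeg F"
  using arg_cong[OF image_xco_zeros[of F], of size] proots_factorization(1)[of "nrm F"] degree_nrm[of F]
  by (simp add: nrm_eq_0_iff)

section \<open>The reciprocity relation between polynomial functions\<close>

definition eval_zeros :: "'k poly poly \<Rightarrow> 'k poly poly \<Rightarrow> 'k" where
  "eval_zeros F G = (\<Prod>P\<in>#zeros G. pval F P)"

text \<open>The tame symbol at \<open>Infinity\<close>, where the orders are \<open>- pdeg F\<close>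
  and \<open>- pdeg G\<close>, multiplied out. In this form common zeros of \<open>F\<close> and
  \<open>G\<close> just make both sides vanish, so the relation can be used for factors such as
  vertical lines.\<close>

definition recip :: "'k poly poly \<Rightarrow> 'k poly poly \<Rightarrow> bool" where
  "recip F G \<longleftrightarrow> eval_zeros F G * plc G ^ pdeg F = (- 1) ^ (pdeg F * pdeg G) * (eval_zeros G F * plc F ^ pdeg G)"

lemma recip_sym: "recip F G \<Longrightarrow> recip G F"
  unfolding recip_def by (simp add: mult.commute)

lemma recip_congW:
  assumes "\<not> W dvd F" "\<not> W dvd G" "F \<doteq> F'"
  shows "recip F G \<longleftrightarrow> recip F' G"
proof -
  have "eval_zeros F G = eval_zeros F' G"
    unfolding eval_zeros_def using assms pval_congW set_zeros[OF assms(2)] 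
    by (intro arg_cong[of _ _ prod_mset] image_mset_cong) auto
  moreover have "eval_zeros G F = eval_zeros G F'" unfolding eval_zeros_def using zeros_congW[OF assms(1,3)] by simp
  ultimately show ?thesis unfolding recip_def using pdeg_congW[OF assms(3)] plc_congW[OF assms(3)] by simp
qed

lemma recip_mult:
  assumes "\<not> W dvd F" "\<not> W dvd F'" "recip F G" "recip F' G"
  shows "recip (F * F') G"
proof -
  have "eval_zeros (F * F') G = eval_zeros F G * eval_zeros F' G" by (simp add: eval_zeros_def pval_mult prod_mset.distrib)
  moreover have "eval_zeros G (F * F') = eval_zeros G F * eval_zeros G F'" by (simp add: eval_zeros_def zeros_mult assms)
  ultimately have "eval_zeros (F * F') G * plc G ^ pdeg (F * F') = 
      (eval_zeros F G * plc G ^ pdeg F) * (eval_zeros F' G * plc G ^ pdeg F')"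
    using assms by (simp add: pdeg_mult power_add)
  also have "\<dots> = (- 1) ^ (pdeg (F * F') * pdeg G) * (eval_zeros G (F * F') * plc (F * F') ^ pdeg G)"
    using assms \<open>eval_zeros G (F * F') = _\<close> unfolding recip_def
    by (simp add: pdeg_mult plc_mult power_add power_mult_distrib distrib_right)
  finally show ?thesis unfolding recip_def .
qed

lemma recip_const:
  assumes "\<not> W dvd G" "c \<noteq> 0"
  shows "recip [:[:c:]:] G"
proof -
  have nd: "\<not> W dvd [:[:c:]:]" using assms by simp
  have "pval [:[:c:]:] P \<noteq> 0" if "P \<in> apts" for P
    using that assms(2) by (auto elim!: aptsE simp: eval2_simps)
  hence "set_mset (zeros [:[:c:]:]) = {}" unfolding set_zeros[OF nd] by blast
  hence "eval_zeros G [:[:c:]:] = 1" by (simp add: eval_zeros_def)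
  moreover have "pval [:[:c:]:] P = c" if "P \<in># zeros G" for P
    using that unfolding set_zeros[OF assms(1)] by (auto elim!: aptsE simp: eval2_simps)
  hence "eval_zeros [:[:c:]:] G = (\<Prod>P\<in>#zeros G. c)"
    unfolding eval_zeros_def by (intro arg_cong[of _ _ prod_mset] image_mset_cong)
  ultimately show ?thesis using size_zeros[OF assms(1)] by (simp add: recip_def pdeg_const plc_const)
qed

text \<open>The two points above \<open>r\<close> give \<open>poly (nrm G) r\<close> directly as a
  product of conjugate values. The zeros of \<open>G\<close> give the same number, up to the leading
  coefficient of the norm, by flipping \<open>root_prod\<close> against
  \<open>x - r\<close>.\<close>

lemma recip_vert:
  assumes "\<not> W dvd G"
  shows "recip (vert r) G"
proof -
  obtain s where s: "on_curve r s" using exists_point_over by blast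
  have nd: "\<not> W dvd vert r" by simp
  have z: "zeros (vert r) = {#Affine r s, Affine r (negy r s)#}"
  proof (rule multiset_eqI)
    fix P
    show "count (zeros (vert r)) P = count {#Affine r s, Affine r (negy r s)#} P"
    proof (cases "P \<in> apts \<and> xco P = r")
      case True
      then obtain s' where s': "P = Affine r s'" "on_curve r s'" by (auto elim!: aptsE)
      have "order r [:- r, 1:] = 1" using order_power_n_n[of r 1] by simp
      thus ?thesis using s' on_curve_fibre[OF s s'(2)] 
        by (auto simp: count_zeros[OF nd] Affine_apts aord_const s)
    next
      case False
      have "pval (vert r) P \<noteq> 0" if "P \<in> apts" using that False by (auto elim!: aptsE simp: eval2_simps)
      hence "count (zeros (vert r)) P = 0" using set_zeros[OF nd] by (auto simp: not_in_iff[symmetric])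
      moreover have "P \<noteq> Affine r s" "P \<noteq> Affine r (negy r s)" 
        using False s on_curve_negy[OF s] by (auto simp: Affine_apts)
      ultimately show ?thesis by simp
    qed
  qed
  have 1: "eval_zeros G (vert r) = poly (nrm G) r" using nrm_eval[OF s] by (simp add: eval_zeros_def z)
  have nz: "nrm G \<noteq> 0" using assms by (simp add: nrm_eq_0_iff)
  have "pval (vert r) P = poly [:- r, 1:] (xco P)" if "P \<in># zeros G" for P
    using that unfolding set_zeros[OF assms] by (auto elim!: aptsE simp: eval2_simps)
  hence "eval_zeros (vert r) G = (\<Prod>P\<in>#zeros G. poly [:- r, 1:] (xco P))"
    unfolding eval_zeros_def by (intro arg_cong[of _ _ prod_mset] image_mset_cong)
  also have "\<dots> = root_prod (nrm G) [:- r, 1:]" using root_prod_nrm[OF assms] by simp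
  finally have "eval_zeros (vert r) G * lead_coeff (nrm G) = (- 1) ^ pdeg G * poly (nrm G) r"
    using root_prod_flip[OF nz, of "[:- r, 1:]"] degree_nrm[OF assms] by (simp add: root_prod_def)
  hence "(- 1) ^ pdeg G * (eval_zeros (vert r) G * (plc G)\<^sup>2) = (- 1) ^ pdeg G * poly (nrm G) r"
    unfolding conjunct2[OF degree_nrm[OF assms]] by (simp only: ac_simps)
  hence "eval_zeros (vert r) G * (plc G)\<^sup>2 = poly (nrm G) r" by simp
  thus ?thesis using 1 by (simp add: recip_def pdeg_const plc_const)
qed

lemma zeros_nonempty:
  assumes "\<not> W dvd G" "pdeg G > 0"
  shows "\<exists>P\<in>apts. pval G P = 0"
proof -
  have "zeros G \<noteq> {#}" using size_zeros[OF assms(1)] assms(2) by auto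
  thus ?thesis using set_zeros[OF assms(1)] by (metis (mono_tags, lifting) empty_Collect_eq set_mset_eq_empty_iff)
qed

lemma pdeg_pos: "b \<noteq> 0 \<Longrightarrow> pdeg [:a, b:] > 0"
  using degree_wt_reduced_ge[of b a] by (simp add: pdeg_def del: wt_pCons)

text \<open>
  At a zero of \<open>G = a + b y\<close> one has \<open>y = - a / b\<close>, so that \<open>F = c + d y\<close> takes the value
  \<open>(c b - d a) / b\<close> there and the product of the values of \<open>F\<close> over the zeros of \<open>G\<close> becomes a
  quotient of resultants of polynomials in \<open>x\<close>. Dividing \<open>b\<close> and \<open>d\<close> by a common factor \<open>e\<close>
  keeps all these resultants nonzero.
\<close>

lemma value_at_zero:
  assumes P: "P \<in> apts" "pval [:a, b:] P = 0" and prim: "\<And>r. poly a r \<noteq> 0 \<or> poly b r \<noteq> 0"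
    and bd: "b = e * b'" "d = e * d'"
  shows "pval [:c, d:] P * poly b' (xco P) = poly (c * b' - d' * a) (xco P)"
proof -
  obtain s where s: "\<And>a b. pval [:a, b:] P = poly a (xco P) + s * poly b (xco P)"
    using pval_reduced[OF P(1)] by blast
  let ?x = "xco P"
  have 0: "poly a ?x + s * poly b ?x = 0" using P(2) s by simp
  have e: "poly e ?x \<noteq> 0"
  proof
    assume "poly e ?x = 0"
    hence "poly b ?x = 0" by (simp add: bd)
    thus False using 0 prim[of ?x] by simp
  qed
  have a: "poly a ?x = - s * poly b ?x" using 0 by (simp add: eq_neg_iff_add_eq_0)
  have "poly (c * b' - d' * a) ?x = poly c ?x * poly b' ?x + s * poly d' ?x * poly b ?x"
    by (simp add: a)
  also have "\<dots> = (poly c ?x + s * poly d ?x) * poly b' ?x" by (simp add: bd algebra_simps)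
  finally show ?thesis using s by simp
qed

lemma eval_zeros_root_prod:
  assumes prim: "\<And>r. poly a r \<noteq> 0 \<or> poly b r \<noteq> 0" and nz: "\<not> W dvd [:a, b:]"
    and bd: "b = e * b'" "d = e * d'"
  shows "eval_zeros [:c, d:] [:a, b:] * root_prod (nrm [:a, b:]) b' = root_prod (nrm [:a, b:]) (c * b' - d' * a)"
proof -
  have *: "pval [:c, d:] P * poly b' (xco P) = poly (c * b' - d' * a) (xco P)" if "P \<in># zeros [:a, b:]" for P
    using that value_at_zero[OF _ _ prim bd] unfolding set_zeros[OF nz] by blast
  have "eval_zeros [:c, d:] [:a, b:] * root_prod (nrm [:a, b:]) b' =
      (\<Prod>P\<in>#zeros [:a, b:]. pval [:c, d:] P * poly b' (xco P))"
    unfolding eval_zeros_def root_prod_nrm[OF nz] by (simp add: prod_mset.distrib)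
  also have "\<dots> = (\<Prod>P\<in>#zeros [:a, b:]. poly (c * b' - d' * a) (xco P))"
    by (intro arg_cong[of _ _ prod_mset] image_mset_cong *)
  also have "\<dots> = root_prod (nrm [:a, b:]) (c * b' - d' * a)" by (simp add: root_prod_nrm[OF nz])
  finally show ?thesis .
qed

text \<open>Products over the roots of \<open>nrm G\<close> are flipped into products over the roots
  of \<open>b'\<close> and of \<open>D\<close>. Modulo \<open>b'\<close> the norm of
  \<open>a + b y\<close> is \<open>a^2\<close>, because \<open>b'\<close> divides \<open>b\<close>;
  hence the square of \<open>root_prod b' a\<close>.\<close>

lemma eval_zeros_normalized:
  assumes prim: "\<And>r. poly a r \<noteq> 0 \<or> poly b r \<noteq> 0" and b: "b \<noteq> 0"
    and bd: "b = e * b'" "d = e * d'" and D: "D = c * b' - d' * a" "D \<noteq> 0"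
  shows "eval_zeros [:c, d:] [:a, b:] * (root_prod b' a)\<^sup>2 * lead_coeff b' ^ pdeg [:a, b:] * plc [:a, b:] ^ (2 * degree D) =
    root_prod D (nrm [:a, b:]) * lead_coeff D ^ pdeg [:a, b:] * plc [:a, b:] ^ (2 * degree b')"
proof -
  define G where "G = [:a, b:]"
  define n where "n = pdeg G"
  define g where "g = plc G"
  have nd: "\<not> W dvd G" using b by (simp add: G_def)
  have N: "degree (nrm G) = n" "lead_coeff (nrm G) = (- 1) ^ n * g\<^sup>2" "nrm G \<noteq> 0"
    using degree_nrm[OF nd] nd nrm_eq_0_iff[of G] unfolding n_def g_def by blast+
  have b': "b' \<noteq> 0" using b bd by auto
  have "nrm G - a\<^sup>2 = b' * (- (e * (a * hpol)) - e * (b * fpol))"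
    by (simp add: nrm_def G_def bd power2_eq_square algebra_simps)
  hence "root_prod b' (nrm G) = root_prod b' (a\<^sup>2)" by (intro root_prod_cong[OF b']) simp
  hence u: "root_prod b' (nrm G) = (root_prod b' a)\<^sup>2" by (simp add: root_prod_power_right)
  have 1: "eval_zeros [:c, d:] G * root_prod (nrm G) b' = root_prod (nrm G) D"
    using eval_zeros_root_prod[OF prim nd[unfolded G_def] bd] by (simp add: G_def D)
  let ?B = "degree b'" and ?D = "degree D" and ?L = "lead_coeff (nrm G)"
  have 2: "root_prod (nrm G) b' * ?L ^ ?B = (- 1) ^ (n * ?B) * (root_prod b' a)\<^sup>2 * lead_coeff b' ^ n"
    using root_prod_flip[OF N(3) b'] unfolding u N(1) by simp
  have 3: "root_prod (nrm G) D * ?L ^ ?D = (- 1) ^ (n * ?D) * root_prod D (nrm G) * lead_coeff D ^ n"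
    using root_prod_flip[OF N(3) D(2)] unfolding N(1) by simp
  have "eval_zeros [:c, d:] G * ((- 1) ^ (n * ?B) * (root_prod b' a)\<^sup>2 * lead_coeff b' ^ n) * ?L ^ ?D
      = (eval_zeros [:c, d:] G * root_prod (nrm G) b') * ?L ^ ?B * ?L ^ ?D"
    unfolding 2[symmetric] by (simp only: ac_simps)
  also have "\<dots> = (root_prod (nrm G) D * ?L ^ ?D) * ?L ^ ?B" unfolding 1 by (simp only: ac_simps)
  also have "\<dots> = ((- 1) ^ (n * ?D) * root_prod D (nrm G) * lead_coeff D ^ n) * ?L ^ ?B"
    unfolding 3 ..
  finally have 4: "(- 1) ^ (n * ?B) * (- 1) ^ (n * ?D) * (eval_zeros [:c, d:] G * (root_prod b' a)\<^sup>2 * lead_coeff b' ^ n * g ^ (2 * ?D))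
     = (- 1) ^ (n * ?B) * (- 1) ^ (n * ?D) * (root_prod D (nrm G) * lead_coeff D ^ n * g ^ (2 * ?B))"
    unfolding N(2) power_mult_distrib power_mult[symmetric] by (simp only: ac_simps)
  have "(- 1) ^ (n * ?B) * (- 1) ^ (n * ?D) \<noteq> (0 :: 'k)" by simp
  from 4 this show ?thesis unfolding G_def n_def g_def by (metis mult_left_cancel)
qed

text \<open>The two instances of \<open>eval_zeros_normalized\<close> are linked by the congruence
  between the two norms modulo \<open>D\<close>. The auxiliary resultants of \<open>D\<close>,
  \<open>b'\<close> and \<open>d'\<close> enter only as squares, so that flipping them costs no sign
  and they cancel; leading coefficients remain. The sign comes from \<open>D\<close> turning into
  \<open>- D\<close> when \<open>F\<close> and \<open>G\<close> are exchanged.\<close>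

lemma core_identity:
  fixes a b c d e b' d'
  defines "F \<equiv> [:c, d:]" and "G \<equiv> [:a, b:]" and "D \<equiv> c * b' - d' * a"
  assumes prim: "\<And>r. poly a r \<noteq> 0 \<or> poly b r \<noteq> 0" "\<And>r. poly c r \<noteq> 0 \<or> poly d r \<noteq> 0"
    and nz: "b \<noteq> 0" "d \<noteq> 0"
    and bd: "b = e * b'" "d = e * d'" and cop: "\<And>r. poly b' r \<noteq> 0 \<or> poly d' r \<noteq> 0"
    and disj: "\<And>P. P \<in> apts \<Longrightarrow> pval F P \<noteq> 0 \<or> pval G P \<noteq> 0"
  shows "D \<noteq> 0" 
    "(- 1) ^ pdeg F * eval_zeros G F * lead_coeff d' ^ (pdeg F + 2 * degree b') * plc F ^ (2 * degree D) *
        lead_coeff b' ^ (2 * degree D) * lead_coeff D ^ (2 * degree d' + pdeg G) * plc G ^ (2 * degree b') =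
     eval_zeros F G * lead_coeff b' ^ (pdeg G + 2 * degree d') * plc G ^ (2 * degree D) *
        lead_coeff d' ^ (2 * degree D) * lead_coeff D ^ (2 * degree b' + pdeg F) * plc F ^ (2 * degree d')"
proof -
  have nd: "\<not> W dvd F" "\<not> W dvd G" using nz by (simp_all add: F_def G_def)
  show D: "D \<noteq> 0"
  proof
    \<comment> \<open>At a zero of \<open>G\<close> one gets \<open>F b' = 0\<close>. As
      \<open>F\<close> is nonzero there, \<open>b'\<close> and so \<open>b\<close> vanish, and then
      \<open>a\<close> does too, contrary to primitivity.\<close>
    assume "D = 0"
    obtain P where P: "P \<in> apts" "pval G P = 0" using zeros_nonempty[OF nd(2)] pdeg_pos[OF nz(1)] by (auto simp: G_def)
    have "pval F P * poly b' (xco P) = 0"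
      unfolding F_def value_at_zero[OF P[unfolded G_def] prim(1) bd, of c] \<open>D = 0\<close>[unfolded D_def] by simp
    hence "poly b (xco P) = 0" using disj[OF P(1)] P(2) by (simp add: bd)
    moreover obtain s where "\<And>a b. pval [:a, b:] P = poly a (xco P) + s * poly b (xco P)"
      using pval_reduced[OF P(1)] by blast
    ultimately show False using P(2) prim(1)[of "xco P"] by (simp add: G_def)
  qed
  have b': "b' \<noteq> 0" and d': "d' \<noteq> 0" using nz bd by auto
  define n k \<beta> \<gamma> \<delta> where nk: "n = pdeg G" "k = pdeg F" "\<beta> = degree b'" "\<gamma> = degree d'" "\<delta> = degree D"
  define lb ld lD f g where l: "lb = lead_coeff b'" "ld = lead_coeff d'" "lD = lead_coeff D" "f = plc F" "g = plc G"
  define u v w w' p q where r: "u = root_prod b' a" "v = root_prod d' c" "w = root_prod b' d'" "w' = root_prod d' b'"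
    "p = root_prod D (nrm G)" "q = root_prod D (nrm F)"
  have A: "eval_zeros F G * u\<^sup>2 * lb ^ n * g ^ (2 * \<delta>) = p * lD ^ n * g ^ (2 * \<beta>)"
    using eval_zeros_normalized[OF prim(1) nz(1) bd D_def[THEN meta_eq_to_obj_eq] D] unfolding nk l r F_def G_def .
  have D': "- D = a * d' - b' * c" "- D \<noteq> 0" using D by (simp_all add: D_def mult.commute)
  have "root_prod (- D) (nrm F) = q" by (simp add: root_prod_def r)
  hence "eval_zeros G F * v\<^sup>2 * ld ^ k * f ^ (2 * \<delta>) = q * (- lD) ^ k * f ^ (2 * \<gamma>)"
    using eval_zeros_normalized[OF prim(2) nz(2) bd(2,1) D'] unfolding nk l r F_def G_def by simp
  hence B: "eval_zeros G F * v\<^sup>2 * ld ^ k * f ^ (2 * \<delta>) = (- 1) ^ k * q * lD ^ k * f ^ (2 * \<gamma>)"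
    by (simp add: power_minus[of lD])
  have "b'\<^sup>2 * nrm F - d'\<^sup>2 * nrm G = D * (b' * c + d' * a - hpol * (b' * d))"
    by (simp add: nrm_def F_def G_def D_def bd power2_eq_square algebra_simps)
  hence "root_prod D (b'\<^sup>2 * nrm F) = root_prod D (d'\<^sup>2 * nrm G)"
    by (intro root_prod_cong[OF D]) simp
  hence C0: "(root_prod D b')\<^sup>2 * q = (root_prod D d')\<^sup>2 * p"
    by (simp add: root_prod_mult_right root_prod_power_right r)
  have s2: "((- 1) ^ i)\<^sup>2 = (1 :: 'k)" for i by (simp add: power_mult[symmetric] mult.commute)
  have "root_prod b' D = root_prod b' (- (d' * a))" unfolding D_def by (intro root_prod_cong[OF b']) simp
  hence bD: "(root_prod b' D)\<^sup>2 = (w * u)\<^sup>2"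
    by (simp add: root_prod_uminus root_prod_mult_right r power_mult_distrib s2)
  have "root_prod d' D = root_prod d' (c * b')" unfolding D_def by (intro root_prod_cong[OF d']) simp
  hence dD: "(root_prod d' D)\<^sup>2 = (v * w')\<^sup>2" by (simp add: root_prod_mult_right r)
  have C1: "(root_prod D b')\<^sup>2 * lD ^ (2 * \<beta>) = (w * u)\<^sup>2 * lb ^ (2 * \<delta>)"
    using arg_cong[OF root_prod_flip[OF D b'], of "\<lambda>z. z\<^sup>2"] bD
    by (simp add: power_mult_distrib s2 nk l power_mult[symmetric] mult.commute)
  have C2: "(root_prod D d')\<^sup>2 * lD ^ (2 * \<gamma>) = (v * w')\<^sup>2 * ld ^ (2 * \<delta>)"
    using arg_cong[OF root_prod_flip[OF D d'], of "\<lambda>z. z\<^sup>2"] dD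
    by (simp add: power_mult_distrib s2 nk l power_mult[symmetric] mult.commute)
  have C3: "w\<^sup>2 * lb ^ (2 * \<gamma>) = w'\<^sup>2 * ld ^ (2 * \<beta>)"
    using arg_cong[OF root_prod_flip[OF b' d'], of "\<lambda>z. z\<^sup>2"]
    by (simp add: power_mult_distrib s2 nk l r power_mult[symmetric] mult.commute)
  have w': "w' \<noteq> 0" unfolding r using cop by (intro root_prod_nz[OF d']) blast
  have u: "u \<noteq> 0" unfolding r
    by (rule root_prod_nz[OF b']) (metis bd(1) mult_zero_right poly_mult prim(1))
  have v: "v \<noteq> 0" unfolding r
    by (rule root_prod_nz[OF d']) (metis bd(2) mult_zero_right poly_mult prim(2))
  have lnz: "lb \<noteq> 0" "ld \<noteq> 0" "lD \<noteq> 0" "f \<noteq> 0" "g \<noteq> 0"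
    using b' d' D plc_nz nd by (auto simp: l)
  have "w'\<^sup>2 * (q * u\<^sup>2 * ld ^ (2 * \<beta>) * lb ^ (2 * \<delta>) * lD ^ (2 * \<gamma>)) =
     q * (w\<^sup>2 * lb ^ (2 * \<gamma>)) * u\<^sup>2 * lb ^ (2 * \<delta>) * lD ^ (2 * \<gamma>)"
    unfolding C3 by (simp only: ac_simps)
  also have "\<dots> = q * ((w * u)\<^sup>2 * lb ^ (2 * \<delta>)) * lb ^ (2 * \<gamma>) * lD ^ (2 * \<gamma>)"
    by (simp only: power_mult_distrib ac_simps)
  also have "\<dots> = ((root_prod D b')\<^sup>2 * q) * lD ^ (2 * \<beta>) * lb ^ (2 * \<gamma>) * lD ^ (2 * \<gamma>)"
    unfolding C1[symmetric] by (simp only: ac_simps)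
  also have "\<dots> = p * ((root_prod D d')\<^sup>2 * lD ^ (2 * \<gamma>)) * lD ^ (2 * \<beta>) * lb ^ (2 * \<gamma>)"
    unfolding C0 by (simp only: ac_simps)
  also have "\<dots> = w'\<^sup>2 * (p * v\<^sup>2 * ld ^ (2 * \<delta>) * lD ^ (2 * \<beta>) * lb ^ (2 * \<gamma>))"
    unfolding C2 by (simp only: power_mult_distrib ac_simps)
  finally have C: "q * u\<^sup>2 * ld ^ (2 * \<beta>) * lb ^ (2 * \<delta>) * lD ^ (2 * \<gamma>) =
      p * v\<^sup>2 * ld ^ (2 * \<delta>) * lD ^ (2 * \<beta>) * lb ^ (2 * \<gamma>)"
    using w' by simp
  define X where "X = u\<^sup>2 * v\<^sup>2"
  have "X * ((- 1) ^ k * eval_zeros G F * ld ^ (k + 2 * \<beta>) * f ^ (2 * \<delta>) * lb ^ (2 * \<delta>) * lD ^ (2 * \<gamma> + n) * g ^ (2 * \<beta>)) =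
     (eval_zeros G F * v\<^sup>2 * ld ^ k * f ^ (2 * \<delta>)) * (- 1) ^ k * u\<^sup>2 * ld ^ (2 * \<beta>) * lb ^ (2 * \<delta>) * lD ^ (2 * \<gamma>) * lD ^ n * g ^ (2 * \<beta>)"
    unfolding X_def power_add by (simp only: ac_simps)
  also have "\<dots> = ((- 1) ^ k * (- 1) ^ k) * (q * u\<^sup>2 * ld ^ (2 * \<beta>) * lb ^ (2 * \<delta>) * lD ^ (2 * \<gamma>)) * lD ^ k * f ^ (2 * \<gamma>) * lD ^ n * g ^ (2 * \<beta>)"
    unfolding B by (simp only: ac_simps)
  also have "(- 1) ^ k * (- 1) ^ k = (1 :: 'k)" by (simp flip: power_add)
  also have "1 * (q * u\<^sup>2 * ld ^ (2 * \<beta>) * lb ^ (2 * \<delta>) * lD ^ (2 * \<gamma>)) * lD ^ k * f ^ (2 * \<gamma>) * lD ^ n * g ^ (2 * \<beta>) =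
     (p * lD ^ n * g ^ (2 * \<beta>)) * v\<^sup>2 * ld ^ (2 * \<delta>) * lD ^ (2 * \<beta>) * lb ^ (2 * \<gamma>) * lD ^ k * f ^ (2 * \<gamma>)"
    unfolding C by (simp only: ac_simps mult_1)
  also have "\<dots> = X * (eval_zeros F G * lb ^ (n + 2 * \<gamma>) * g ^ (2 * \<delta>) * ld ^ (2 * \<delta>) * lD ^ (2 * \<beta> + k) * f ^ (2 * \<gamma>))"
    unfolding A[symmetric] X_def power_add by (simp only: ac_simps)
  finally have "(- 1) ^ k * eval_zeros G F * ld ^ (k + 2 * \<beta>) * f ^ (2 * \<delta>) * lb ^ (2 * \<delta>) * lD ^ (2 * \<gamma> + n) * g ^ (2 * \<beta>) =
     eval_zeros F G * lb ^ (n + 2 * \<gamma>) * g ^ (2 * \<delta>) * ld ^ (2 * \<delta>) * lD ^ (2 * \<beta> + k) * f ^ (2 * \<gamma>)"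
    using u v by (simp add: X_def)
  thus "(- 1) ^ pdeg F * eval_zeros G F * lead_coeff d' ^ (pdeg F + 2 * degree b') * plc F ^ (2 * degree D) *
        lead_coeff b' ^ (2 * degree D) * lead_coeff D ^ (2 * degree d' + pdeg G) * plc G ^ (2 * degree b') =
     eval_zeros F G * lead_coeff b' ^ (pdeg G + 2 * degree d') * plc G ^ (2 * degree D) *
        lead_coeff d' ^ (2 * degree D) * lead_coeff D ^ (2 * degree b' + pdeg F) * plc F ^ (2 * degree d')"
    unfolding nk l .
qed

text \<open>
  It remains to compare degrees and leading coefficients in \<open>core_identity\<close>; the assumption on
  the degrees holds for one of the two orders of \<open>F\<close> and \<open>G\<close>.
\<close>

lemma recip_primitive_aux:
  fixes a b c d
  defines "F \<equiv> [:c, d:]" and "G \<equiv> [:a, b:]"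
  assumes prim: "\<And>r. poly a r \<noteq> 0 \<or> poly b r \<noteq> 0" "\<And>r. poly c r \<noteq> 0 \<or> poly d r \<noteq> 0"
    and nz: "b \<noteq> 0" "d \<noteq> 0"
    and disj: "\<And>P. P \<in> apts \<Longrightarrow> pval F P \<noteq> 0 \<or> pval G P \<noteq> 0"
    and deg: "odd (pdeg G) \<or> (even (pdeg F) \<and> degree c + degree b \<le> degree a + degree d)"
  shows "recip F G"
proof -
  obtain e b' d' where bd: "b = e * b'" "d = e * d'" and le: "lead_coeff e = 1"
    and cop: "\<And>r. poly b' r \<noteq> 0 \<or> poly d' r \<noteq> 0"
    using extract_common_roots[OF nz] by metis
  define D where "D = c * b' - d' * a"
  note core = core_identity[OF prim nz bd cop disj[unfolded F_def G_def], folded F_def G_def D_def]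
  have nd: "\<not> W dvd F" "\<not> W dvd G" using nz by (simp_all add: F_def G_def)
  have b': "b' \<noteq> 0" and d': "d' \<noteq> 0" and e: "e \<noteq> 0" using nz bd by auto
  define n k \<beta> \<gamma> \<delta> \<epsilon> where nk: "n = pdeg G" "k = pdeg F" "\<beta> = degree b'" "\<gamma> = degree d'" "\<delta> = degree D" "\<epsilon> = degree e"
  define lb ld lD f g where l: "lb = lead_coeff b'" "ld = lead_coeff d'" "lD = lead_coeff D" "f = plc F" "g = plc G"
  define x y where xy: "x = eval_zeros F G" "y = eval_zeros G F"
  have lnz: "lb \<noteq> 0" "ld \<noteq> 0" "lD \<noteq> 0" "f \<noteq> 0" "g \<noteq> 0"
    using b' d' core(1) plc_nz nd by (auto simp: l)
  have db: "degree b = \<epsilon> + \<beta>" "degree d = \<epsilon> + \<gamma>" using b' d' e by (simp_all add: bd degree_mult_eq nk)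
  have lbd: "lead_coeff b = lb" "lead_coeff d = ld" unfolding bd lead_coeff_mult le l by simp_all
  have E: "(- 1) ^ k * y * ld ^ (k + 2 * \<beta>) * f ^ (2 * \<delta>) * lb ^ (2 * \<delta>) * lD ^ (2 * \<gamma> + n) * g ^ (2 * \<beta>) =
     x * lb ^ (n + 2 * \<gamma>) * g ^ (2 * \<delta>) * ld ^ (2 * \<delta>) * lD ^ (2 * \<beta> + k) * f ^ (2 * \<gamma>)"
    using core(2) unfolding nk l xy .
  have goal: "recip F G" if "x * g ^ k = (- 1) ^ (k * n) * (y * f ^ n)"
    using that unfolding recip_def xy nk l .
  have Godd: "n = 2 * (\<epsilon> + \<beta>) + 3 \<and> g = lb \<and> (a = 0 \<or> 2 * degree a < n)" if "odd n"
    using nd(2) that by (cases rule: pdeg_cases) (auto simp: G_def nk(1) l(5) db lbd[symmetric])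
  have Fodd: "k = 2 * (\<epsilon> + \<gamma>) + 3 \<and> f = ld" if "odd k"
    using nd(1) that by (cases rule: pdeg_cases) (auto simp: F_def nk(2) l(4) db lbd[symmetric])
  have Geven: "n = 2 * degree a \<and> a \<noteq> 0 \<and> g = lead_coeff a" if "even n"
    using nd(2) that by (cases rule: pdeg_cases) (auto simp: G_def nk(1) l(5))
  have Feven: "k = 2 * degree c \<and> c \<noteq> 0 \<and> f = lead_coeff c \<and> 2 * (\<epsilon> + \<gamma>) + 3 < k" if "even k"
    using nd(1) that nz by (cases rule: pdeg_cases) (auto simp: F_def nk(2) l(4) db)
  have da: "degree (d' * a) = \<gamma> + degree a" "lead_coeff (d' * a) = ld * lead_coeff a" if "a \<noteq> 0"
    using that d' by (simp add: degree_mult_eq nk, simp only: lead_coeff_mult l)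
  have cb: "degree (c * b') = degree c + \<beta>" "lead_coeff (c * b') = lead_coeff c * lb" if "c \<noteq> 0"
    using that b' by (simp add: degree_mult_eq nk, simp only: lead_coeff_mult l)
  consider (oo) "odd n" "odd k" | (oe) "odd n" "even k" | (ee) "even n" "even k"
    using deg unfolding nk by blast
  thus ?thesis
  proof cases
    case oo
    \<comment> \<open>With \<open>f = ld\<close> and \<open>g = lb\<close> the powers with exponent
      \<open>2 * \<delta>\<close> agree on both sides, and so do the powers of \<open>lD\<close>:
      both cancel whatever the degree of \<open>D\<close> is.\<close>
    note G = Godd[OF oo(1)] and F = Fodd[OF oo(2)]
    have fg: "f = ld" "g = lb" using F G by auto
    have nn: "n = 2 * \<epsilon> + 2 * \<beta> + 3" "k = 2 * \<epsilon> + 2 * \<gamma> + 3" using F G by auto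
    define X where "X = ld ^ (2 * \<delta> + 2 * \<gamma>) * lb ^ (2 * \<delta> + 2 * \<beta>) * lD ^ (2 * \<epsilon> + 2 * \<beta> + 2 * \<gamma> + 3)"
    have "(- 1) ^ k = (- 1 :: 'k)" "(- 1) ^ (k * n) = (- 1 :: 'k)" using oo by simp_all
    moreover have eq: "X * (- y * ld ^ n) = X * (x * lb ^ k)"
      using E unfolding \<open>(- 1) ^ k = (- 1 :: 'k)\<close> fg nn X_def by (simp add: power_add ac_simps)
    moreover have "X \<noteq> 0" using lnz by (simp add: X_def)
    hence "x * lb ^ k = - y * ld ^ n" using eq by (metis mult_left_cancel)
    ultimately show ?thesis using fg by (intro goal) simp
  next
    case oe
    note G = Godd[OF oe(1)] and F = Feven[OF oe(2)]
    define \<kappa> where "\<kappa> = degree c"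
    have cb': "degree (c * b') = \<kappa> + \<beta>" "lead_coeff (c * b') = f * lb" using cb F \<kappa>_def by auto
    \<comment> \<open>\<open>2 * degree a < 2 * (\<epsilon> + \<beta>) + 3\<close> and
      \<open>2 * (\<epsilon> + \<gamma>) + 3 < 2 * \<kappa>\<close> add up to the claim that
      \<open>c * b'\<close> dominates in \<open>D\<close>.\<close>
    have "degree (- (d' * a)) < degree (c * b') \<or> d' * a = 0"
      using G F da(1) unfolding cb'(1) \<kappa>_def by (cases "a = 0") auto
    hence "degree D = degree (c * b') \<and> lead_coeff D = lead_coeff (c * b')"
    proof
      assume less: "degree (- (d' * a)) < degree (c * b')"
      have "D = - (d' * a) + c * b'" by (simp add: D_def)
      thus ?thesis using degree_add_eq_right[OF less] lead_coeff_add_le[OF less] by simp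
    next
      assume "d' * a = 0"
      hence "D = c * b'" unfolding D_def by (simp only: diff_zero)
      thus ?thesis by simp
    qed
    hence dD: "\<delta> = \<kappa> + \<beta>" "lD = f * lb" using cb' unfolding nk(5) l(3) by metis+
    have fg: "g = lb" and nn: "n = 2 * \<epsilon> + 2 * \<beta> + 3" "k = 2 * \<kappa>" using F G by (auto simp: \<kappa>_def)
    define X where "X = ld ^ (2 * \<kappa> + 2 * \<beta>) * lb ^ (2 * \<kappa> + 4 * \<beta> + 2 * \<beta> + 2 * \<gamma> + 2 * \<epsilon> + 3) * f ^ (2 * \<kappa> + 2 * \<beta> + 2 * \<gamma>)"
    have "X * (y * f ^ n) = X * (x * lb ^ k)"
      using E unfolding fg nn dD X_def power_mult_distrib by (simp add: power_add ac_simps)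
    moreover have "X \<noteq> 0" using lnz by (simp add: X_def)
    ultimately show ?thesis using fg oe by (intro goal) simp
  next
    case ee
    note G = Geven[OF ee(1)] and F = Feven[OF ee(2)]
    define \<kappa> where "\<kappa> = degree c"
    define \<alpha> where "\<alpha> = degree a"
    have nn: "n = 2 * \<alpha>" "k = 2 * \<kappa>" using F G by (auto simp: \<kappa>_def \<alpha>_def)
    have "degree c + degree b \<le> degree a + degree d" using deg ee unfolding nk(1,2) by blast
    hence le: "\<kappa> + \<beta> \<le> \<alpha> + \<gamma>" using db unfolding \<kappa>_def \<alpha>_def by simp
    have cb': "degree (c * b') = \<kappa> + \<beta>" "lead_coeff (c * b') = f * lb" using cb F \<kappa>_def by auto
    have da': "degree (d' * a) = \<alpha> + \<gamma>" "lead_coeff (d' * a) = ld * g" using da G \<alpha>_def by auto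
    have yx: "y * f ^ (2 * \<alpha>) = x * g ^ (2 * \<kappa>)"
    proof (cases "\<kappa> + \<beta> < \<alpha> + \<gamma>")
      case True
      hence less: "degree (c * b') < degree (- (d' * a))" using cb' da' by simp
      have "D = c * b' + - (d' * a)" by (simp add: D_def)
      hence dD: "\<delta> = \<alpha> + \<gamma>" "lD = - (ld * g)"
        unfolding nk(5) l(3) using degree_add_eq_right[OF less] lead_coeff_add_le[OF less] da' by simp_all
      have even: "lD ^ (2 * i) = (ld * g) ^ (2 * i)" for i by (simp add: dD)
      define X where "X = ld ^ (2 * \<alpha> + 2 * \<beta> + 2 * \<gamma> + 2 * \<kappa>) * lb ^ (2 * \<alpha> + 2 * \<gamma>) * g ^ (2 * \<alpha> + 2 * \<beta> + 2 * \<gamma>) * f ^ (2 * \<gamma>)"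
      have "lD ^ (2 * \<gamma> + n) = (ld * g) ^ (2 * \<gamma> + 2 * \<alpha>)" "lD ^ (2 * \<beta> + k) = (ld * g) ^ (2 * \<beta> + 2 * \<kappa>)"
        using even[of "\<gamma> + \<alpha>"] even[of "\<beta> + \<kappa>"] by (simp_all add: nn distrib_left)
      hence "X * (y * f ^ (2 * \<alpha>)) = X * (x * g ^ (2 * \<kappa>))"
        using E ee unfolding nn dD(1) X_def power_mult_distrib by (simp add: power_add ac_simps)
      moreover have "X \<noteq> 0" using lnz by (simp add: X_def)
      ultimately show ?thesis by simp
    next
      case False
      hence eq: "\<kappa> + \<beta> = \<alpha> + \<gamma>" using le by simp
      \<comment> \<open>For equal degrees the leading terms of \<open>c * b'\<close> and
        \<open>d' * a\<close> may cancel, which leaves \<open>\<delta>\<close> and \<open>lD\<close>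
        unknown. By this equation \<open>lD\<close> drops out; and cancellation means
        \<open>f * lb = ld * g\<close>, which makes the powers with exponent
        \<open>2 * \<delta>\<close> drop out as well.\<close>
      have e2: "2 * \<gamma> + n = 2 * \<beta> + k" using eq nn by simp
      have E': "y * ld ^ (2 * \<kappa> + 2 * \<beta>) * f ^ (2 * \<delta>) * lb ^ (2 * \<delta>) * g ^ (2 * \<beta>) =
         x * lb ^ (2 * \<alpha> + 2 * \<gamma>) * g ^ (2 * \<delta>) * ld ^ (2 * \<delta>) * f ^ (2 * \<gamma>)"
      proof -
        have "lD ^ (2 * \<beta> + k) * (y * ld ^ (2 * \<kappa> + 2 * \<beta>) * f ^ (2 * \<delta>) * lb ^ (2 * \<delta>) * g ^ (2 * \<beta>)) =
           lD ^ (2 * \<beta> + k) * (x * lb ^ (2 * \<alpha> + 2 * \<gamma>) * g ^ (2 * \<delta>) * ld ^ (2 * \<delta>) * f ^ (2 * \<gamma>))"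
          using E ee unfolding e2 by (simp add: nn ac_simps)
        thus ?thesis using lnz by simp
      qed
      show ?thesis
      proof (cases "f * lb = ld * g")
        case True
        have "(f * lb) ^ (2 * \<delta>) * (f ^ (2 * \<gamma>) * (y * ld ^ (2 * \<kappa> + 2 * \<beta>) * g ^ (2 * \<beta>))) =
           (ld * g) ^ (2 * \<delta>) * (f ^ (2 * \<gamma>) * (x * lb ^ (2 * \<alpha> + 2 * \<gamma>) * f ^ (2 * \<gamma>)))"
          unfolding power_mult_distrib using arg_cong[OF E', of "\<lambda>z. f ^ (2 * \<gamma>) * z"] by (simp only: ac_simps)
        hence "y * ld ^ (2 * \<kappa> + 2 * \<beta>) * g ^ (2 * \<beta>) = x * lb ^ (2 * \<alpha> + 2 * \<gamma>) * f ^ (2 * \<gamma>)"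
          unfolding True using lnz by simp
        hence "f ^ (2 * \<alpha>) * (y * ld ^ (2 * \<kappa> + 2 * \<beta>) * g ^ (2 * \<beta>)) = x * (f * lb) ^ (2 * \<alpha> + 2 * \<gamma>)"
          by (simp add: power_mult_distrib power_add ac_simps)
        also have "\<dots> = x * (ld ^ (2 * \<kappa> + 2 * \<beta>) * g ^ (2 * \<kappa> + 2 * \<beta>))"
          using eq by (simp only: True power_mult_distrib flip: distrib_left)
        finally have "(ld ^ (2 * \<kappa> + 2 * \<beta>) * g ^ (2 * \<beta>)) * (y * f ^ (2 * \<alpha>)) =
            (ld ^ (2 * \<kappa> + 2 * \<beta>) * g ^ (2 * \<beta>)) * (x * g ^ (2 * \<kappa>))"
          by (simp add: power_add ac_simps)
        thus ?thesis using lnz by simp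
      next
        case False
        have "coeff D (\<alpha> + \<gamma>) = f * lb - ld * g"
          unfolding D_def coeff_diff using cb' da' eq by metis
        hence "coeff D (\<alpha> + \<gamma>) \<noteq> 0" using False by simp
        moreover have "degree D \<le> \<alpha> + \<gamma>" unfolding D_def
          using cb' da' eq by (intro degree_diff_le) auto
        ultimately have "\<delta> = \<alpha> + \<gamma>" unfolding nk by (intro antisym le_degree)
        define X where "X = ld ^ (2 * \<alpha> + 2 * \<gamma>) * lb ^ (2 * \<alpha> + 2 * \<gamma>) * f ^ (2 * \<gamma>) * g ^ (2 * \<beta>)"
        have e3: "2 * \<kappa> + 2 * \<beta> = 2 * \<alpha> + 2 * \<gamma>" using eq by simp
        have g3: "g ^ (2 * \<alpha> + 2 * \<gamma>) = g ^ (2 * \<kappa>) * g ^ (2 * \<beta>)" unfolding e3[symmetric] by (rule power_add)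
        have "y * ld ^ (2 * \<alpha> + 2 * \<gamma>) * f ^ (2 * \<alpha> + 2 * \<gamma>) * lb ^ (2 * \<alpha> + 2 * \<gamma>) * g ^ (2 * \<beta>) =
         x * lb ^ (2 * \<alpha> + 2 * \<gamma>) * g ^ (2 * \<alpha> + 2 * \<gamma>) * ld ^ (2 * \<alpha> + 2 * \<gamma>) * f ^ (2 * \<gamma>)"
          using E' unfolding \<open>\<delta> = \<alpha> + \<gamma>\<close> e3 by (simp only: distrib_left)
        hence "X * (y * f ^ (2 * \<alpha>)) = X * (x * g ^ (2 * \<kappa>))"
          unfolding g3 power_add[of f] X_def by (simp only: ac_simps)
        moreover have "X \<noteq> 0" using lnz by (simp add: X_def)
        ultimately show ?thesis by simp
      qed
    qed
    show ?thesis by (rule goal) (use yx ee in \<open>simp add: nn\<close>)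
  qed
qed

text \<open>If \<open>b\<close> or \<open>d\<close> is 0, primitivity leaves a nonzero constant.
  Otherwise the parities and degrees allow \<open>recip_primitive_aux\<close> in at least one of the
  two orders, and the relation is symmetric.\<close>

lemma recip_primitive:
  assumes prim: "\<And>r. poly a r \<noteq> 0 \<or> poly b r \<noteq> 0" "\<And>r. poly c r \<noteq> 0 \<or> poly d r \<noteq> 0"
    and disj: "\<And>P. P \<in> apts \<Longrightarrow> pval [:c, d:] P \<noteq> 0 \<or> pval [:a, b:] P \<noteq> 0"
  shows "recip [:c, d:] [:a, b:]"
proof -
  have const: "\<exists>z. z \<noteq> 0 \<and> p = [:z:]" if "\<And>r. poly p r \<noteq> 0" for p :: "'k poly"
  proof -
    have "degree p = 0" using that alg_closed_imp_poly_has_root[of p] by auto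
    then obtain z where "p = [:z:]" by (rule degree_eq_zeroE)
    thus ?thesis using that[of 0] by auto
  qed
  have nd: "\<not> W dvd [:a, b:]" "\<not> W dvd [:c, d:]" using prim(1)[of 0] prim(2)[of 0] by auto
  show ?thesis
  proof (cases "b = 0 \<or> d = 0")
    case True
    thus ?thesis
    proof
      assume "b = 0"
      then obtain z where "z \<noteq> 0" "a = [:z:]" using const[of a] prim(1) by auto
      thus ?thesis using recip_sym[OF recip_const[OF nd(2), of z]] \<open>b = 0\<close> by simp
    next
      assume "d = 0"
      then obtain z where "z \<noteq> 0" "c = [:z:]" using const[of c] prim(2) by auto
      thus ?thesis using recip_const[OF nd(1), of z] \<open>d = 0\<close> by simp
    qed
  next
    case False
    hence nz: "b \<noteq> 0" "d \<noteq> 0" by auto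
    have disj': "\<And>P. P \<in> apts \<Longrightarrow> pval [:a, b:] P \<noteq> 0 \<or> pval [:c, d:] P \<noteq> 0" using disj by blast
    have "(odd (pdeg [:a, b:]) \<or> (even (pdeg [:c, d:]) \<and> degree c + degree b \<le> degree a + degree d)) \<or>
        (odd (pdeg [:c, d:]) \<or> (even (pdeg [:a, b:]) \<and> degree a + degree d \<le> degree c + degree b))"
      by linarith
    thus ?thesis
      using recip_primitive_aux[OF prim nz disj] recip_sym[OF recip_primitive_aux[OF prim(2,1) nz(2,1) disj']] by blast
  qed
qed

text \<open>Every nonzero reduced function is a product of vertical lines and a primitive function,
  as common roots of \<open>a\<close> and \<open>b\<close> can be split off.\<close>

lemma primitive_induct [consumes 1, case_names prim vert]:
  assumes "a \<noteq> 0 \<or> b \<noteq> 0"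
    and prim: "\<And>a b. (\<And>r. poly a r \<noteq> 0 \<or> poly b r \<noteq> 0) \<Longrightarrow> \<Phi> [:a, b:]"
    and step: "\<And>r F. \<not> W dvd F \<Longrightarrow> \<Phi> F \<Longrightarrow> \<Phi> (vert r * F)"
  shows "\<Phi> [:a, b:]"
  using assms(1)
proof (induction "degree a + degree b" arbitrary: a b rule: less_induct)
  case less
  show ?case
  proof (cases "\<exists>r. poly a r = 0 \<and> poly b r = 0")
    case True
    then obtain r a' b' where *: "a = [:- r, 1:] * a'" "b = [:- r, 1:] * b'"
      by (metis dvdE poly_eq_0_iff_dvd)
    have "degree a' \<le> degree a" "degree b' \<le> degree b" "a' \<noteq> 0 \<longrightarrow> degree a' < degree a"
         "b' \<noteq> 0 \<longrightarrow> degree b' < degree b"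
      by (cases "a' = 0"; cases "b' = 0"; simp add: * degree_mult_eq del: mult_pCons_left)+
    moreover have nz: "a' \<noteq> 0 \<or> b' \<noteq> 0" using less.prems * by auto
    ultimately have "degree a' + degree b' < degree a + degree b" by auto
    from step[OF _ less.hyps[OF this nz], of r] nz have "\<Phi> (vert r * [:a', b':])" by simp
    moreover have "vert r * [:a', b':] = [:a, b:]" unfolding * by simp
    ultimately show ?thesis by metis
  next
    case False
    thus ?thesis using prim by blast
  qed
qed

text \<open>Disjointness stands inside the statement proved by induction because it has to be passed
  down to the factors; the vertical lines are covered by \<open>recip_vert\<close>.\<close>

lemma recip_reduced:
  assumes "a \<noteq> 0 \<or> b \<noteq> 0" "c \<noteq> 0 \<or> d \<noteq> 0"
  shows "(\<forall>P\<in>apts. pval [:c, d:] P \<noteq> 0 \<or> pval [:a, b:] P \<noteq> 0) \<longrightarrow> recip [:c, d:] [:a, b:]"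
  using assms(1)
proof (induction a b rule: primitive_induct)
  case G: (prim a b)
  show ?case
    using assms(2)
  proof (induction c d rule: primitive_induct)
    case (prim c d)
    thus ?case using recip_primitive[OF G] by blast
  next
    case (vert r F)
    have nd: "\<not> W dvd [:a, b:]" using G[of 0] by auto
    have "recip F [:a, b:] \<Longrightarrow> recip (vert r * F) [:a, b:]"
      using recip_mult[OF _ vert(1) recip_vert[OF nd]] by simp
    thus ?case using vert(2) unfolding pval_mult by auto
  qed
next
  case (vert r G)
  have nd: "\<not> W dvd [:c, d:]" using assms(2) by simp
  show ?case
  proof
    assume "\<forall>P\<in>apts. pval [:c, d:] P \<noteq> 0 \<or> pval (vert r * G) P \<noteq> 0"
    hence "recip [:c, d:] G" using vert(2) unfolding pval_mult by auto
    hence "recip (vert r * G) [:c, d:]"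
      using recip_mult[OF _ vert(1) recip_vert[OF nd] recip_sym] by simp
    thus "recip [:c, d:] (vert r * G)" by (rule recip_sym)
  qed
qed

theorem recip_disjoint:
  assumes "\<not> W dvd F" "\<not> W dvd G" "\<And>P. P \<in> apts \<Longrightarrow> pval F P \<noteq> 0 \<or> pval G P \<noteq> 0"
  shows "recip F G"
proof -
  have "\<forall>P\<in>apts. pval (red F) P \<noteq> 0 \<or> pval (red G) P \<noteq> 0"
    using assms(3) pval_congW[OF _ red_cong[of F]] pval_congW[OF _ red_cong[of G]] by metis
  hence "recip (red F) (red G)"
    using recip_reduced assms(1,2) unfolding dvd_red_iff[of F] dvd_red_iff[of G] by blast
  hence "recip F (red G)" using recip_congW[OF assms(1) _ red_cong] congW_dvd[OF red_cong] assms(2) by blast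
  thus ?thesis using recip_congW[OF assms(2,1) red_cong] recip_sym by blast
qed

section \<open>Reciprocity for rational functions\<close>

text \<open>The tame symbol without its sign.\<close>

definition tame :: "'k point \<Rightarrow> 'k ratfun \<Rightarrow> 'k ratfun \<Rightarrow> 'k" where
  "tame P f g = rlc P f powi rord P g / rlc P g powi rord P f"

lemma tame_trivial: "rord P f = 0 \<Longrightarrow> rord P g = 0 \<Longrightarrow> tame P f g = 1"
  by (simp add: tame_def)

lemma tame_swap: "tame P g f = inverse (tame P f g)"
  by (simp add: tame_def)

context
  fixes P :: "'k point"
  assumes P: "P \<in> curve_points E"
begin


lemma tame_divide_left:
  assumes "nonzero_rf f" "nonzero_rf f'" "nonzero_rf g"
  shows "tame P (f / f') g = tame P f g / tame P f' g"
  using assms rlc_nz[OF P assms(3)]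
  by (simp add: tame_def rord_divide[OF P] rlc_divide[OF P] power_int_divide_distrib power_int_diff)

lemma tame_divide_right:
  assumes "nonzero_rf f" "nonzero_rf g" "nonzero_rf g'"
  shows "tame P f (g / g') = tame P f g / tame P f g'"
  using tame_divide_left[OF assms(2,3,1)] tame_swap[of P f] by (simp add: divide_inverse)

lemma tame_rf_eq: "nonzero_rf f \<Longrightarrow> rf_eq E f f' \<Longrightarrow> tame P f g = tame P f' g"
  using rf_eq_rord[OF P] by (simp add: tame_def)

end

definition ratfun_of :: "'k poly poly \<Rightarrow> 'k ratfun" where "ratfun_of F = Fract F 1"

lemma nonzero_rf_ratfun_of: "\<not> W dvd F \<Longrightarrow> nonzero_rf (ratfun_of F)"
  unfolding ratfun_of_def by (rule nonzero_rf_Fract) simp_all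

lemma ordp_1: "P \<in> curve_points E \<Longrightarrow> ordp P 1 = 0" and lcp_1: "P \<in> curve_points E \<Longrightarrow> lcp P 1 = 1"
  using ordp_mult[of P 1 1] lcp_mult[of P 1 1] lcp_nz[of P 1] by simp_all

lemma rord_ratfun_of: "P \<in> curve_points E \<Longrightarrow> \<not> W dvd F \<Longrightarrow> rord P (ratfun_of F) = ordp P F"
  and rlc_ratfun_of: "P \<in> curve_points E \<Longrightarrow> \<not> W dvd F \<Longrightarrow> rlc P (ratfun_of F) = lcp P F"
  unfolding ratfun_of_def by (simp_all add: rord_Fract rlc_Fract ordp_1 lcp_1)

lemma Fract_ratfun_of: "G \<noteq> 0 \<Longrightarrow> Fract F G = ratfun_of F / ratfun_of G"
  by (simp add: ratfun_of_def)

lemma apts_curve: "P \<in> apts \<Longrightarrow> P \<in> curve_points E"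
  by (simp add: apts_def)

lemma tame_ratfun_of:
  assumes "P \<in> apts" "\<not> W dvd F" "\<not> W dvd G" "pval F P \<noteq> 0 \<or> pval G P \<noteq> 0"
  shows "tame P (ratfun_of F) (ratfun_of G) = pval F P ^ nat (ordp P G) / pval G P ^ nat (ordp P F)"
proof -
  note c = apts_curve[OF assms(1)]
  have F: "lcp P F powi ordp P G = pval F P ^ nat (ordp P G)"
  proof (cases "pval F P = 0")
    case True
    hence "ordp P G = 0" using assms ordp_eq_0_iff by blast
    thus ?thesis by simp
  qed (use lcp_pval assms(1) ordp_nonneg in \<open>simp add: power_int_def\<close>)
  have G: "lcp P G powi ordp P F = pval G P ^ nat (ordp P F)"
  proof (cases "pval G P = 0")
    case True
    hence "ordp P F = 0" using assms ordp_eq_0_iff by blast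
    thus ?thesis by simp
  qed (use lcp_pval assms(1) ordp_nonneg in \<open>simp add: power_int_def\<close>)
  show ?thesis using assms c F G by (simp add: tame_def rord_ratfun_of rlc_ratfun_of)
qed

lemma eval_zeros_prod:
  assumes "\<not> W dvd G" "finite S" "{P \<in> apts. pval G P = 0} \<subseteq> S" "S \<subseteq> apts"
  shows "eval_zeros F G = (\<Prod>P\<in>S. pval F P ^ nat (ordp P G))"
proof -
  have "eval_zeros F G = (\<Prod>P\<in>set_mset (zeros G). pval F P ^ count (zeros G) P)"
    unfolding eval_zeros_def by (rule image_prod_mset_multiplicity)
  also have "\<dots> = (\<Prod>P\<in>S. pval F P ^ count (zeros G) P)"
  proof (rule prod.mono_neutral_left)
    show "set_mset (zeros G) \<subseteq> S" using assms by (simp add: set_zeros)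
  qed (auto simp: not_in_iff assms(2))
  also have "\<dots> = (\<Prod>P\<in>S. pval F P ^ nat (ordp P G))"
    using assms by (intro prod.cong) (auto simp: count_zeros)
  finally show ?thesis .
qed

lemma reciprocity_poly:
  assumes "\<not> W dvd F" "\<not> W dvd G" "\<And>P. P \<in> apts \<Longrightarrow> pval F P \<noteq> 0 \<or> pval G P \<noteq> 0"
    and S: "finite S" "S \<subseteq> apts" "{P \<in> apts. pval F P = 0} \<subseteq> S" "{P \<in> apts. pval G P = 0} \<subseteq> S"
  shows "(\<Prod>P\<in>S. tame P (ratfun_of F) (ratfun_of G)) * tame Infinity (ratfun_of F) (ratfun_of G) = (- 1) ^ (pdeg F * pdeg G)"
proof -
  have "(\<Prod>P\<in>S. tame P (ratfun_of F) (ratfun_of G)) = (\<Prod>P\<in>S. pval F P ^ nat (ordp P G) / pval G P ^ nat (ordp P F))"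
    using S assms by (intro prod.cong refl tame_ratfun_of) auto
  also have "\<dots> = eval_zeros F G / eval_zeros G F"
    using assms S by (simp add: prod_dividef eval_zeros_prod)
  finally have 1: "(\<Prod>P\<in>S. tame P (ratfun_of F) (ratfun_of G)) = eval_zeros F G / eval_zeros G F" .
  have 2: "tame Infinity (ratfun_of F) (ratfun_of G) = plc G ^ pdeg F / plc F ^ pdeg G"
    using assms by (simp add: tame_def rord_ratfun_of rlc_ratfun_of power_int_minus field_simps)
  have "pval G P \<noteq> 0" if "P \<in># zeros F" for P
    using that assms(3)[of P] unfolding set_zeros[OF assms(1)] by auto
  hence nz: "eval_zeros G F \<noteq> 0" by (auto simp: eval_zeros_def)
  have "eval_zeros F G * plc G ^ pdeg F = (- 1) ^ (pdeg F * pdeg G) * (eval_zeros G F * plc F ^ pdeg G)"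
    using recip_disjoint[OF assms(1-3)] unfolding recip_def .
  thus ?thesis unfolding 1 2 using nz plc_nz[OF assms(1)] by (simp add: field_simps)
qed

text \<open>For each point some representation has a denominator nonzero there; two representations
  are merged into \<open>(A1 + s A2) / (B1 + s B2)\<close> with a generic constant \<open>s\<close>.
  Once the denominator avoids \<open>Z\<close>, order 0 makes the numerator avoid it too.\<close>

lemma Fract_avoiding:
  assumes f: "nonzero_rf f" and Z: "finite Z" "Z \<subseteq> apts" "\<And>z. z \<in> Z \<Longrightarrow> rord z f = 0"
  shows "\<exists>A B. rf_eq E f (Fract A B) \<and> \<not> W dvd A \<and> \<not> W dvd B \<and>
    (\<forall>z\<in>Z. pval A z \<noteq> 0 \<and> pval B z \<noteq> 0)"
proof -
  obtain F G where FG: "f = Fract F G" "\<not> W dvd F" "\<not> W dvd G" using f by (auto elim: nonzero_rfE)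
  have "\<exists>A B. F * B \<doteq> A * G \<and> \<not> W dvd B \<and> (\<forall>z\<in>Z. pval B z \<noteq> 0)"
    using Z
  proof (induction Z rule: finite_induct)
    case empty
    show ?case using FG(3) by (intro exI[of _ F] exI[of _ G]) auto
  next
    case (insert z0 Z)
    then obtain A1 B1 where 1: "F * B1 \<doteq> A1 * G" "\<And>z. z \<in> Z \<Longrightarrow> pval B1 z \<noteq> 0" by blast
    have z0: "z0 \<in> apts" "z0 \<in> curve_points E" "rord z0 f = 0" using insert.prems apts_curve by auto
    have "has_value E f z0 (rlc z0 f)" using has_value_iff[OF z0(2) f] z0(3) by simp
    then obtain d A2 B2 where 2: "form_of_degree d B2" "form_value d B2 z0 \<noteq> 0" "rf_eq E f (Fract A2 B2)"
      unfolding has_value_def by blast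
    have B2: "\<not> W dvd B2" using form_value_nonzero(1)[OF z0(2) 2(1,2)] .
    have eq2: "F * B2 \<doteq> A2 * G" using 2(3) rf_eq_Fract[OF FG(3) B2] FG(1) by simp
    have v2: "pval B2 z0 \<noteq> 0" using 2(2) z0(1) by (auto elim!: aptsE)
    \<comment> \<open>Where \<open>B2\<close> vanishes the excluded quotient is the default 0; this
      is harmless since \<open>B1\<close> is nonzero there. At \<open>z0\<close> it is
      \<open>B2\<close> that is nonzero.\<close>
    obtain s where s: "s \<notin> (\<lambda>z. - pval B1 z / pval B2 z) ` insert z0 Z"
      using ex_new_if_finite[OF infinite_alg_closed, of "(\<lambda>z. - pval B1 z / pval B2 z) ` insert z0 Z"]
        insert.hyps by auto
    define A B where "A = A1 + [:[:s:]:] * A2" and "B = B1 + [:[:s:]:] * B2"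
    have v: "pval B z \<noteq> 0" if "z \<in> insert z0 Z" for z
    proof
      assume 0: "pval B z = 0"
      have "z \<in> apts" using that insert.prems by auto
      hence sum: "pval B1 z + s * pval B2 z = 0"
        using 0 by (auto elim!: aptsE simp: B_def eval2_simps)
      have "pval B2 z \<noteq> 0" using sum 1(2)[of z] v2 that by auto
      hence "s = - pval B1 z / pval B2 z" using sum by (simp add: field_simps eq_neg_iff_add_eq_0)
      thus False using s that by blast
    qed
    have "F * B = F * B1 + [:[:s:]:] * (F * B2)" by (simp add: B_def algebra_simps)
    also have "\<dots> \<doteq> A1 * G + [:[:s:]:] * (A2 * G)" by (intro congW_add congW_mult 1(1) eq2 congW_refl)
    also have "\<dots> = A * G" by (simp add: A_def algebra_simps)
    finally have "F * B \<doteq> A * G" .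
    moreover have "\<not> W dvd B"
    proof
      assume "W dvd B"
      hence "pval B z0 = 0" using pval_congW[OF z0(1), of B 0] z0(1) 
        by (auto elim!: aptsE simp: congW_0_iff eval2_simps)
      thus False using v by blast
    qed
    ultimately show ?case using v by blast
  qed
  then obtain A B where AB: "F * B \<doteq> A * G" "\<not> W dvd B" "\<And>z. z \<in> Z \<Longrightarrow> pval B z \<noteq> 0" by blast
  have A: "\<not> W dvd A" using congW_dvd[OF AB(1)] FG AB(2) by (auto simp: W_dvd_mult_iff)
  have eq: "rf_eq E f (Fract A B)" using rf_eq_Fract[OF FG(3) AB(2)] AB(1) FG(1) by simp
  have "pval A z \<noteq> 0 \<and> pval B z \<noteq> 0" if z: "z \<in> Z" for z
  proof -
    have za: "z \<in> apts" "z \<in> curve_points E" using z Z(2) apts_curve by auto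
    have "rord z (Fract A B) = 0" using rf_eq_rord[OF za(2) eq f] Z(3)[OF z] by simp
    moreover have "ordp z B = 0" using ordp_eq_0_iff[OF za(1) AB(2)] AB(3)[OF z] by simp
    ultimately have "ordp z A = 0" using rord_Fract[OF za(2) A AB(2)] by simp
    thus ?thesis using ordp_eq_0_iff[OF za(1) A] AB(3)[OF z] by blast
  qed
  thus ?thesis using eq A AB(2) by blast
qed

text \<open>All four pairs of polynomials must be free of common zeros. \<open>F1\<close> and
  \<open>F2\<close> avoid the points of \<open>S\<close> where \<open>f\<close> has order 0 but may
  acquire zeros outside \<open>S\<close>; these are collected in \<open>S1\<close>, and
  \<open>G1\<close>, \<open>G2\<close> are chosen afterwards to avoid the points of
  \<open>S1\<close> where \<open>g\<close> has order 0. The extra points contribute symbols equal to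
  1.\<close>

theorem reciprocity:
  assumes f: "nonzero_rf f" and g: "nonzero_rf g" and S: "finite S" "S \<subseteq> apts"
    and out: "\<And>P. P \<in> apts - S \<Longrightarrow> rord P f = 0 \<and> rord P g = 0"
    and disj: "\<And>P. P \<in> S \<Longrightarrow> rord P f = 0 \<or> rord P g = 0"
  shows "(\<Prod>P\<in>S. tame P f g) * tame Infinity f g = (- 1) powi (rord Infinity f * rord Infinity g)"
proof -
  define zs where "zs = (\<lambda>F. {P \<in> apts. pval F P = 0})"
  have Zf: "finite {P \<in> S. rord P f = 0}" "{P \<in> S. rord P f = 0} \<subseteq> apts"
    "\<And>z. z \<in> {P \<in> S. rord P f = 0} \<Longrightarrow> rord z f = 0" using S by auto
  obtain F1 F2 where F: "rf_eq E f (Fract F1 F2)" "\<not> W dvd F1" "\<not> W dvd F2"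
    "\<forall>z\<in>{P \<in> S. rord P f = 0}. pval F1 z \<noteq> 0 \<and> pval F2 z \<noteq> 0"
    using Fract_avoiding[OF f Zf] by blast
  define S1 where "S1 = S \<union> zs F1 \<union> zs F2"
  have S1: "finite S1" "S1 \<subseteq> apts" unfolding S1_def zs_def using S finite_zeros F(2,3) by auto
  have Zg: "finite {P \<in> S1. rord P g = 0}" "{P \<in> S1. rord P g = 0} \<subseteq> apts"
    "\<And>z. z \<in> {P \<in> S1. rord P g = 0} \<Longrightarrow> rord z g = 0" using S1 by auto
  obtain G1 G2 where G: "rf_eq E g (Fract G1 G2)" "\<not> W dvd G1" "\<not> W dvd G2"
    "\<forall>z\<in>{P \<in> S1. rord P g = 0}. pval G1 z \<noteq> 0 \<and> pval G2 z \<noteq> 0"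
    using Fract_avoiding[OF g Zg] by blast
  have dj: "pval F P \<noteq> 0 \<or> pval G P \<noteq> 0" if "F \<in> {F1, F2}" "G \<in> {G1, G2}" "P \<in> apts" for F G P
  proof (rule ccontr)
    assume 0: "\<not> (pval F P \<noteq> 0 \<or> pval G P \<noteq> 0)"
    hence "P \<in> S1" using that unfolding S1_def zs_def by auto
    hence "rord P g \<noteq> 0" using G(4) that(2) 0 by auto
    hence "P \<in> S" "rord P f = 0" using out[of P] disj[of P] that(3) by auto
    thus False using F(4) that(1) 0 by auto
  qed
  define S2 where "S2 = S1 \<union> zs G1 \<union> zs G2"
  have S2: "finite S2" "S2 \<subseteq> apts" unfolding S2_def zs_def using S1 finite_zeros G(2,3) by auto
  define h where "h = (\<lambda>f g. (\<Prod>P\<in>S2. tame P f g) * tame Infinity f g)"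
  have hpf: "h (ratfun_of F) (ratfun_of G) = (- 1) ^ (pdeg F * pdeg G)" if "F \<in> {F1, F2}" "G \<in> {G1, G2}" for F G
    unfolding h_def
  proof (rule reciprocity_poly)
    show "\<not> W dvd F" "\<not> W dvd G" using that F G by auto
    show "{P \<in> apts. pval F P = 0} \<subseteq> S2" "{P \<in> apts. pval G P = 0} \<subseteq> S2"
      using that unfolding S2_def S1_def zs_def by auto
  qed (use dj that S2 in auto)
  have nz: "F2 \<noteq> 0" "G2 \<noteq> 0" using F G by auto
  have ratio: "tame P f g = (tame P (ratfun_of F1) (ratfun_of G1) / tame P (ratfun_of F1) (ratfun_of G2)) / (tame P (ratfun_of F2) (ratfun_of G1) / tame P (ratfun_of F2) (ratfun_of G2))"
    if "P \<in> curve_points E" for P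
  proof -
    have "tame P f g = tame P (ratfun_of F1 / ratfun_of F2) g" using tame_rf_eq[OF that f F(1)] nz by (simp add: Fract_ratfun_of)
    also have "\<dots> = inverse (tame P g (ratfun_of F1 / ratfun_of F2))" by (rule tame_swap)
    also have "\<dots> = inverse (tame P (ratfun_of G1 / ratfun_of G2) (ratfun_of F1 / ratfun_of F2))"
      using tame_rf_eq[OF that g G(1)] nz by (simp add: Fract_ratfun_of)
    also have "\<dots> = tame P (ratfun_of F1 / ratfun_of F2) (ratfun_of G1 / ratfun_of G2)" by (rule tame_swap[symmetric])
    finally show ?thesis
      using F G that by (simp add: tame_divide_left tame_divide_right nonzero_rf_ratfun_of nonzero_rf_divide)
  qed
  have "(\<Prod>P\<in>S2. tame P f g) = (\<Prod>P\<in>S2. (tame P (ratfun_of F1) (ratfun_of G1) / tame P (ratfun_of F1) (ratfun_of G2)) / (tame P (ratfun_of F2) (ratfun_of G1) / tame P (ratfun_of F2) (ratfun_of G2)))"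
    using S2 apts_curve by (intro prod.cong refl ratio) auto
  hence "h f g = (h (ratfun_of F1) (ratfun_of G1) / h (ratfun_of F1) (ratfun_of G2)) / (h (ratfun_of F2) (ratfun_of G1) / h (ratfun_of F2) (ratfun_of G2))"
    unfolding h_def ratio[OF Infinity_curve] by (simp add: prod_dividef prod.distrib ac_simps)
  also have "\<dots> = (- 1) powi (rord Infinity f * rord Infinity g)"
  proof -
    have r: "rord Infinity f = int (pdeg F2) - int (pdeg F1)" "rord Infinity g = int (pdeg G2) - int (pdeg G1)"
      using rf_eq_rord[OF Infinity_curve F(1) f] rf_eq_rord[OF Infinity_curve G(1) g] F G
      by (simp_all add: rord_Fract)
    have e: "rord Infinity f * rord Infinity g = (int (pdeg F1 * pdeg G1) - int (pdeg F1 * pdeg G2)) -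
       (int (pdeg F2 * pdeg G1) - int (pdeg F2 * pdeg G2))" unfolding r by (simp add: algebra_simps)
    have m: "(- 1 :: 'k) \<noteq> 0" by simp
    show ?thesis unfolding e using m by (simp add: hpf power_int_diff del: of_nat_mult)
  qed
  also have "h f g = (\<Prod>P\<in>S. tame P f g) * tame Infinity f g"
  proof -
    have "(\<Prod>P\<in>S2. tame P f g) = (\<Prod>P\<in>S. tame P f g)"
      using S2 out by (intro prod.mono_neutral_right) (auto simp: S2_def S1_def intro!: tame_trivial)
    thus ?thesis by (simp add: h_def)
  qed
  finally show ?thesis .
qed

subsection \<open>Functions without zeros and poles\<close>

lemma ordp_vert_pos:
  assumes "on_curve r s" 
  shows "aord r s (vert r) = (if s = negy r s then 2 else 1)"
  using aord_const[OF assms, of "[:- r, 1:]"] order_power_n_n[of r 1] by simp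

text \<open>Above a root \<open>r\<close> of \<open>D\<close> the function \<open>a + b y\<close>
  vanishes at both points, or at least doubly at a branch point. Either way \<open>a\<close> and
  \<open>b\<close> vanish at \<open>r\<close>, and \<open>x - r\<close> can be cancelled. For
  constant \<open>D\<close> the order at \<open>Infinity\<close> forces a constant.\<close>

lemma proportional_if_same_orders:
  assumes "D \<noteq> 0" "a \<noteq> 0 \<or> b \<noteq> 0" 
    "\<And>P. P \<in> curve_points E \<Longrightarrow> ordp P [:a, b:] = ordp P [:D:]"
  shows "\<exists>c. c \<noteq> 0 \<and> [:a, b:] = [:smult c D:]"
  using assms
proof (induction "degree D" arbitrary: a b D)
  case 0
  have "pdeg [:a, b:] = 0" using 0(4)[of Infinity] 0(1) by (simp add: pdeg_const)
  hence b: "b = 0" using pdeg_pos[of b a] by auto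
  hence "degree a = 0" using \<open>pdeg [:a, b:] = 0\<close> by (simp add: pdeg_const)
  then obtain x where x: "a = [:x:]" by (rule degree_eq_zeroE)
  obtain y where y: "D = [:y:]" using 0(1) by (metis degree_eq_zeroE)
  show ?case using b x y 0 by (intro exI[of _ "x / y"]) auto
next
  case (Suc n)
  then obtain r where r: "poly D r = 0" using alg_closed_imp_poly_has_root[of D] by auto
  obtain s where s: "on_curve r s" using exists_point_over by blast
  have o1: "aord r s' [:a, b:] = (if s' = negy r s' then 2 else 1) * order r D" if "on_curve r s'" for s'
  proof -
    have "int (aord r s' [:a, b:]) = int (aord r s' [:D:])"
      using Suc.prems(3)[of "Affine r s'"] that by (simp add: Affine_curve_iff)
    thus ?thesis unfolding aord_const[OF that Suc.prems(1)] by (simp only: of_nat_eq_iff)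
  qed
  have oD: "order r D > 0" using r Suc.prems(1) by (simp add: order_gt_0_iff)
  have nd: "\<not> W dvd [:a, b:]" using Suc.prems(2) by simp
  have z: "poly a r + s' * poly b r = 0" if "on_curve r s'" for s'
  proof -
    have "aord r s' [:a, b:] \<noteq> 0" using o1[OF that] oD by auto
    thus ?thesis using aord_eq_0_iff[OF that nd] by (simp add: eval2_simps)
  qed
  have "poly a r = 0 \<and> poly b r = 0"
  proof (cases "s = negy r s")
    case True
    have "poly b r = 0"
    proof (rule ccontr)
      assume "poly b r \<noteq> 0"
      then obtain c where "vrel r s [:a, b:] 1 c" using vrel_ramified_1[OF s True z[OF s]] by blast
      hence "aord r s [:a, b:] = 1" using aord_alc_eqI[OF s] by blast
      thus False using o1[OF s] True oD by auto
    qed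
    thus ?thesis using z[OF s] by simp
  next
    case False
    thus ?thesis using both_zero_unramified[OF False z[OF s] z[OF on_curve_negy[OF s]]] by blast
  qed
  then obtain a' b' D' where *: "a = [:- r, 1:] * a'" "b = [:- r, 1:] * b'" "D = [:- r, 1:] * D'"
    using r by (metis dvdE poly_eq_0_iff_dvd)
  have D': "D' \<noteq> 0" and ab': "a' \<noteq> 0 \<or> b' \<noteq> 0" using Suc.prems * by auto
  have eq: "[:a, b:] = vert r * [:a', b':]" "[:D:] = vert r * [:D':]" unfolding * by simp_all
  have "n = degree D'" using Suc.hyps(2) D' unfolding * by (simp add: degree_mult_eq del: mult_pCons_left)
  moreover have "ordp P [:a', b':] = ordp P [:D':]" if P: "P \<in> curve_points E" for P
  proof -
    have "ordp P (vert r) + ordp P [:a', b':] = ordp P (vert r) + ordp P [:D':]"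
      using Suc.prems(3)[OF P] D' ab' unfolding eq by (subst (asm) (1 2) ordp_mult[OF P]) auto
    thus ?thesis by simp
  qed
  ultimately obtain c where "c \<noteq> 0" "[:a', b':] = [:smult c D':]" using Suc.hyps(1)[OF _ D' ab'] by blast
  thus ?case unfolding * by (intro exI[of _ c]) auto
qed

text \<open>Extending the fraction by the conjugate of its denominator turns the denominator into
  the norm, a polynomial in \<open>x\<close>, so that \<open>proportional_if_same_orders\<close>
  applies.\<close>

lemma constant_if_no_zeros_poles:
  assumes q: "nonzero_rf q" and 0: "\<And>P. P \<in> curve_points E \<Longrightarrow> rord P q = 0"
  obtains c where "c \<noteq> 0" "\<And>P. P \<in> curve_points E \<Longrightarrow> rlc P q = c"
proof -
  obtain F G where FG: "q = Fract F G" "\<not> W dvd F" "\<not> W dvd G" using q by (auto elim: nonzero_rfE)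
  define F' where "F' = F * conj G"
  have F': "\<not> W dvd F'" using FG by (simp add: F'_def W_dvd_mult_iff W_dvd_conj_iff)
  have N: "nrm G \<noteq> 0" using FG(3) by (simp add: nrm_eq_0_iff)
  hence nN: "\<not> W dvd [:nrm G:]" by simp
  have rn: "rA F' \<noteq> 0 \<or> rB F' \<noteq> 0" using F' dvd_red_iff by blast
  hence nr: "\<not> W dvd red F'" by simp
  have "F * [:nrm G:] \<doteq> F * (G * conj G)" by (intro congW_mult congW_sym[OF conj_nrm] congW_refl)
  also have "\<dots> = F' * G" by (simp add: F'_def ac_simps)
  also have "\<dots> \<doteq> red F' * G" by (intro congW_mult red_cong congW_refl)
  finally have "rf_eq E q (Fract (red F') [:nrm G:])"
    using rf_eq_Fract[OF FG(3) nN] FG(1) by simp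
  note rq = rf_eq_rord[OF _ this q]
  have "ordp P (red F') = ordp P [:nrm G:]" if "P \<in> curve_points E" for P
    using rq[OF that] 0[OF that] rord_Fract[OF that nr nN] by simp
  from proportional_if_same_orders[OF N rn this] obtain c where c: "c \<noteq> 0" "red F' = [:smult c (nrm G):]"
    by blast
  have m: "red F' = [:[:c:]:] * [:nrm G:]" using c(2) by simp
  have "rlc P q = c" if P: "P \<in> curve_points E" for P
  proof -
    have "lcp P [:[:c:]:] = c"
    proof (cases P)
      case (Affine r s)
      thus ?thesis using P c(1) by (simp add: Affine_curve_iff alc_eval eval2_simps)
    qed (simp add: plc_const)
    hence "lcp P (red F') = c * lcp P [:nrm G:]"
      unfolding m using c(1) nN by (subst lcp_mult[OF P]) auto
    thus ?thesis using rq[OF P] rlc_Fract[OF P nr nN] lcp_nz[OF P nN] by simp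
  qed
  thus ?thesis using that c(1) by blast
qed

section \<open>Divisors\<close>


abbreviation "lkp \<equiv> Poly_Mapping.lookup"
abbreviation "keys \<equiv> Poly_Mapping.keys"

lemma divisorsD: "D \<in> divisors E \<Longrightarrow> P \<in> keys D \<Longrightarrow> P \<in> curve_points E"
  by (auto simp: divisors_def)

lemma divisors_add: "D \<in> divisors E \<Longrightarrow> D' \<in> divisors E \<Longrightarrow> D + D' \<in> divisors E"
  using Poly_Mapping.keys_add[of D D'] by (auto simp: divisors_def)

lemma divisors_diff: "D \<in> divisors E \<Longrightarrow> D' \<in> divisors E \<Longrightarrow> D - D' \<in> divisors E"
  using keys_diff[of D D'] by (auto simp: divisors_def)

lemma divisors_cmul: "D \<in> divisors E \<Longrightarrow> frag_cmul k D \<in> divisors E"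
  using keys_cmul[of k D] by (auto simp: divisors_def)

lemma divisors_frag_of: "P \<in> curve_points E \<Longrightarrow> frag_of P \<in> divisors E"
  by (simp add: divisors_def keys_frag_of)

lemma has_divisorD:
  assumes "has_divisor E f D"
  shows "nonzero_rf f" "D \<in> divisors E" "P \<in> curve_points E \<Longrightarrow> rord P f = lkp D P"
  using assms by (auto simp: has_divisor_iff)

lemma has_divisor_mult: "has_divisor E f A \<Longrightarrow> has_divisor E g B \<Longrightarrow> has_divisor E (f * g) (A + B)"
  by (auto simp: has_divisor_iff nonzero_rf_mult divisors_add rord_mult lookup_add)

lemma has_divisor_divide: "has_divisor E f A \<Longrightarrow> has_divisor E g B \<Longrightarrow> has_divisor E (f / g) (A - B)"
  by (auto simp: has_divisor_iff nonzero_rf_divide divisors_diff rord_divide lookup_minus)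

lemma has_divisor_power: "has_divisor E f A \<Longrightarrow> has_divisor E (f ^ n) (frag_cmul (int n) A)"
  by (auto simp: has_divisor_iff nonzero_rf_power divisors_cmul rord_power)

lemma finite_support:
  assumes "nonzero_rf f"
  shows "finite {P \<in> curve_points E. rord P f \<noteq> 0}"
proof -
  obtain F G where FG: "f = Fract F G" "\<not> W dvd F" "\<not> W dvd G" using assms by (auto elim: nonzero_rfE)
  have "{P \<in> curve_points E. rord P f \<noteq> 0} \<subseteq> insert Infinity ({P \<in> apts. pval F P = 0} \<union> {P \<in> apts. pval G P = 0})"
  proof
    fix P assume P: "P \<in> {P \<in> curve_points E. rord P f \<noteq> 0}"
    show "P \<in> insert Infinity ({P \<in> apts. pval F P = 0} \<union> {P \<in> apts. pval G P = 0})"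
    proof (rule ccontr)
      assume c: "\<not> ?thesis"
      hence ap: "P \<in> apts" using P by (auto simp: apts_def)
      hence "ordp P F = 0" "ordp P G = 0" using c ordp_eq_0_iff FG by auto
      hence "rord P f = 0" using P FG rord_Fract by simp
      thus False using P by simp
    qed
  qed
  thus ?thesis using finite_zeros FG finite_subset by blast
qed

lemma exists_divisor:
  assumes "nonzero_rf f"
  shows "\<exists>D. has_divisor E f D"
proof -
  define \<phi> where "\<phi> = (\<lambda>P. if P \<in> curve_points E then rord P f else 0)"
  have "{P. \<phi> P \<noteq> 0} = {P \<in> curve_points E. rord P f \<noteq> 0}" by (auto simp: \<phi>_def)
  hence "finite {P. \<phi> P \<noteq> 0}" using finite_support[OF assms] by simp
  hence "lkp (Abs_poly_mapping \<phi>) = \<phi>" by (rule lookup_Abs_poly_mapping)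
  then obtain D where l: "lkp D = \<phi>" by blast
  have "has_divisor E f D"
    using assms by (auto simp: has_divisor_iff l divisors_def in_keys_iff \<phi>_def split: if_splits)
  thus ?thesis ..
qed

text \<open>
  The evaluation of a function at a divisor, with leading coefficients in place of the values; it
  is defined without any assumption of disjointness and bimultiplicative.
\<close>

definition dval :: "'k ratfun \<Rightarrow> 'k divisor \<Rightarrow> 'k" where
  "dval f D = (\<Prod>P\<in>keys D. rlc P f powi lkp D P)"

lemma dval_superset: "finite S \<Longrightarrow> keys D \<subseteq> S \<Longrightarrow> dval f D = (\<Prod>P\<in>S. rlc P f powi lkp D P)"
  unfolding dval_def by (rule prod.mono_neutral_left) (auto simp: in_keys_iff)

lemma dval_nz: "nonzero_rf f \<Longrightarrow> D \<in> divisors E \<Longrightarrow> dval f D \<noteq> 0"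
  by (auto simp: dval_def dest!: divisorsD dest: rlc_nz)

lemma dval_mult: "nonzero_rf f \<Longrightarrow> nonzero_rf g \<Longrightarrow> D \<in> divisors E \<Longrightarrow> dval (f * g) D = dval f D * dval g D"
  unfolding dval_def prod.distrib[symmetric]
  by (intro prod.cong refl) (auto dest!: divisorsD simp: rlc_mult power_int_mult_distrib)

lemma dval_power: "nonzero_rf f \<Longrightarrow> D \<in> divisors E \<Longrightarrow> dval (f ^ n) D = dval f D ^ n"
  unfolding dval_def prod_power_distrib
  by (intro prod.cong refl) (auto dest!: divisorsD simp: rlc_power power_int_power power_int_power' mult.commute)

lemma dval_add:
  assumes "nonzero_rf f" "A \<in> divisors E" "B \<in> divisors E"
  shows "dval f (A + B) = dval f A * dval f B"
proof -
  let ?S = "keys A \<union> keys B"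
  have c: "P \<in> curve_points E" if "P \<in> ?S" for P using that assms divisorsD by blast
  have "dval f (A + B) = (\<Prod>P\<in>?S. rlc P f powi lkp (A + B) P)"
    by (rule dval_superset) (simp_all add: Poly_Mapping.keys_add)
  also have "\<dots> = (\<Prod>P\<in>?S. rlc P f powi lkp A P * rlc P f powi lkp B P)"
    using c rlc_nz[OF _ assms(1)] by (intro prod.cong refl) (simp add: lookup_add power_int_add)
  also have "\<dots> = dval f A * dval f B"
    by (simp add: prod.distrib dval_superset[of ?S A] dval_superset[of ?S B])
  finally show ?thesis .
qed

lemma dval_cmul: "dval f (frag_cmul k D) = dval f D powi k"
proof -
  have "dval f (frag_cmul k D) = (\<Prod>P\<in>keys D. rlc P f powi lkp (frag_cmul k D) P)"
    using keys_cmul by (intro dval_superset) auto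
  also have "\<dots> = (\<Prod>P\<in>keys D. (rlc P f powi lkp D P) powi k)"
  proof (intro prod.cong refl)
    fix P
    have "lkp (frag_cmul k D) P = lkp D P * k" by simp
    thus "rlc P f powi lkp (frag_cmul k D) P = (rlc P f powi lkp D P) powi k"
      by (simp only: power_int_mult)
  qed
  also have "\<dots> = dval f D powi k"
  proof -
    have "(\<Prod>P\<in>S. \<phi> P powi k) = (\<Prod>P\<in>S. \<phi> P) powi k" for S and \<phi> :: "'k point \<Rightarrow> 'k"
      by (induction S rule: infinite_finite_induct) (simp_all add: power_int_mult_distrib)
    thus ?thesis by (simp add: dval_def)
  qed
  finally show ?thesis .
qed

lemma dval_diff:
  assumes "nonzero_rf f" "A \<in> divisors E" "B \<in> divisors E"
  shows "dval f (A - B) = dval f A / dval f B"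
proof -
  have "A - B = A + frag_cmul (- 1) B" by simp
  hence "dval f (A - B) = dval f A * dval f (frag_cmul (- 1) B)"
    using dval_add[OF assms(1,2) divisors_cmul[OF assms(3)]] by metis
  thus ?thesis by (simp only: dval_cmul) (simp add: divide_inverse)
qed

lemma dval_frag_of: "dval f (frag_of P) = rlc P f"
  by (simp add: dval_def keys_frag_of)

lemma dval_point_diff:
  assumes "nonzero_rf f" "P \<in> curve_points E"
  shows "dval f (frag_of P - frag_of Infinity) = rlc P f / rlc Infinity f"
  using assms by (simp add: dval_diff divisors_frag_of dval_frag_of)

lemma rf_value_div_dval:
  assumes "nonzero_rf f" "D \<in> divisors E" "\<And>P. P \<in> keys D \<Longrightarrow> rord P f = 0"
  shows "rf_value_div E f D = dval f D"
  unfolding rf_value_div_def dval_def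
  using assms divisorsD rf_value_eq by (intro prod.cong refl) auto

lemma reciprocity_dval:
  assumes f: "has_divisor E f A" and g: "has_divisor E g B" and disj: "keys A \<inter> keys B \<subseteq> {Infinity}"
  shows "dval f B = (- 1) powi (lkp A Infinity * lkp B Infinity) * dval g A"
proof -
  define S where "S = keys A \<union> keys B - {Infinity}"
  note fD = has_divisorD[OF f] and gD = has_divisorD[OF g]
  have S: "finite S" "S \<subseteq> apts" using divisorsD fD(2) gD(2) by (auto simp: S_def apts_def)
  have "(\<Prod>P\<in>S. tame P f g) * tame Infinity f g = (- 1) powi (rord Infinity f * rord Infinity g)"
  proof (rule reciprocity[OF fD(1) gD(1) S])
    fix P assume "P \<in> apts - S"
    thus "rord P f = 0 \<and> rord P g = 0" 
      using fD(3)[of P] gD(3)[of P] by (auto simp: S_def apts_def in_keys_iff)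
  next
    fix P assume "P \<in> S"
    hence "P \<in> curve_points E" "P \<noteq> Infinity" using S(2) by (auto simp: apts_def)
    thus "rord P f = 0 \<or> rord P g = 0"
      using disj fD(3)[of P] gD(3)[of P] by (auto simp: in_keys_iff)
  qed
  also have "(\<Prod>P\<in>S. tame P f g) * tame Infinity f g = (\<Prod>P\<in>insert Infinity S. tame P f g)"
  proof -
    have "Infinity \<notin> S" by (simp add: S_def)
    thus ?thesis using S(1) by (simp add: mult.commute)
  qed
  also have "\<dots> = (\<Prod>P\<in>insert Infinity S. rlc P f powi lkp B P / rlc P g powi lkp A P)"
  proof (intro prod.cong refl)
    fix P assume "P \<in> insert Infinity S"
    hence "P \<in> curve_points E" using S(2) by (auto simp: apts_def)
    thus "tame P f g = rlc P f powi lkp B P / rlc P g powi lkp A P"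
      using fD(3) gD(3) by (simp add: tame_def)
  qed
  also have "\<dots> = dval f B / dval g A"
    unfolding prod_dividef using S(1)
    by (subst (1 2) dval_superset[of "insert Infinity S"]) (auto simp: S_def)
  finally show ?thesis using dval_nz[OF gD(1) fD(2)] fD(3)[OF Infinity_curve] gD(3)[OF Infinity_curve]
    by (simp add: field_simps)
qed

lemma weil_reciprocity:
  assumes "has_divisor E f A" "has_divisor E g B" "keys A \<inter> keys B = {}"
  shows "dval f B = dval g A"
proof -
  have 0: "lkp A Infinity * lkp B Infinity = 0" using assms(3) by (auto simp: in_keys_iff)
  show ?thesis using reciprocity_dval[OF assms(1,2)] assms(3) unfolding 0 by simp
qed

section \<open>Constants, and moving a divisor within its class\<close>

definition konst :: "'k \<Rightarrow> 'k ratfun" where "konst c = ratfun_of [:[:c:]:]"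

lemma konst:
  assumes "c \<noteq> 0"
  shows "has_divisor E (konst c) 0" "P \<in> curve_points E \<Longrightarrow> rlc P (konst c) = c" "nonzero_rf (konst c)"
proof -
  have nd: "\<not> W dvd [:[:c:]:]" using assms by simp
  show n: "nonzero_rf (konst c)" unfolding konst_def using nonzero_rf_ratfun_of[OF nd] .
  have *: "ordp P [:[:c:]:] = 0 \<and> lcp P [:[:c:]:] = c" if P: "P \<in> curve_points E" for P
  proof (cases P)
    case (Affine r s)
    have "on_curve r s" "eval2 [:[:c:]:] r s = c" using P Affine by (simp_all add: Affine_curve_iff eval2_simps)
    thus ?thesis using Affine assms aord_eq_0_iff[OF _ nd] alc_eval by simp
  qed (simp add: plc_const pdeg_const)
  show "rlc P (konst c) = c" if "P \<in> curve_points E"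
    using *[OF that] rlc_ratfun_of[OF that nd] by (simp add: konst_def)
  show "has_divisor E (konst c) 0"
    using n * rord_ratfun_of[OF _ nd] by (simp add: has_divisor_iff divisors_def konst_def)
qed

text \<open>Reciprocity against a constant, whose divisor is 0. In multiplicative form this says
  that principal divisors have degree 0.\<close>

lemma dval_konst_principal: "c \<noteq> 0 \<Longrightarrow> has_divisor E h D \<Longrightarrow> dval (konst c) D = 1"
  using weil_reciprocity[OF konst(1), of c h D] by (simp add: dval_def)

lemma dval_konst_lin_equiv:
  assumes "c \<noteq> 0" "lin_equiv E B (frag_of Q - frag_of Infinity)" "Q \<in> curve_points E"
  shows "dval (konst c) B = 1"
proof -
  obtain h where h: "has_divisor E h (B - (frag_of Q - frag_of Infinity))" "B \<in> divisors E"
    "frag_of Q - frag_of Infinity \<in> divisors E"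
    using assms(2) unfolding lin_equiv_def by blast
  have "dval (konst c) (B - (frag_of Q - frag_of Infinity)) = 1"
    using dval_konst_principal[OF assms(1) h(1)] .
  moreover have "dval (konst c) (frag_of Q - frag_of Infinity) = 1"
    using assms by (simp add: dval_point_diff konst)
  ultimately show ?thesis using dval_diff[OF konst(3)[OF assms(1)] h(2,3)] by simp
qed

text \<open>\<open>f'\<close> and \<open>f * k ^ m\<close> have the same divisor, so they differ by
  a constant, which takes the value 1 at \<open>B\<close>. What remains is
  \<open>k(m B) = g(A' - A)\<close>, an instance of Weil reciprocity.\<close>

lemma pairing_move:
  assumes k: "has_divisor E k (A' - A)" and f: "has_divisor E f (frag_cmul (int m) A)"
    and f': "has_divisor E f' (frag_cmul (int m) A')" and g: "has_divisor E g (frag_cmul (int m) B)"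
    and div: "A \<in> divisors E" "A' \<in> divisors E" "B \<in> divisors E"
    and disj: "keys A \<inter> keys B = {}" "keys A' \<inter> keys B = {}"
    and B: "\<And>c. c \<noteq> 0 \<Longrightarrow> dval (konst c) B = 1"
  shows "dval f' B * dval g A = dval f B * dval g A'"
proof -
  note nz = has_divisorD(1)[OF k] has_divisorD(1)[OF f] has_divisorD(1)[OF f'] has_divisorD(1)[OF g]
  define q where "q = f' / (f * k ^ m)"
  have q: "has_divisor E q (frag_cmul (int m) A' - (frag_cmul (int m) A + frag_cmul (int m) (A' - A)))"
    unfolding q_def by (intro has_divisor_divide has_divisor_mult has_divisor_power f f' k)
  have "rord P q = 0" if "P \<in> curve_points E" for P
    using has_divisorD(3)[OF q that] by (simp add: lookup_minus lookup_add algebra_simps)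
  then obtain c where c: "c \<noteq> 0" "\<And>P. P \<in> curve_points E \<Longrightarrow> rlc P q = c"
    using constant_if_no_zeros_poles[OF has_divisorD(1)[OF q]] by metis
  have f'_eq: "f' = q * (f * k ^ m)" using nonzero_rf_nz nz nonzero_rf_power unfolding q_def by simp
  have "dval q B = dval (konst c) B"
    unfolding dval_def using c divisorsD[OF div(3)] konst(2)[OF c(1)] by (intro prod.cong refl) simp
  hence "dval f' B = dval f B * dval k B ^ m"
    unfolding f'_eq using nz has_divisorD(1)[OF q] div(3) B[OF c(1)]
    by (simp add: dval_mult dval_power nonzero_rf_mult nonzero_rf_power)
  also have "dval k B ^ m = dval k (frag_cmul (int m) B)" by (simp add: dval_cmul)
  also have "\<dots> = dval g (A' - A)"
  proof (rule weil_reciprocity[OF k g])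
    show "keys (A' - A) \<inter> keys (frag_cmul (int m) B) = {}"
      using keys_diff[of A' A] keys_cmul[of "int m" B] disj by blast
  qed
  also have "\<dots> = dval g A' / dval g A" using div nz by (simp add: dval_diff)
  finally show ?thesis using dval_nz[OF nz(4) div(1)] by simp
qed

subsection \<open>Functions with a simple pole at a given point\<close>

lemma order_ge_2_pderiv: "order r p \<ge> 2 \<Longrightarrow> poly (pderiv p) r = (0 :: 'k)"
proof -
  assume "order r p \<ge> 2"
  hence "[:- r, 1:] ^ 2 dvd p" using order_divides by blast
  then obtain q where "p = [:- r, 1:] ^ 2 * q" by (elim dvdE)
  thus ?thesis by (simp add: pderiv_mult pderiv_pCons power2_eq_square del: mult_pCons_left)
qed

text \<open>\<open>h\<close> is a vertical line divided by a line \<open>L\<close> through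
  \<open>P\<close> of generic slope \<open>l\<close>, so its order at infinity is
  \<open>- 2 + 3\<close>. The slope keeps \<open>L\<close> from being tangent at \<open>P\<close>
  and from meeting the other points of \<open>Z\<close>; the vertical line avoids all of
  them.\<close>

lemma simple_pole_function:
  assumes P: "P \<in> apts" and Z: "finite Z" "Z \<subseteq> apts"
  obtains h where "nonzero_rf h" "rord Infinity h = 1" "rord P h = - 1"
    "\<And>z. z \<in> Z - {P} \<Longrightarrow> rord z h = 0"
proof -
  obtain r s where rs: "P = Affine r s" "on_curve r s" using P by (elim aptsE)
  define \<eta> where "\<eta> = s * poly (pderiv hpol) r - poly (pderiv fpol) r"
  define yc where "yc = (\<lambda>z. case z of Affine x y \<Rightarrow> y | Infinity \<Rightarrow> (0::'k))"
  \<comment> \<open>The first value is the slope of the tangent at \<open>P\<close>, as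
    \<open>\<eta>\<close> is the partial derivative in \<open>x\<close>; the others are the slopes
    of the lines from \<open>P\<close> to points of \<open>Z\<close>. A zero denominator belongs to
    a vertical line, which no slope \<open>l\<close> describes.\<close>
  have "finite (insert (- \<eta> / (2 * s + poly hpol r)) ((\<lambda>z. (yc z - s) / (xco z - r)) ` Z))" using Z by simp
  from ex_new_if_finite[OF infinite_alg_closed this] obtain l where
    l: "l \<noteq> - \<eta> / (2 * s + poly hpol r)" "l \<notin> (\<lambda>z. (yc z - s) / (xco z - r)) ` Z" by auto
  have "finite (xco ` insert P Z)" using Z by simp
  from ex_new_if_finite[OF infinite_alg_closed this] obtain c where c: "c \<notin> xco ` insert P Z" by auto
  define p where "p = [:l * r - s, - l:]"
  have p: "poly p r = - s" "pderiv p = [:- l:]" "degree p \<le> 1" by (simp_all add: p_def pderiv_pCons)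
  define L where "L = [:p, 1:]"
  have L: "\<not> W dvd L" by (simp add: L_def)
  have Lv: "eval2 L x y = (y - s) - l * (x - r)" for x y by (simp add: L_def p_def eval2_simps algebra_simps)
  have v: "\<not> W dvd vert c" by simp
  have pL: "pdeg L = 3"
    unfolding L_def pdeg_def using wt_odd(1)[of 1 p] p(3) by (simp del: wt_pCons)
  \<comment> \<open>This is \<open>W\<close> restricted to the line \<open>y = - p\<close>; a simple
    root at \<open>r\<close> means that the line meets the curve transversally in
    \<open>P\<close>.\<close>
  have nL: "nrm L = p\<^sup>2 - p * hpol - fpol"
    by (simp add: nrm_def L_def)
  have "poly (pderiv (nrm L)) r = l * (2 * s + poly hpol r) + \<eta>"
    unfolding nL pderiv_diff power2_eq_square pderiv_mult by (simp add: p \<eta>_def algebra_simps)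
  also have "\<dots> \<noteq> 0"
  proof (cases "2 * s + poly hpol r = 0")
    case True
    hence "s = negy r s" by (simp add: negy_def eq_neg_iff_add_eq_0 algebra_simps)
    hence "\<eta> \<noteq> 0" using smooth'[OF rs(2)] by (auto simp: \<eta>_def)
    thus ?thesis using True by simp
  next
    case False
    thus ?thesis using l(1) by (auto simp: field_simps eq_neg_iff_add_eq_0)
  qed
  finally have "order r (nrm L) < 2" using order_ge_2_pderiv by (meson not_le)
  moreover have "order r (nrm L) \<ge> aord r s L" using order_nrm[OF rs(2) L] by auto
  moreover have "aord r s L \<noteq> 0" using aord_eq_0_iff[OF rs(2) L] Lv by simp
  ultimately have oL: "aord r s L = 1" by simp
  have ov: "ordp z (vert c) = 0" if "z \<in> insert P Z" for z
  proof -
    have z: "z \<in> apts" using that P Z by auto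
    moreover have "xco z \<noteq> c" using c that by blast
    hence "pval (vert c) z \<noteq> 0" using z by (auto elim!: aptsE simp: eval2_simps)
    ultimately show ?thesis using ordp_eq_0_iff v by blast
  qed
  define h where "h = Fract (vert c) L"
  have h: "rord z h = ordp z (vert c) - ordp z L" if "z \<in> curve_points E" for z
    using rord_Fract[OF that v L] by (simp add: h_def)
  have "nonzero_rf h" unfolding h_def using v L by blast
  moreover have "rord Infinity h = 1" using h[OF Infinity_curve] pL by (simp add: pdeg_const)
  moreover have "rord P h = - 1" using h[OF apts_curve[OF P]] ov[of P] oL rs by simp
  moreover have "rord z h = 0" if z: "z \<in> Z - {P}" for z
  proof -
    have za: "z \<in> apts" using z Z by auto
    then obtain x y where xy: "z = Affine x y" "on_curve x y" by (elim aptsE)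
    have "pval L z \<noteq> 0"
    proof
      assume "pval L z = 0"
      hence 0: "y - s = l * (x - r)" using xy Lv by simp
      have "x \<noteq> r" using 0 z xy rs by auto
      hence "l = (yc z - s) / (xco z - r)" using 0 xy by (simp add: yc_def)
      thus False using l(2) z by blast
    qed
    hence "ordp z L = 0" using ordp_eq_0_iff[OF za L] by blast
    thus ?thesis using h[OF apts_curve[OF za]] ov[of z] z by simp
  qed
  ultimately show ?thesis using that by blast
qed

lemma vert_divisor:
  assumes "on_curve r s"
  shows "has_divisor E (ratfun_of (vert r))
    (frag_of (Affine r s) + frag_of (Affine r (negy r s)) - frag_cmul 2 (frag_of Infinity))" (is "has_divisor E _ ?D")
  unfolding has_divisor_iff
proof (intro conjI ballI)
  have v: "\<not> W dvd vert r" by simp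
  show "nonzero_rf (ratfun_of (vert r))" using nonzero_rf_ratfun_of v by blast
  show "?D \<in> divisors E"
    using assms on_curve_negy by (intro divisors_diff divisors_add divisors_cmul divisors_frag_of) (auto simp: Affine_curve_iff)
  fix P assume P: "P \<in> curve_points E"
  have "ordp P (vert r) = lkp ?D P"
    using P
  proof (cases rule: curve_pointsE)
    case 1
    thus ?thesis by (simp add: pdeg_const lookup_minus lookup_add)
  next
    case (2 x y)
    show ?thesis
    proof (cases "x = r")
      case True
      thus ?thesis using 2 on_curve_fibre[OF assms, of y] ordp_vert_pos[of r y]
        by (auto simp: lookup_minus lookup_add)
    next
      case False
      hence "aord x y (vert r) = 0" using aord_eq_0_iff[OF 2(2) v] by (simp add: eval2_simps)
      thus ?thesis using 2 False by (simp add: lookup_minus lookup_add)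
    qed
  qed
  thus "rord P (ratfun_of (vert r)) = lkp ?D P" using rord_ratfun_of[OF P v] by simp
qed

section \<open>The Weil pairing\<close>


lemma ec_neg_negy: "ec_neg E (Affine r s) = Affine r (negy r s)"
  by (simp add: negy_def hpol_def algebra_simps)

lemma frag_cmul_diff: "frag_cmul k (A - B) = frag_cmul k A - frag_cmul k B"
  by (rule poly_mapping_eqI) (simp add: lookup_minus right_diff_distrib)

text \<open>The simple pole of \<open>h\<close> at \<open>P\<close> and its simple zero at
  \<open>Infinity\<close> cancel the two points of \<open>(P) - (O)\<close>, and at the other points
  of \<open>Z\<close> the order of \<open>h\<close> is 0.\<close>

lemma exists_moved_divisor:
  assumes P: "P \<in> apts" and Z: "finite Z" "Z \<subseteq> curve_points E"
  obtains h A where "has_divisor E h (A - (frag_of P - frag_of Infinity))" "A \<in> divisors E"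
    "rord Infinity h = 1" "keys A \<inter> insert P (insert Infinity Z) = {}"
proof -
  obtain h where h: "nonzero_rf h" "rord Infinity h = 1" "rord P h = - 1"
    "\<And>z. z \<in> (Z - {Infinity}) - {P} \<Longrightarrow> rord z h = 0"
    using simple_pole_function[OF P, of "Z - {Infinity}"] Z by (auto simp: apts_def)
  obtain D where D: "has_divisor E h D" using exists_divisor[OF h(1)] by blast
  define A where "A = D + (frag_of P - frag_of Infinity)"
  have Pc: "P \<in> curve_points E" "P \<noteq> Infinity" using P by (auto simp: apts_def)
  have A: "A \<in> divisors E"
    unfolding A_def using has_divisorD(2)[OF D] Pc by (intro divisors_add divisors_diff divisors_frag_of) auto
  have "lkp A z = 0" if z: "z \<in> insert P (insert Infinity Z)" for z
  proof -
    have zc: "z \<in> curve_points E" using z Z Pc by auto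
    have "lkp A z = rord z h + (if z = P then 1 else 0) - (if z = Infinity then 1 else 0)"
      using has_divisorD(3)[OF D zc] by (simp add: A_def lookup_add lookup_minus)
    thus ?thesis using h z Pc(2) by auto
  qed
  hence "keys A \<inter> insert P (insert Infinity Z) = {}" by (auto simp: in_keys_iff)
  moreover have "has_divisor E h (A - (frag_of P - frag_of Infinity))" using D by (simp add: A_def)
  ultimately show ?thesis using that A h(2) by blast
qed

context
  fixes m :: nat and P Q :: "'k point" and fP fQ :: "'k ratfun"
  assumes m: "m > 0" and P: "P \<in> apts" and Q: "Q \<in> apts" and PQ: "P \<noteq> Q"
    and fP: "has_divisor E fP (frag_cmul (int m) (frag_of P) - frag_cmul (int m) (frag_of Infinity))"
    and fQ: "has_divisor E fQ (frag_cmul (int m) (frag_of Q) - frag_cmul (int m) (frag_of Infinity))"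
begin

abbreviation "dP \<equiv> frag_of P - frag_of Infinity"
abbreviation "dQ \<equiv> frag_of Q - frag_of Infinity"

lemma fP': "has_divisor E fP (frag_cmul (int m) dP)" and fQ': "has_divisor E fQ (frag_cmul (int m) dQ)"
  using fP fQ by (simp_all add: frag_cmul_diff)

lemma points: "P \<in> curve_points E" "Q \<in> curve_points E" "P \<noteq> Infinity" "Q \<noteq> Infinity"
  using P Q by (auto simp: apts_def)

lemma dP_dQ: "dP \<in> divisors E" "dQ \<in> divisors E" "keys dP = {P, Infinity}" "keys dQ = {Q, Infinity}"
  using points by (auto simp: divisors_diff divisors_frag_of in_keys_iff lookup_minus lookup_frag_of split: if_splits)

definition datum :: "'k divisor \<Rightarrow> 'k divisor \<Rightarrow> 'k ratfun \<Rightarrow> 'k ratfun \<Rightarrow> bool" where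
  "datum A B f g \<longleftrightarrow> lin_equiv E A dP \<and> lin_equiv E B dQ \<and> keys A \<inter> keys B = {} \<and>
     has_divisor E f (frag_cmul (int m) A) \<and> has_divisor E g (frag_cmul (int m) B)"

text \<open>The function for \<open>A\<close> is \<open>fP * h ^ m\<close>, whose value at
  \<open>dQ\<close> contains \<open>x ^ m\<close> with \<open>x = dval h dQ\<close>. Reciprocity
  between \<open>fQ\<close> and \<open>h\<close> produces the same power in
  \<open>dval fQ A\<close>, together with the sign, and it cancels.\<close>

lemma moved_pairing:
  assumes h: "has_divisor E h (A - dP)" and A: "A \<in> divisors E" "rord Infinity h = 1"
    and disj: "keys A \<inter> {P, Infinity, Q} = {}"
  shows "dval (fP * h ^ m) dQ / dval fQ A = 
    (- 1) ^ m * (rlc Q fP * rlc Infinity fQ) / (rlc P fQ * rlc Infinity fP)"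
proof -
  note nz = has_divisorD(1)[OF h] has_divisorD(1)[OF fP] has_divisorD(1)[OF fQ]
  have hQ: "lkp (A - dP) Q = 0"
    using disj PQ points by (auto simp: lookup_minus lookup_frag_of in_keys_iff)
  have hO: "lkp (A - dP) Infinity = 1" using has_divisorD(3)[OF h Infinity_curve] A(2) by simp
  define x where "x = dval h dQ"
  have x: "x \<noteq> 0" unfolding x_def using dval_nz nz dP_dQ by blast
  have 1: "dval (fP * h ^ m) dQ = rlc Q fP / rlc Infinity fP * x ^ m"
    using nz dP_dQ(2) points by (simp add: dval_mult dval_power nonzero_rf_power dval_point_diff rlc_power power_divide x_def)
  have "dval fQ (A - dP) = (- 1) powi (lkp (frag_cmul (int m) dQ) Infinity * lkp (A - dP) Infinity) * dval h (frag_cmul (int m) dQ)"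
  proof (rule reciprocity_dval[OF fQ' h])
    have "Q \<notin> keys (A - dP)" using hQ by (simp add: in_keys_iff)
    thus "keys (frag_cmul (int m) dQ) \<inter> keys (A - dP) \<subseteq> {Infinity}"
      using keys_cmul[of "int m" dQ] dP_dQ(4) by auto
  qed
  also have "\<dots> = (- 1) ^ m * x ^ m"
    unfolding hO using points by (simp add: lookup_minus lookup_frag_of dval_cmul x_def power_int_minus)
       (metis inverse_1 inverse_minus_eq power_inverse)
  finally have "dval fQ (A - dP) = (- 1) ^ m * x ^ m" .
  moreover have "dval fQ A = dval fQ (A - dP) * dval fQ dP"
    using dval_diff[OF nz(3) A(1) dP_dQ(1)] dval_nz[OF nz(3) dP_dQ(1)] by simp
  ultimately have 2: "dval fQ A = (- 1) ^ m * x ^ m * (rlc P fQ / rlc Infinity fQ)"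
    using nz points by (simp add: dval_point_diff)
  define \<sigma> :: 'k where "\<sigma> = (- 1) ^ m"
  have \<sigma>: "\<sigma> * \<sigma> = 1" "\<sigma> \<noteq> 0" unfolding \<sigma>_def by (simp_all flip: power_add)
  have flip: "y / (\<sigma> * z) = \<sigma> * y / z" for y z
  proof -
    have "\<sigma> * y / z = (\<sigma> * \<sigma> * y) / (\<sigma> * z)" using \<sigma>(2) by simp
    thus ?thesis using \<sigma>(1) by simp
  qed
  show ?thesis
    unfolding 1 2 \<sigma>_def[symmetric] mult.assoc flip using x by simp
qed

lemma datum_values:
  assumes "datum A B f g"
  shows "rf_value_div E f B / rf_value_div E g A = dval f B / dval g A"
proof -
  from assms have *: "A \<in> divisors E" "B \<in> divisors E" "keys A \<inter> keys B = {}"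
    "has_divisor E f (frag_cmul (int m) A)" "has_divisor E g (frag_cmul (int m) B)"
    unfolding datum_def lin_equiv_def by auto
  have "rf_value_div E f B = dval f B"
    using *(2,3) divisorsD[OF *(2)] has_divisorD[OF *(4)]
    by (intro rf_value_div_dval) (auto simp: in_keys_iff)
  moreover have "rf_value_div E g A = dval g A"
    using *(1,3) divisorsD[OF *(1)] has_divisorD[OF *(5)]
    by (intro rf_value_div_dval) (auto simp: in_keys_iff)
  ultimately show ?thesis by simp
qed

lemma moved_datum:
  assumes h: "has_divisor E h (A - dP)" and A: "A \<in> divisors E" and disj: "keys A \<inter> {P, Infinity, Q} = {}"
  shows "datum A dQ (fP * h ^ m) fQ"
proof -
  have "has_divisor E (fP * h ^ m) (frag_cmul (int m) dP + frag_cmul (int m) (A - dP))"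
    by (intro has_divisor_mult fP' has_divisor_power h)
  also have "frag_cmul (int m) dP + frag_cmul (int m) (A - dP) = frag_cmul (int m) A"
    by (simp flip: frag_cmul_distrib2)
  finally have "has_divisor E (fP * h ^ m) (frag_cmul (int m) A)" .
  moreover have "lin_equiv E A dP" unfolding lin_equiv_def using A dP_dQ(1) h by blast
  moreover have "lin_equiv E dQ dQ"
    unfolding lin_equiv_def using dP_dQ(2) konst(1)[of 1] by auto
  ultimately show ?thesis unfolding datum_def using fQ' dP_dQ(4) disj by auto
qed

text \<open>Replacing \<open>B\<close> by \<open>dQ\<close> at once could destroy disjointness from
  \<open>A\<close>. The intermediate \<open>A'\<close> is disjoint from both \<open>B\<close> and
  \<open>dQ\<close>, so the passage from \<open>(A, B)\<close> to \<open>(A', B)\<close> and on to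
  \<open>(A', dQ)\<close> is legitimate; the second move is \<open>pairing_move\<close> with the two
  arguments exchanged.\<close>

lemma pairing_value:
  assumes "datum A B f g"
  shows "dval f B / dval g A = (- 1) ^ m * (rlc Q fP * rlc Infinity fQ) / (rlc P fQ * rlc Infinity fP)"
proof -
  from assms have *: "A \<in> divisors E" "B \<in> divisors E" "keys A \<inter> keys B = {}"
    "has_divisor E f (frag_cmul (int m) A)" "has_divisor E g (frag_cmul (int m) B)"
    "lin_equiv E A dP" "lin_equiv E B dQ"
    unfolding datum_def lin_equiv_def by auto
  obtain hA where hA: "has_divisor E hA (A - dP)" using *(6) unfolding lin_equiv_def by blast
  obtain hB where hB: "has_divisor E hB (B - dQ)" using *(7) unfolding lin_equiv_def by blast
  have "finite (insert Q (keys B))" "insert Q (keys B) \<subseteq> curve_points E" using divisorsD[OF *(2)] points by auto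
  from exists_moved_divisor[OF P this] obtain h A' where
    h: "has_divisor E h (A' - dP)" "A' \<in> divisors E" "rord Infinity h = 1"
      "keys A' \<inter> insert P (insert Infinity (insert Q (keys B))) = {}" by metis
  have "datum A' dQ (fP * h ^ m) fQ" using h by (intro moved_datum) auto
  hence f': "has_divisor E (fP * h ^ m) (frag_cmul (int m) A')" unfolding datum_def by blast
  have cP: "dval (konst c) A' = 1" if "c \<noteq> 0" for c
    using dval_konst_lin_equiv[OF that _ points(1)] h dP_dQ(1) unfolding lin_equiv_def by blast
  have cQ: "dval (konst c) B = 1" if "c \<noteq> 0" for c
    using dval_konst_lin_equiv[OF that *(7) points(2)] .
  have "has_divisor E (h / hA) ((A' - dP) - (A - dP))" by (rule has_divisor_divide[OF h(1) hA])
  hence kA: "has_divisor E (h / hA) (A' - A)" by simp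
  have 1: "dval (fP * h ^ m) B * dval g A = dval f B * dval g A'"
    by (rule pairing_move[OF kA *(4) f' *(5) *(1) h(2) *(2,3) _ cQ]) (use h(4) in auto)
  have "has_divisor E (inverse hB) (dQ - B)"
    using has_divisor_divide[OF konst(1)[of 1] hB] by (simp add: konst_def ratfun_of_def One_fract_def[symmetric] one_pCons[symmetric] divide_inverse)
  hence 2: "dval fQ A' * dval (fP * h ^ m) B = dval g A' * dval (fP * h ^ m) dQ"
    by (rule pairing_move[OF _ *(5) fQ' f' *(2) dP_dQ(2) h(2) _ _ cP]) (use h(4) dP_dQ(4) in auto)
  have nz: "dval fQ A' \<noteq> 0" "dval g A' \<noteq> 0" "dval g A \<noteq> 0" "dval (fP * h ^ m) B \<noteq> 0"
    using dval_nz has_divisorD(1)[OF *(5)] has_divisorD(1)[OF fQ] has_divisorD(1)[OF f'] * h(2) by blast+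
  have "dval f B / dval g A = dval (fP * h ^ m) B / dval g A'" using 1 nz by (simp add: frac_eq_eq)
  also have "\<dots> = dval (fP * h ^ m) dQ / dval fQ A'" using 2 nz by (simp add: frac_eq_eq mult.commute)
  also have "\<dots> = (- 1) ^ m * (rlc Q fP * rlc Infinity fQ) / (rlc P fQ * rlc Infinity fP)"
    using h by (intro moved_pairing) auto
  finally show ?thesis .
qed

theorem weil_pairing_eq:
  "weil_pairing E m P Q = (- 1) ^ m * (rlc Q fP * rlc Infinity fQ) / (rlc P fQ * rlc Infinity fP)" (is "_ = ?e")
proof -
  have "weil_pairing E m P Q = (THE e. \<exists>A B f g. datum A B f g \<and> e = rf_value_div E f B / rf_value_div E g A)"
    unfolding weil_pairing_def datum_def by (simp only: conj_assoc)
  also have "\<dots> = ?e"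
  proof (rule the_equality)
    have "finite {Q}" "{Q} \<subseteq> curve_points E" using points by auto
    from exists_moved_divisor[OF P this] obtain h A where
      "has_divisor E h (A - dP)" "A \<in> divisors E" "keys A \<inter> {P, Infinity, Q} = {}" by metis
    from moved_datum[OF this] show "\<exists>A B f g. datum A B f g \<and> ?e = rf_value_div E f B / rf_value_div E g A"
      using datum_values pairing_value by metis
  next
    fix e assume "\<exists>A B f g. datum A B f g \<and> e = rf_value_div E f B / rf_value_div E g A"
    thus "e = ?e" using datum_values pairing_value by metis
  qed
  finally show ?thesis .
qed

end

text \<open>This is reciprocity of \<open>f\<close> with the function \<open>x - xP\<close>.\<close>

lemma conjugate_values:
  assumes on: "on_curve xP yP" "on_curve xQ yQ" and neq: "xP \<noteq> xQ"
    and f: "has_divisor E f (frag_cmul (int m) (frag_of (Affine xQ yQ)) - frag_cmul (int m) (frag_of Infinity))"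
  shows "rlc (Affine xP yP) f * rlc (Affine xP (negy xP yP)) f = (rlc Infinity f)\<^sup>2 * (xQ - xP) ^ m"
proof -
  let ?P = "Affine xP yP" and ?P' = "Affine xP (negy xP yP)" and ?Q = "Affine xQ yQ"
  let ?A = "frag_cmul (int m) (frag_of ?Q) - frag_cmul (int m) (frag_of Infinity)"
  let ?B = "frag_of ?P + frag_of ?P' - frag_cmul 2 (frag_of Infinity)"
  have c: "?P \<in> curve_points E" "?P' \<in> curve_points E" "?Q \<in> curve_points E"
    using on on_curve_negy by (auto simp: Affine_curve_iff)
  note n = has_divisorD(1)[OF f]
  have v: "\<not> W dvd vert xP" by simp
  note nv = nonzero_rf_ratfun_of[OF v]
  have "keys ?A \<subseteq> {?Q, Infinity}" by (auto simp: in_keys_iff lookup_minus lookup_frag_of split: if_splits)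
  moreover have "keys ?B \<subseteq> {?P, ?P', Infinity}" by (auto simp: in_keys_iff lookup_minus lookup_add lookup_frag_of split: if_splits)
  ultimately have "keys ?A \<inter> keys ?B \<subseteq> {Infinity}" using neq by auto
  from reciprocity_dval[OF f vert_divisor[OF on(1)] this] have
    "dval f ?B = (- 1) powi (lkp ?A Infinity * lkp ?B Infinity) * dval (ratfun_of (vert xP)) ?A" .
  also have "lkp ?A Infinity * lkp ?B Infinity = 2 * int m" by (simp add: lookup_minus lookup_add)
  also have "(- 1) powi (2 * int m) = (1 :: 'k)" by (simp add: power_int_mult)
  also have "dval f ?B = rlc ?P f * rlc ?P' f / (rlc Infinity f)\<^sup>2"
    using n c by (simp add: dval_diff dval_add dval_cmul dval_frag_of divisors_add divisors_cmul divisors_frag_of)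
  also have "dval (ratfun_of (vert xP)) ?A = (rlc ?Q (ratfun_of (vert xP)) / rlc Infinity (ratfun_of (vert xP))) ^ m"
    using nv c by (simp add: dval_diff dval_cmul dval_frag_of divisors_cmul divisors_frag_of power_divide)
  also have "rlc Infinity (ratfun_of (vert xP)) = 1" using rlc_ratfun_of[OF Infinity_curve v] by (simp add: plc_const)
  also have "rlc ?Q (ratfun_of (vert xP)) = xQ - xP"
    using rlc_ratfun_of[OF c(3) v] alc_eval[OF on(2), of "vert xP"] neq by (simp add: eval2_simps)
  finally show ?thesis using rlc_nz[OF Infinity_curve n] by (simp add: field_simps)
qed

end

theorem theorem1:
  fixes E0 :: "'q::finite_field weierstrass"
    and \<iota> :: "'q \<Rightarrow> 'k::alg_closed_field"
    and E :: "'k weierstrass"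
    and m :: nat
    and P Q :: "'k point"
    and fP fQ :: "'k ratfun"
  assumes "field_embedding \<iota>"
    and "E = map_weierstrass \<iota> E0"
    and "elliptic_curve E"
    and "m > 0"
    and "P \<in> torsion_points E m" and "Q \<in> torsion_points E m"
    and "P \<noteq> Infinity" and "Q \<noteq> Infinity"
    and "P \<noteq> Q" and "P \<noteq> ec_neg E Q"
    and "has_divisor E fP (frag_cmul (int m) (frag_of P) - frag_cmul (int m) (frag_of Infinity))"
    and "has_divisor E fQ (frag_cmul (int m) (frag_of Q) - frag_cmul (int m) (frag_of Infinity))"
  shows "(rf_value E fP Q * rf_value E fQ (ec_neg E P)) /
         (rf_value E fP (ec_neg E Q) * rf_value E fQ P)
           = (- 1) ^ m * (weil_pairing E m P Q)\<^sup>2"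
proof -
  interpret elliptic E using assms(3) by unfold_locales
  have "P \<in> apts" "Q \<in> apts" using assms(5-8) by (auto simp: torsion_points_def apts_def)
  then obtain xP yP xQ yQ where PQ: "P = Affine xP yP" "on_curve xP yP" "Q = Affine xQ yQ" "on_curve xQ yQ"
    by (metis aptsE)
  define P' where "P' = Affine xP (negy xP yP)"
  define Q' where "Q' = Affine xQ (negy xQ yQ)"
  have neg: "ec_neg E P = P'" "ec_neg E Q = Q'" unfolding PQ P'_def Q'_def by (rule ec_neg_negy)+
  have c: "P \<in> curve_points E" "Q \<in> curve_points E" "P' \<in> curve_points E" "Q' \<in> curve_points E"
    using PQ on_curve_negy by (auto simp: P'_def Q'_def Affine_curve_iff)
  have x: "xP \<noteq> xQ"
  proof
    assume "xP = xQ"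
    hence "yP = yQ \<or> yP = negy xQ yQ" using on_curve_fibre[of xQ yQ yP] PQ by auto
    thus False using \<open>xP = xQ\<close> assms(9,10) PQ neg by (auto simp: Q'_def)
  qed
  note nP = has_divisorD(1)[OF assms(11)] and nQ = has_divisorD(1)[OF assms(12)]
  have v: "rf_value E fP Q = rlc Q fP" "rf_value E fP Q' = rlc Q' fP"
    "rf_value E fQ P = rlc P fQ" "rf_value E fQ P' = rlc P' fQ"
    using c x has_divisorD(3)[OF assms(11)] has_divisorD(3)[OF assms(12)] rf_value_eq nP nQ
    by (auto simp: PQ P'_def Q'_def lookup_minus lookup_frag_of)
  define a b p p' q q' X where "a = rlc Infinity fP" "b = rlc Infinity fQ"
    "p = rlc Q fP" "p' = rlc Q' fP" "q = rlc P fQ" "q' = rlc P' fQ" "X = (xQ - xP) ^ m"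
  note defs = this
  have nz: "a \<noteq> 0" "b \<noteq> 0" "p \<noteq> 0" "q \<noteq> 0" "p' \<noteq> 0" "X \<noteq> 0"
    using nP nQ c x rlc_nz by (auto simp: defs)
  have q: "q * q' = b\<^sup>2 * X"
    using conjugate_values[OF PQ(2,4) x, of fQ m] assms(12) PQ unfolding defs P'_def by simp
  have "p * p' = a\<^sup>2 * (xP - xQ) ^ m"
    using conjugate_values[OF PQ(4,2) x[symmetric], of fP m] assms(11) PQ unfolding defs Q'_def by simp
  also have "(xP - xQ) ^ m = (- 1) ^ m * X"
    unfolding defs power_mult_distrib[symmetric] by simp
  finally have p: "p * p' = (- 1) ^ m * (a\<^sup>2 * X)" by (simp only: ac_simps)
  have m1: "(- 1) ^ m * (- 1) ^ m = (1 :: 'k)" by (simp flip: power_add)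
  have "weil_pairing E m P Q = (- 1) ^ m * (p * b) / (q * a)"
    using weil_pairing_eq[OF assms(4) \<open>P \<in> apts\<close> \<open>Q \<in> apts\<close> assms(9) assms(11,12)] unfolding defs .
  hence "(weil_pairing E m P Q)\<^sup>2 = ((- 1) ^ m * (- 1) ^ m) * (p * b)\<^sup>2 / (q * a)\<^sup>2"
    by (simp add: power2_eq_square)
  hence e: "(weil_pairing E m P Q)\<^sup>2 = (p * b)\<^sup>2 / (q * a)\<^sup>2" unfolding m1 by simp
  \<comment> \<open>Multiplied out: \<open>q * q'\<close> is replaced by \<open>b^2 X\<close>, which
    removes \<open>q'\<close>, and the remaining \<open>a^2 X\<close> is read backwards as
    \<open>(- 1) ^ m * (p * p')\<close>, which brings in \<open>p'\<close>.\<close>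
  have "(p * q') * (q * a)\<^sup>2 = p * q * a\<^sup>2 * (q * q')" by (simp add: power2_eq_square)
  also have "\<dots> = p * q * b\<^sup>2 * (((- 1) ^ m * (- 1) ^ m) * (a\<^sup>2 * X))" unfolding q m1 by simp
  also have "\<dots> = p * q * b\<^sup>2 * ((- 1) ^ m * (p * p'))" unfolding p by (simp only: ac_simps)
  also have "\<dots> = ((- 1) ^ m * (p * b)\<^sup>2) * (p' * q)" by (simp add: power2_eq_square)
  finally have "(p * q') / (p' * q) = (- 1) ^ m * (p * b)\<^sup>2 / (q * a)\<^sup>2"
    using nz by (simp add: frac_eq_eq)
  thus ?thesis unfolding neg v e by (simp add: defs)
qed

end
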